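(* Fix $1\le l\le r$ and any fixed vector $\bm{a}\in\mathbb{R}^{p}$. For any given $\bm{\Sigma}$, let $\{\bm{s}_{i}\}_{i=1}^{n}$ be independent samples with $\bm{s}_{i}\sim\mathcal{N}(\bm{0},\bm{\Sigma}+\sigma^{2}\bm{I}_{p})$. Assume that the sample size obeys $$n\geq\left\{ \max_{k:\,k\neq l,\,1\le k\le r}\frac{(\lambda_{k}^{\star}+\sigma^{2})(\lambda_{l}^{\star}+\sigma^{2})}{|\lambda_{l}^{\star}-\lambda_{k}^{\star}|^{2}}\right\} \vee\frac{(\lambda_{l}^{\star}+\sigma^{2})\sigma^{2}}{\lambda_{l}^{\star2}}.$$ Then $$\inf_{u_{\bm{a},l}}\sup_{\bm{\Sigma}\in\mathcal{M}_{1}(\bm{\Sigma}^{\star})}\mathbb{E}\Big[\min\big|u_{\bm{a},l}\pm\bm{a}^{\top}\bm{u}_{l}(\bm{\Sigma})\big|\Big]\gtrsim\max_{k:\,k\neq l,\,1\leq k\leq r}\frac{(\lambda_{k}^{\star}+\sigma^{2})(\lambda_{l}^{\star}+\sigma^{2})}{|\lambda_{l}^{\star}-\lambda_{k}^{\star}|^{2}\,n}\big|\bm{a}^{\top}\bm{u}_{l}^{\star}\big|+\max_{k:\,k\neq l,\,1\leq k\leq r}\frac{\sqrt{(\lambda_{k}^{\star}+\sigma^{2})(\lambda_{l}^{\star}+\sigma^{2})}}{|\lambda_{l}^{\star}-\lambda_{k}^{\star}|\sqrt{n}}\big|\bm{a}^{\top}\bm{u}_{k}^{\star}\big|$$ and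 $$\inf_{u_{\bm{a},l}}\sup_{\bm{\Sigma}\in\mathcal{M}_{2}(\bm{\Sigma}^{\star})}\mathbb{E}\Big[\min\big|u_{\bm{a},l}\pm\bm{a}^{\top}\bm{u}_{l}(\bm{\Sigma})\big|\Big]\gtrsim\sqrt{\frac{(\lambda_{l}^{\star}+\sigma^{2})\sigma^{2}}{\lambda_{l}^{\star2}n}}\,\|\bm{P}_{\bm{U}^{\star\perp}}\bm{a}\|_{2}.$$ Here the infimum is taken over all estimators $u_{\bm{a},l}$ (functions of the samples $\bm{s}_1,\dots,\bm{s}_n$) for the linear form of the $l$-th eigenvector.
   Context: $\bm{\Sigma}^{\star}=\sum_{i=1}^{r}\lambda_{i}^{\star}\bm{u}_{i}^{\star}\bm{u}_{i}^{\star\top}\in\mathbb{R}^{p\times p}$ is a rank-$r$ positive semidefinite matrix with orthonormal $\bm{u}_{i}^{\star}$ and $0<\lambda_{r}^{\star}\leq\cdots\leq\lambda_{1}^{\star}$; $\bm{U}^{\star}=[\bm{u}_{1}^{\star},\dots,\bm{u}_{r}^{\star}]$ and $\bm{P}_{\bm{U}^{\star\perp}}=\bm{I}_p-\bm{U}^{\star}\bm{U}^{\star\top}$. For a symmetric matrix $\bm{\Sigma}$, $\lambda_i(\bm{\Sigma})$ is its $i$-th largest eigenvalue and $\bm{u}_{l}(\bm{\Sigma})$ a unit eigenvector associated with its $l$-th largest eigenvalue. The following are sets of (symmetric positive semidefinite) covariance matrices in $\mathbb{R}^{p\times p}$: $$\mathcal{M}_{1}(\bm{\Sigma}^{\star}):=\Big\{\bm{\Sigma}:\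 \mathsf{rank}(\bm{\Sigma})=r,\ \lambda_{i}(\bm{\Sigma})=\lambda_{i}^{\star}\ (1\leq i\leq r),\ \|\bm{\Sigma}-\bm{\Sigma}^{\star}\|_{\mathrm{F}}\leq\max_{k:\,k\neq l,\,1\le k\le r}\sqrt{\tfrac{(\lambda_{l}^{\star}+\sigma^{2})(\lambda_{k}^{\star}+\sigma^{2})}{n}}\Big\},$$ $$\mathcal{M}_{2}(\bm{\Sigma}^{\star}):=\Big\{\bm{\Sigma}:\ \mathsf{rank}(\bm{\Sigma})=r,\ \lambda_{i}(\bm{\Sigma})=\lambda_{i}^{\star}\ (1\leq i\leq r),\ \|\bm{u}_{l}(\bm{\Sigma})-\bm{u}_{l}^{\star}\|_{2}\leq\sqrt{\tfrac{(\lambda_{l}^{\star}+\sigma^{2})\sigma^{2}}{\lambda_{l}^{\star2}n}}\Big\}.$$ Notation: $\min|a\pm b|=\min\{|a-b|,|a+b|\}$; $a\vee b=\max\{a,b\}$; maxima over $k\neq l$, $1\le k\le r$, are read as zero when $r=1$. $f\gtrsim g$ means $f\geq C|g|$ for some universal constant $C>0$ (when $n$ is sufficiently large). *)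

theory Defs
  imports
    "HOL-Probability.Probability"
    "Jordan_Normal_Form.DL_Rank"
    "Jordan_Normal_Form.Char_Poly"
begin

text \<open>
  Vectors and matrices are those of the Jordan normal form library, whose dimension is an ordinary
  natural number, so that the dimension \<open>p\<close> can be quantified inside the scope of a universal
  constant. Eigenvalues, eigenvectors and samples are numbered from 1, coordinates from 0.
\<close>

unbundle no vec_syntax

definition vec_norm2 :: "real Matrix.vec \<Rightarrow> real" where
  "vec_norm2 v = sqrt (scalar_prod v v)"

definition frobenius_norm :: "real Matrix.mat \<Rightarrow> real" where
  "frobenius_norm A = sqrt (\<Sum>i<dim_row A. \<Sum>j<dim_col A. (A $$ (i, j))\<^sup>2)"

definition psd_mat :: "nat \<Rightarrow> real Matrix.mat \<Rightarrow> bool" where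
  "psd_mat p S \<longleftrightarrow> S \<in> carrier_mat p p \<and> transpose_mat S = S \<and>
     (\<forall>x\<in>carrier_vec p. 0 \<le> scalar_prod x (S *\<^sub>v x))"

text \<open>
  The \<open>i\<close>-th largest eigenvalue, counted with multiplicity. For a symmetric \<open>p \<times> p\<close> matrix the real
  roots of the characteristic polynomial form a multiset of size \<open>p\<close>; the value is only meaningful
  for \<open>1 \<le> i \<le> p\<close>.
\<close>

definition eigval :: "real Matrix.mat \<Rightarrow> nat \<Rightarrow> real" where
  "eigval S i = rev (sorted_list_of_multiset (proots (char_poly S))) ! (i - 1)"

definition is_unit_eigvec :: "nat \<Rightarrow> real Matrix.mat \<Rightarrow> nat \<Rightarrow> real Matrix.vec \<Rightarrow> bool" where
  "is_unit_eigvec p S l v \<longleftrightarrow>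
     v \<in> carrier_vec p \<and> S *\<^sub>v v = eigval S l \<cdot>\<^sub>v v \<and> vec_norm2 v = 1"

text \<open>
  An arbitrary choice of unit eigenvector. When the \<open>l\<close>-th largest eigenvalue is simple, the choice
  is only one of sign, so this is used solely inside quantities that do not depend on the sign.
\<close>

definition unit_eigvec :: "nat \<Rightarrow> real Matrix.mat \<Rightarrow> nat \<Rightarrow> real Matrix.vec" where
  "unit_eigvec p S l = (SOME v. is_unit_eigvec p S l v)"

definition max_over :: "'a set \<Rightarrow> ('a \<Rightarrow> real) \<Rightarrow> real" where
  "max_over K f = (if K = {} then 0 else Max (f ` K))"

definition spiked_mat :: "nat \<Rightarrow> nat \<Rightarrow> (nat \<Rightarrow> real) \<Rightarrow> (nat \<Rightarrow> real Matrix.vec) \<Rightarrow> real Matrix.mat" where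
  "spiked_mat p r lam u = Matrix.mat p p (\<lambda>(a, b). \<Sum>i=1..r. lam i * (u i $ a) * (u i $ b))"

definition proj_perp :: "nat \<Rightarrow> nat \<Rightarrow> (nat \<Rightarrow> real Matrix.vec) \<Rightarrow> real Matrix.mat" where
  "proj_perp p r u =
     (let U = mat_of_cols p (map u [1..<Suc r]) in 1\<^sub>m p - U * transpose_mat U)"

definition M1 :: "nat \<Rightarrow> nat \<Rightarrow> nat \<Rightarrow> nat \<Rightarrow> real \<Rightarrow> (nat \<Rightarrow> real) \<Rightarrow> (nat \<Rightarrow> real Matrix.vec)
    \<Rightarrow> real Matrix.mat set" where
  "M1 p r n l \<sigma> lam u =
     {S. psd_mat p S \<and> vec_space.rank p S = r \<and> (\<forall>i\<in>{1..r}. eigval S i = lam i) \<and>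
         frobenius_norm (S - spiked_mat p r lam u)
           \<le> max_over ({1..r} - {l}) (\<lambda>k. sqrt ((lam l + \<sigma>\<^sup>2) * (lam k + \<sigma>\<^sup>2) / real n))}"

text \<open>
  The constraint on the \<open>l\<close>-th eigenvector depends on its sign; it is required of one of the two
  unit eigenvectors.
\<close>

definition M2 :: "nat \<Rightarrow> nat \<Rightarrow> nat \<Rightarrow> nat \<Rightarrow> real \<Rightarrow> (nat \<Rightarrow> real) \<Rightarrow> (nat \<Rightarrow> real Matrix.vec)
    \<Rightarrow> real Matrix.mat set" where
  "M2 p r n l \<sigma> lam u =
     {S. psd_mat p S \<and> vec_space.rank p S = r \<and> (\<forall>i\<in>{1..r}. eigval S i = lam i) \<and>
         (\<exists>v. is_unit_eigvec p S l v \<and>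
              vec_norm2 (v - u l) \<le> sqrt ((lam l + \<sigma>\<^sup>2) * \<sigma>\<^sup>2 / ((lam l)\<^sup>2 * real n)))}"

text \<open>
  Random vectors in \<open>\<real>\<^sup>p\<close> take values in the product \<open>\<sigma>\<close>-algebra on functions on \<open>{..<p}\<close>.
  The centred normal law with positive semidefinite covariance \<open>S\<close> (degenerate \<open>S\<close> allowed) is the
  law of \<open>A z\<close> for a standard normal \<open>z\<close> and any square \<open>A\<close> with \<open>A A\<^sup>T = S\<close>; such an \<open>A\<close> exists and
  the law does not depend on which one is chosen.
\<close>

definition sample_space :: "nat \<Rightarrow> (nat \<Rightarrow> real) measure" where
  "sample_space p = (\<Pi>\<^sub>M i\<in>{..<p}. borel)"

definition cov_root :: "nat \<Rightarrow> real Matrix.mat \<Rightarrow> real Matrix.mat" where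
  "cov_root p S = (SOME A. A \<in> carrier_mat p p \<and> A * transpose_mat A = S)"

definition normal_law :: "nat \<Rightarrow> real Matrix.mat \<Rightarrow> (nat \<Rightarrow> real) measure" where
  "normal_law p S =
     distr (\<Pi>\<^sub>M i\<in>{..<p}. density lborel (\<lambda>x. ennreal (std_normal_density x))) (sample_space p)
       (\<lambda>z. \<lambda>i\<in>{..<p}. \<Sum>j<p. cov_root p S $$ (i, j) * z j)"

definition estimators :: "nat \<Rightarrow> nat \<Rightarrow> ((nat \<Rightarrow> nat \<Rightarrow> real) \<Rightarrow> real) set" where
  "estimators p n = borel_measurable (\<Pi>\<^sub>M i\<in>{1..n}. sample_space p)"

definition risk :: "nat \<Rightarrow> nat \<Rightarrow> nat \<Rightarrow> real \<Rightarrow> real Matrix.vec \<Rightarrow> real Matrix.mat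
    \<Rightarrow> ((nat \<Rightarrow> nat \<Rightarrow> real) \<Rightarrow> real) \<Rightarrow> ennreal" where
  "risk p n l \<sigma> a S est =
     (\<integral>\<^sup>+ s. ennreal (min \<bar>est s - scalar_prod a (unit_eigvec p S l)\<bar>
                        \<bar>est s + scalar_prod a (unit_eigvec p S l)\<bar>)
        \<partial>(\<Pi>\<^sub>M i\<in>{1..n}. normal_law p (S + \<sigma>\<^sup>2 \<cdot>\<^sub>m 1\<^sub>m p)))"

definition minimax_risk :: "nat \<Rightarrow> nat \<Rightarrow> nat \<Rightarrow> real \<Rightarrow> real Matrix.vec \<Rightarrow> real Matrix.mat set
    \<Rightarrow> ennreal" where
  "minimax_risk p n l \<sigma> a M = (INF est\<in>estimators p n. SUP S\<in>M. risk p n l \<sigma> a S est)"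

end

theory Submission
  imports Defs
begin

text \<open>
  Both bounds follow from Le Cam's two-point method. Against \<open>\<Sigma>\<^sup>\<star>\<close> one sets the matrix obtained by
  rotating the eigenvector \<open>u\<^sub>l\<close> by a small angle in a plane that it spans with a second eigenvector of
  \<open>\<Sigma>\<^sup>\<star>\<close>: with \<open>u\<^sub>k\<close> for the first class, and with the direction of the residual of \<open>a\<close> after
  projection onto the span of the \<open>u\<^sub>i\<close>, whose eigenvalue is zero, for the second class. Rotation keeps
  the spectrum and the rank, so the competitor lies in the class as soon as it is close enough. The two
  cases are one argument: \<open>\<Sigma>\<^sup>\<star>\<close> is written in a full orthonormal eigenbasis, and \<open>\<alpha>\<close>, \<open>\<beta>\<close> denote the
  eigenvalues of \<open>\<Sigma>\<^sup>\<star> + \<sigma>\<^sup>2 I\<close> in the plane of the rotation (\<open>minimax_rotation\<close>).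

  The two covariances, restricted to the plane, are mirror images in the axis at half the angle.
  Conditionally on the coordinate across that axis, the coordinate along it is normal with the same
  variance under both laws and with opposite regression slopes. Hence both laws are images, under one
  common linear map, of a standard normal vector and of its image under a shear
  \<open>z\<^sub>k \<mapsto> z\<^sub>k + y z\<^sub>l\<close> (\<open>normal_law_rotate_pair\<close>), where \<open>y\<^sup>2\<close> is \<open>(\<alpha> - \<beta>)\<^sup>2 / (\<alpha> \<beta>)\<close> times the squared
  sine of the angle. The reduction also covers the singular covariances that occur for \<open>\<sigma> = 0\<close>,
  because it does not use densities on the sample space. It rests on the fact that a centred normal
  law depends only on the covariance and not on the chosen square root, which is an instance of the
  uniqueness theorem for characteristic functions on a finite product of lines
  (\<open>char_PiM_uniqueness\<close>).

  The sheared standard normal law has an explicit density with respect to the unsheared one, its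
  Hellinger affinity is at least \<open>1 - y\<^sup>2 / 8\<close> (\<open>hellinger_affinity_shear\<close>), and affinities multiply over
  independent samples. With \<open>\<delta>\<^sup>2 = \<alpha> \<beta> / ((\<alpha> - \<beta>)\<^sup>2 n)\<close>, a half angle of sine \<open>\<delta> / 4\<close> gives
  \<open>n y\<^sup>2 \<le> 1/4\<close>, and the two product laws cannot be told apart reliably (\<open>shear_two_point_bound\<close>). Finally
  the loss \<open>min \<bar>t \<plusminus> x\<bar>\<close> only sees \<open>\<bar>x\<bar>\<close>, and rotating towards the right side changes \<open>\<bar>a \<bullet> u\<^sub>l\<bar>\<close> by at
  least a constant multiple of \<open>\<delta>\<^sup>2 \<bar>a \<bullet> u\<^sub>l\<bar> + \<delta> \<bar>a \<bullet> u\<^sub>k\<bar>\<close> (\<open>rotation_gap\<close>): the first term is the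
  second-order shrinkage by the cosine, the second one the first-order contribution of the sine.
\<close>

section \<open>Characteristic functions on finite products\<close>

text \<open>
  Normalised by its integral, \<open>g\<close> is a probability density, and Levy's uniqueness theorem on the line
  applies to the law of \<open>X\<close> under it. The bounds on \<open>g\<close> keep the normalising constant positive and
  finite.
\<close>

lemma weighted_marginal_eq:
  fixes P Q :: "'a measure" and X g :: "'a \<Rightarrow> real"
  assumes P: "prob_space P" and Q: "prob_space Q"
    and meas: "X \<in> borel_measurable P" "X \<in> borel_measurable Q"
      "g \<in> borel_measurable P" "g \<in> borel_measurable Q"
    and g: "\<And>x. 1 \<le> g x" "\<And>x. g x \<le> 3"
    and eq: "\<And>s. (\<integral>x. g x *\<^sub>R iexp (s * X x) \<partial>P) = (\<integral>x. g x *\<^sub>R iexp (s * X x) \<partial>Q)"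
    and A: "A \<in> sets borel"
  shows "(\<integral>x. g x * indicator A (X x) \<partial>P) = (\<integral>x. g x * indicator A (X x) \<partial>Q)"
proof -
  define c where "c = (\<integral>x. g x \<partial>P)"
  define law where "law M = distr (density M (\<lambda>x. ennreal (g x / c))) borel X" for M :: "'a measure"
  have int: "integrable M g" if "prob_space M" "g \<in> borel_measurable M" for M :: "'a measure"
  proof -
    interpret prob_space M by fact
    show ?thesis using that(2) g
      by (intro integrable_const_bound[of _ 3]) (auto intro!: AE_I2 simp: abs_le_iff intro: order_trans[of _ "-1"])
  qed
  have "complex_of_real (\<integral>x. g x \<partial>P) = complex_of_real (\<integral>x. g x \<partial>Q)"
    using eq[of 0] by (simp add: scaleR_conv_of_real)
  then have cQ: "c = (\<integral>x. g x \<partial>Q)" unfolding c_def by (simp only: of_real_eq_iff)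
  have c: "c \<ge> 1"
  proof -
    interpret prob_space P by fact
    have "(\<integral>x. 1 \<partial>P) \<le> (\<integral>x. g x \<partial>P)"
      using int[OF P meas(3)] g by (intro integral_mono) auto
    then show ?thesis by (simp add: c_def prob_space)
  qed
  have dist: "real_distribution (law M)"
    and char: "char (law M) s = (\<integral>x. g x *\<^sub>R iexp (s * X x) \<partial>M) / c"
    and meas_law: "measure (law M) A = (\<integral>x. g x * indicator A (X x) \<partial>M) / c"
    if M: "prob_space M" "X \<in> borel_measurable M" "g \<in> borel_measurable M" "c = (\<integral>x. g x \<partial>M)"
    for M :: "'a measure" and s
  proof -
    note [measurable] = M(2,3) A
    have gc: "0 \<le> g x / c" for x using g(1)[of x] c by (auto intro: order_trans[of _ 1])
    interpret M: prob_space M by fact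
    have "(\<integral>\<^sup>+x. ennreal (g x / c) \<partial>M) = ennreal (\<integral>x. g x / c \<partial>M)"
      using gc int[OF M(1,3)] by (intro nn_integral_eq_integral) auto
    then have "emeasure (density M (\<lambda>x. ennreal (g x / c))) (space M) = ennreal (\<integral>x. g x / c \<partial>M)"
      by (subst emeasure_density) (auto cong: nn_integral_cong)
    also have "(\<integral>x. g x / c \<partial>M) = 1" using c M(4) by simp
    finally have D: "prob_space (density M (\<lambda>x. ennreal (g x / c)))"
      by (intro prob_spaceI) simp
    then interpret D: prob_space "density M (\<lambda>x. ennreal (g x / c))" .
    have "prob_space (law M)" unfolding law_def by (rule D.prob_space_distr) simp
    then show "real_distribution (law M)"
      unfolding real_distribution_def real_distribution_axioms_def by (simp add: law_def)
    have "char (law M) s = (\<integral>x. (g x / c) *\<^sub>R iexp (s * X x) \<partial>M)"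
      unfolding char_def law_def using gc
      by (subst integral_distr, simp, simp, subst integral_density) auto
    also have "\<dots> = (\<integral>x. (1 / c) *\<^sub>R (g x *\<^sub>R iexp (s * X x)) \<partial>M)"
      by (simp add: divide_inverse mult.commute)
    finally show "char (law M) s = (\<integral>x. g x *\<^sub>R iexp (s * X x) \<partial>M) / c"
      by (simp add: scaleR_conv_of_real divide_inverse mult.commute)
    have "measure (law M) A = (\<integral>y. indicator A y \<partial>law M)" by (simp add: law_def)
    also have "\<dots> = (\<integral>x. (g x / c) *\<^sub>R indicator A (X x) \<partial>M)"
      unfolding law_def using gc
      by (subst integral_distr, simp, simp, subst integral_density) auto
    finally show "measure (law M) A = (\<integral>x. g x * indicator A (X x) \<partial>M) / c" by simp
  qed
  have "law P = law Q"
  proof (rule Levy_uniqueness[OF dist[OF P meas(1,3) c_def] dist[OF Q meas(2,4) cQ]])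
    show "char (law P) = char (law Q)"
      unfolding fun_eq_iff char[OF P meas(1,3) c_def] char[OF Q meas(2,4) cQ] eq by simp
  qed
  then have "measure (law P) A = measure (law Q) A" by simp
  then show ?thesis using meas_law[OF P meas(1,3) c_def] meas_law[OF Q meas(2,4) cQ] c by simp
qed

text \<open>
  The complex weight \<open>R\<close> will carry the other coordinates. It splits into real and imaginary parts,
  which is why the hypothesis is needed for its conjugate too, and adding the constant \<open>2\<close> to either
  part gives a positive weight. The hypothesis \<open>eq1\<close> takes that constant away again.
\<close>

lemma char_eq_imp_indicator_eq:
  fixes P Q :: "'a measure" and X :: "'a \<Rightarrow> real" and R :: "'a \<Rightarrow> complex"
  assumes P: "prob_space P" and Q: "prob_space Q" and sets: "sets P = sets Q"
    and X[measurable]: "X \<in> borel_measurable P" and R[measurable]: "R \<in> borel_measurable P"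
    and bound: "\<And>x. norm (R x) \<le> 1"
    and eq1: "\<And>s. (\<integral>x. iexp (s * X x) \<partial>P) = (\<integral>x. iexp (s * X x) \<partial>Q)"
    and eqR: "\<And>s. (\<integral>x. R x * iexp (s * X x) \<partial>P) = (\<integral>x. R x * iexp (s * X x) \<partial>Q)"
    and eqC: "\<And>s. (\<integral>x. cnj (R x) * iexp (s * X x) \<partial>P) = (\<integral>x. cnj (R x) * iexp (s * X x) \<partial>Q)"
    and A[measurable]: "A \<in> sets borel"
  shows "(\<integral>x. R x * indicator A (X x) \<partial>P) = (\<integral>x. R x * indicator A (X x) \<partial>Q)"
proof -
  have XQ[measurable]: "X \<in> borel_measurable Q" and RQ[measurable]: "R \<in> borel_measurable Q"
    using X R by (simp_all cong: measurable_cong_sets add: sets)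
  have bdd: "integrable M f" if "prob_space M" "f \<in> borel_measurable M" "\<And>x. norm (f x) \<le> 3"
    for M and f :: "'a \<Rightarrow> 'b::{banach, second_countable_topology}"
  proof -
    interpret prob_space M by fact
    show ?thesis using that by (intro integrable_const_bound[of _ 3]) auto
  qed
  have real_case: "(\<integral>x. f x * indicator A (X x) \<partial>P) = (\<integral>x. f x * indicator A (X x) \<partial>Q)"
    if f[measurable]: "f \<in> borel_measurable P" and fb: "\<And>x. \<bar>f x\<bar> \<le> 1"
      and feq: "\<And>s. (\<integral>x. f x *\<^sub>R iexp (s * X x) \<partial>P) = (\<integral>x. f x *\<^sub>R iexp (s * X x) \<partial>Q)"
    for f :: "'a \<Rightarrow> real"
  proof -
    have fQ[measurable]: "f \<in> borel_measurable Q"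
      using f by (simp cong: measurable_cong_sets add: sets)
    have f3: "\<bar>f x\<bar> \<le> 3" for x using fb[of x] by simp
    have int: "integrable P (\<lambda>x. f x *\<^sub>R iexp (s * X x))" "integrable Q (\<lambda>x. f x *\<^sub>R iexp (s * X x))"
      "integrable P (\<lambda>x. 2 *\<^sub>R iexp (s * X x))" "integrable Q (\<lambda>x. 2 *\<^sub>R iexp (s * X x))" for s
      using P Q f3 by (auto intro!: bdd simp del: scaleR_scaleR)
    have "(\<integral>x. (2 + f x) *\<^sub>R iexp (s * X x) \<partial>P) = (\<integral>x. (2 + f x) *\<^sub>R iexp (s * X x) \<partial>Q)" for s
      unfolding scaleR_add_left
      using int[of s] eq1[of s] feq[of s] by (simp del: of_real_mult)
    moreover have "1 \<le> 2 + f x" "2 + f x \<le> 3" for x using fb[of x] by (auto simp: abs_le_iff)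
    ultimately have *: "(\<integral>x. (2 + f x) * indicator A (X x) \<partial>P) = (\<integral>x. (2 + f x) * indicator A (X x) \<partial>Q)"
      using A by (intro weighted_marginal_eq[OF P Q]) auto
    have **: "(\<integral>x. 1 * indicator A (X x) \<partial>P) = (\<integral>x. 1 * indicator A (X x) \<partial>Q :: real)"
      using A eq1 by (intro weighted_marginal_eq[OF P Q]) auto
    have int2: "integrable P (\<lambda>x. f x * indicator A (X x))" "integrable Q (\<lambda>x. f x * indicator A (X x))"
      "integrable P (\<lambda>x. 2 * indicator A (X x) :: real)" "integrable Q (\<lambda>x. 2 * indicator A (X x) :: real)"
      using P Q f3 by (auto intro!: bdd split: split_indicator)
    show ?thesis using * ** int2 by (simp add: distrib_right)
  qed
  have [measurable]: "cnj \<in> borel_measurable borel"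
    by (intro borel_measurable_continuous_onI continuous_intros)
  have norm3: "norm (R x) \<le> 3" for x using bound[of x] by simp
  have int: "integrable M (\<lambda>x. R x * iexp (s * X x))" "integrable M (\<lambda>x. cnj (R x) * iexp (s * X x))"
    if "M = P \<or> M = Q" for M s
    using P Q norm3 that by (auto intro!: bdd simp: norm_mult)
  have Re: "(\<integral>x. Re (R x) *\<^sub>R iexp (s * X x) \<partial>P) = (\<integral>x. Re (R x) *\<^sub>R iexp (s * X x) \<partial>Q)" for s
  proof -
    have "Re z *\<^sub>R y = (z * y + cnj z * y) / 2" for z y :: complex
      by (simp add: complex_eq_iff)
    then have "(\<integral>x. Re (R x) *\<^sub>R iexp (s * X x) \<partial>M) =
        (\<integral>x. (R x * iexp (s * X x) + cnj (R x) * iexp (s * X x)) / 2 \<partial>M)" for M by (simp only:)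
    moreover have "(\<integral>x. (R x * iexp (s * X x) + cnj (R x) * iexp (s * X x)) / 2 \<partial>M) = ((\<integral>x. R x * iexp (s * X x) \<partial>M) + (\<integral>x. cnj (R x) * iexp (s * X x) \<partial>M)) / 2"
      if "M = P \<or> M = Q" for M
      unfolding integral_divide_zero
      by (subst Bochner_Integration.integral_add) (use int[OF that, of s] in auto)
    ultimately show ?thesis by (simp only: eqR eqC simp_thms)
  qed
  have Im: "(\<integral>x. Im (R x) *\<^sub>R iexp (s * X x) \<partial>P) = (\<integral>x. Im (R x) *\<^sub>R iexp (s * X x) \<partial>Q)" for s
  proof -
    have "Im z *\<^sub>R y = (z * y - cnj z * y) / (2 * \<i>)" for z y :: complex
      by (simp add: complex_eq_iff Re_divide Im_divide)
    then have "(\<integral>x. Im (R x) *\<^sub>R iexp (s * X x) \<partial>M) =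
        (\<integral>x. (R x * iexp (s * X x) - cnj (R x) * iexp (s * X x)) / (2 * \<i>) \<partial>M)" for M by (simp only:)
    moreover have "(\<integral>x. (R x * iexp (s * X x) - cnj (R x) * iexp (s * X x)) / (2 * \<i>) \<partial>M) = ((\<integral>x. R x * iexp (s * X x) \<partial>M) - (\<integral>x. cnj (R x) * iexp (s * X x) \<partial>M)) / (2 * \<i>)"
      if "M = P \<or> M = Q" for M
      unfolding integral_divide_zero
      by (subst Bochner_Integration.integral_diff) (use int[OF that, of s] in auto)
    ultimately show ?thesis by (simp only: eqR eqC simp_thms)
  qed
  have *: "(\<integral>x. R x * indicator A (X x) \<partial>M) =
      Complex (\<integral>x. Re (R x) * indicator A (X x) \<partial>M) (\<integral>x. Im (R x) * indicator A (X x) \<partial>M)"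
    if "M = P \<or> M = Q" for M
  proof -
    have "integrable M (\<lambda>x. R x * indicator A (X x))"
      using P Q norm3 that by (auto intro!: bdd simp: norm_mult split: split_indicator)
    then show ?thesis
      by (auto simp: complex_eq_iff integral_Re[symmetric] integral_Im[symmetric]
        intro!: Bochner_Integration.integral_cong split: split_indicator)
  qed
  have ReIm: "\<bar>Re (R x)\<bar> \<le> 1" "\<bar>Im (R x)\<bar> \<le> 1" for x
    using bound[of x] abs_Re_le_cmod[of "R x"] abs_Im_le_cmod[of "R x"] by linarith+
  show ?thesis unfolding *[of P, simplified] *[of Q, simplified]
    using real_case[of "\<lambda>x. Re (R x)"] real_case[of "\<lambda>x. Im (R x)"] Re Im ReIm by simp
qed

text \<open>
  The exponentials are replaced by indicator functions one coordinate at a time, for all frequencies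
  in the remaining coordinates simultaneously. Once all are replaced, the measures agree on boxes.
\<close>

theorem char_PiM_uniqueness:
  fixes P Q :: "('i \<Rightarrow> real) measure"
  assumes I: "finite I" and P: "prob_space P" and Q: "prob_space Q"
    and sP: "sets P = sets (\<Pi>\<^sub>M i\<in>I. borel)" and sQ: "sets Q = sets (\<Pi>\<^sub>M i\<in>I. borel)"
    and eq: "\<And>t. (\<integral>x. iexp (\<Sum>i\<in>I. t i * x i) \<partial>P) = (\<integral>x. iexp (\<Sum>i\<in>I. t i * x i) \<partial>Q)"
  shows "P = Q"
proof -
  note [measurable_cong] = sP sQ
  interpret P: prob_space P by fact
  interpret Q: prob_space Q by fact
  have claim: "(\<integral>x. (\<Prod>i\<in>J. indicator (A i) (x i)) * iexp (\<Sum>i\<in>I - J. t i * x i) \<partial>P)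
      = (\<integral>x. (\<Prod>i\<in>J. indicator (A i) (x i)) * iexp (\<Sum>i\<in>I - J. t i * x i) \<partial>Q)"
    if "J \<subseteq> I" "\<And>i. i \<in> J \<Longrightarrow> A i \<in> sets borel" for J A t
    using finite_subset[OF that(1) I] that
  proof (induction J arbitrary: t rule: finite_induct)
    case empty
    then show ?case using eq by simp
  next
    case (insert j J)
    let ?R = "\<lambda>t x. (\<Prod>i\<in>J. indicator (A i) (x i)) * iexp (\<Sum>i\<in>I - insert j J. t i * x i)"
    have IJ: "I - J = insert j (I - insert j J)" using insert by auto
    have fin: "finite (I - insert j J)" using I by simp
    have fJ: "finite J" by fact
    have A[measurable]: "A i \<in> sets borel" if "i \<in> J" for i using insert that by auto
    have IH: "(\<integral>x. ?R t x * iexp (s * x j) \<partial>P) = (\<integral>x. ?R t x * iexp (s * x j) \<partial>Q)" for t s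
    proof -
      have "(\<Sum>i\<in>I - J. (t(j := s)) i * x i) = s * x j + (\<Sum>i\<in>I - insert j J. t i * x i)" for x :: "'i \<Rightarrow> real"
        unfolding IJ using fin by (subst sum.insert) (auto intro!: sum.cong)
      then show ?thesis using insert.IH[of "t(j := s)"] insert.prems
        by (simp add: exp_add distrib_left mult_ac)
    qed
    have cnjR: "cnj (?R t x) = ?R (\<lambda>i. - t i) x" for x
      by (simp add: cnj_prod exp_cnj sum_negf cong: prod.cong) (auto intro!: prod.cong split: split_indicator)
    have "(\<integral>x. ?R t x * indicator (A j) (x j) \<partial>P) = (\<integral>x. ?R t x * indicator (A j) (x j) \<partial>Q)"
    proof (rule char_eq_imp_indicator_eq[OF P Q])
      show "sets P = sets Q" using sP sQ by simp
      have jI: "j \<in> I" using insert by simp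
      show "(\<lambda>x. x j) \<in> borel_measurable P" using jI by measurable
      have JI: "i \<in> I" if "i \<in> J" for i using that insert by auto
      show "?R t \<in> borel_measurable P" using JI by measurable
      show "norm (?R t x) \<le> 1" for x
        using fJ by (auto simp: norm_mult prod_norm[symmetric] intro!: prod_le_1 split: split_indicator)
      show "(\<integral>x. iexp (s * x j) \<partial>P) = (\<integral>x. iexp (s * x j) \<partial>Q)" for s
        using eq[of "\<lambda>i. if i = j then s else 0"] I jI
        by (simp add: if_distrib[of "\<lambda>y. y * _"] cong: if_cong)
      show "(\<integral>x. ?R t x * iexp (s * x j) \<partial>P) = (\<integral>x. ?R t x * iexp (s * x j) \<partial>Q)" for s by (rule IH)
      show "(\<integral>x. cnj (?R t x) * iexp (s * x j) \<partial>P) = (\<integral>x. cnj (?R t x) * iexp (s * x j) \<partial>Q)" for s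
        unfolding cnjR by (rule IH)
      show "A j \<in> sets borel" using insert by simp
    qed
    then show ?case using insert by (simp add: mult_ac)
  qed
  show ?thesis
  proof (rule measure_eqI_PiM_finite[OF I sP sQ])
    fix A :: "'i \<Rightarrow> real set" assume A: "\<And>i. i \<in> I \<Longrightarrow> A i \<in> sets borel"
    have box: "complex_of_real (measure M (Pi\<^sub>E I A)) = (\<integral>x. (\<Prod>i\<in>I. indicator (A i) (x i)) \<partial>M)"
      if M: "prob_space M" "sets M = sets (\<Pi>\<^sub>M i\<in>I. borel)" for M
    proof -
      have sp: "space M = PiE I (\<lambda>_. UNIV)" using sets_eq_imp_space_eq[OF M(2)] by (simp add: space_PiM)
      have "Pi\<^sub>E I A \<in> sets M" unfolding M(2) using A I by (intro sets_PiM_I_finite) auto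
      then have "(\<integral>x. complex_of_real (indicator (Pi\<^sub>E I A) x) \<partial>M) = complex_of_real (measure M (Pi\<^sub>E I A))"
        by (simp add: integral_complex_of_real del: of_real_indicator)
      moreover have "(\<Prod>i\<in>I. indicator (A i) (x i)) = complex_of_real (indicator (Pi\<^sub>E I A) x)" if "x \<in> space M" for x
        using that I sp by (auto simp: indicator_def prod_zero_iff PiE_iff split: if_splits intro!: prod.neutral)
      ultimately show ?thesis by (metis (mono_tags, lifting) Bochner_Integration.integral_cong)
    qed
    have "complex_of_real (measure P (Pi\<^sub>E I A)) = complex_of_real (measure Q (Pi\<^sub>E I A))"
      using claim[of I A] A unfolding box[OF P sP] box[OF Q sQ] by simp
    then show "emeasure P (Pi\<^sub>E I A) = emeasure Q (Pi\<^sub>E I A)"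
      by (simp add: P.emeasure_eq_measure Q.emeasure_eq_measure)
  next
    show "range (\<lambda>_::nat. Pi\<^sub>E I (\<lambda>_. UNIV)) \<subseteq> prod_algebra I (\<lambda>_. borel :: real measure)"
      using prod_algebraI_finite[OF I, of "\<lambda>_. UNIV" "\<lambda>_. borel :: real measure"] by auto
  qed (auto simp: space_PiM P.emeasure_eq_measure)
qed

section \<open>Normal laws as linear images of a standard normal vector\<close>

abbreviation std_normal_vec :: "nat \<Rightarrow> (nat \<Rightarrow> real) measure" where
  "std_normal_vec p \<equiv> \<Pi>\<^sub>M i\<in>{..<p}. std_normal_distribution"

definition linear_image :: "nat \<Rightarrow> (nat \<Rightarrow> nat \<Rightarrow> real) \<Rightarrow> (nat \<Rightarrow> real) \<Rightarrow> nat \<Rightarrow> real" where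
  "linear_image p B z = (\<lambda>i\<in>{..<p}. \<Sum>j<p. B i j * z j)"

lemma prob_space_std_normal: "prob_space std_normal_distribution"
  using real_dist_normal_dist by (simp add: real_distribution_def)

lemma prob_space_std_normal_vec: "prob_space (std_normal_vec p)"
  by (intro prob_space_PiM prob_space_std_normal)

lemma sets_std_normal_vec: "sets (std_normal_vec p) = sets (sample_space p)"
  unfolding sample_space_def by (intro sets_PiM_cong) auto

lemma measurable_std_normal_coord:
  "l \<in> J \<Longrightarrow> (\<lambda>z. z l) \<in> borel_measurable (\<Pi>\<^sub>M i\<in>J. std_normal_distribution)"
  using measurable_component_singleton[of l J "\<lambda>_. std_normal_distribution"] by simp

lemma measurable_std_normal_vec_coord [measurable]:
  "l < p \<Longrightarrow> (\<lambda>z. z l) \<in> borel_measurable (std_normal_vec p)"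
  by (simp add: measurable_std_normal_coord)

lemma measurable_linear_image [measurable]:
  "linear_image p B \<in> measurable (sample_space p) (sample_space p)"
  unfolding linear_image_def sample_space_def by measurable

lemma measurable_linear_image_std [measurable]:
  "linear_image p B \<in> measurable (std_normal_vec p) (sample_space p)"
  using measurable_linear_image by (simp cong: measurable_cong_sets add: sets_std_normal_vec)

lemma char_linear_image:
  "(\<integral>x. iexp (\<Sum>i<p. t i * x i) \<partial>distr (std_normal_vec p) (sample_space p) (linear_image p B))
    = exp (- (\<Sum>j<p. (\<Sum>i<p. t i * B i j)\<^sup>2) / 2)"
proof -
  interpret product_sigma_finite "\<lambda>_::nat. std_normal_distribution"
    by (intro product_sigma_finite.intro prob_space_imp_sigma_finite prob_space_std_normal)
  interpret std: prob_space std_normal_distribution by (rule prob_space_std_normal)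
  let ?b = "\<lambda>j. \<Sum>i<p. t i * B i j"
  have meas: "(\<lambda>x. iexp (\<Sum>i<p. t i * x i)) \<in> borel_measurable (sample_space p)"
    unfolding sample_space_def by measurable
  have "(\<integral>x. iexp (\<Sum>i<p. t i * x i) \<partial>distr (std_normal_vec p) (sample_space p) (linear_image p B))
      = (\<integral>z. iexp (\<Sum>i<p. t i * linear_image p B z i) \<partial>std_normal_vec p)"
    by (rule integral_distr[OF measurable_linear_image_std meas])
  also have "\<dots> = (\<integral>z. (\<Prod>j<p. iexp (?b j * z j)) \<partial>std_normal_vec p)"
  proof (intro Bochner_Integration.integral_cong refl)
    fix z
    have "(\<Sum>i<p. t i * linear_image p B z i) = (\<Sum>j<p. ?b j * z j)"
      unfolding linear_image_def
      by (simp add: sum_distrib_left sum_distrib_right mult.assoc) (rule sum.swap)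
    then show "iexp (\<Sum>i<p. t i * linear_image p B z i) = (\<Prod>j<p. iexp (?b j * z j))"
      by (simp add: exp_sum sum_distrib_left)
  qed
  also have "\<dots> = (\<Prod>j<p. \<integral>x. iexp (?b j * x) \<partial>std_normal_distribution)"
    by (intro product_integral_prod) (auto intro!: std.integrable_const_bound[of _ 1])
  also have "\<dots> = (\<Prod>j<p. complex_of_real (exp (- (?b j)\<^sup>2 / 2)))"
    using char_std_normal_distribution[THEN fun_cong] unfolding char_def by (intro prod.cong refl) blast
  also have "\<dots> = exp (- (\<Sum>j<p. (?b j)\<^sup>2) / 2)"
    by (simp add: exp_sum[symmetric] sum_negf sum_divide_distrib flip: of_real_prod exp_of_real)
  finally show ?thesis .
qed

text \<open>
  The characteristic function of \<open>B z\<close> depends on \<open>B\<close> only through \<open>B B\<^sup>T\<close>, so any square root of the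
  covariance may replace the arbitrary one in the definition of \<^const>\<open>normal_law\<close>.
\<close>

lemma normal_law_eq_linear_image:
  assumes S: "S \<in> carrier_mat p p"
    and B: "\<And>a b. a < p \<Longrightarrow> b < p \<Longrightarrow> (\<Sum>j<p. B a j * B b j) = S $$ (a, b)"
  shows "normal_law p S = distr (std_normal_vec p) (sample_space p) (linear_image p B)"
proof -
  define A where "A = cov_root p S"
  let ?B = "Matrix.mat p p (\<lambda>(i, j). B i j)"
  have "?B * transpose_mat ?B = S"
    using S B by (intro eq_matI) (auto simp: scalar_prod_def atLeast0LessThan)
  then have "?B \<in> carrier_mat p p \<and> ?B * transpose_mat ?B = S" by simp
  then have "A \<in> carrier_mat p p \<and> A * transpose_mat A = S"
    unfolding A_def cov_root_def by (rule someI)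
  then have A: "(\<Sum>j<p. A $$ (a, j) * A $$ (b, j)) = S $$ (a, b)" if "a < p" "b < p" for a b
    using that by (auto simp: scalar_prod_def atLeast0LessThan)
  let ?L = "\<lambda>B. distr (std_normal_vec p) (sample_space p) (linear_image p B)"
  have quad: "(\<Sum>j<p. (\<Sum>i<p. t i * C i j)\<^sup>2) = (\<Sum>a<p. \<Sum>b<p. t a * t b * S $$ (a, b))"
    if C: "\<And>a b. a < p \<Longrightarrow> b < p \<Longrightarrow> (\<Sum>j<p. C a j * C b j) = S $$ (a, b)" for C :: "nat \<Rightarrow> nat \<Rightarrow> real" and t
  proof -
    have "(\<Sum>j<p. (\<Sum>i<p. t i * C i j)\<^sup>2) = (\<Sum>j<p. \<Sum>a<p. \<Sum>b<p. t a * t b * (C a j * C b j))"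
      by (simp add: power2_eq_square sum_product mult_ac)
    also have "\<dots> = (\<Sum>a<p. \<Sum>b<p. \<Sum>j<p. t a * t b * (C a j * C b j))"
      by (subst sum.swap) (intro sum.cong refl sum.swap)
    also have "\<dots> = (\<Sum>a<p. \<Sum>b<p. t a * t b * S $$ (a, b))"
      by (intro sum.cong refl) (simp add: C sum_distrib_left[symmetric])
    finally show ?thesis .
  qed
  have "?L (\<lambda>i j. A $$ (i, j)) = ?L B"
  proof (rule char_PiM_uniqueness[of "{..<p}"])
    show "prob_space (?L C)" for C
      by (intro prob_space.prob_space_distr prob_space_std_normal_vec) simp
    then show "prob_space (?L B)" .
    show "sets (?L C) = sets (\<Pi>\<^sub>M i\<in>{..<p}. borel)" for C by (simp add: sample_space_def)
    then show "sets (?L B) = sets (\<Pi>\<^sub>M i\<in>{..<p}. borel)" .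
    fix t
    show "(\<integral>x. iexp (\<Sum>i<p. t i * x i) \<partial>?L (\<lambda>i j. A $$ (i, j))) = (\<integral>x. iexp (\<Sum>i<p. t i * x i) \<partial>?L B)"
      using quad[of "\<lambda>i j. A $$ (i, j)" t] quad[of B t] A B by (simp only: char_linear_image)
  qed simp
  then show ?thesis unfolding normal_law_def A_def linear_image_def by simp
qed

text \<open>Gaussian change of drift (Cameron and Martin) in one dimension.\<close>

lemma std_normal_shift:
  assumes [measurable]: "h \<in> borel_measurable borel"
  shows "(\<integral>\<^sup>+t. h (t + b) \<partial>std_normal_distribution)
    = (\<integral>\<^sup>+t. h t * ennreal (exp (b * t - b\<^sup>2 / 2)) \<partial>std_normal_distribution)"
proof -
  have dens: "std_normal_density (t - b) = std_normal_density t * exp (b * t - b\<^sup>2 / 2)" for t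
  proof -
    have "- (t - b)\<^sup>2 / 2 = - t\<^sup>2 / 2 + (b * t - b\<^sup>2 / 2)" by (simp add: power2_eq_square field_simps)
    then show ?thesis unfolding std_normal_density_def by (simp only: exp_add mult.assoc)
  qed
  have "(\<integral>\<^sup>+t. h (t + b) \<partial>std_normal_distribution)
      = (\<integral>\<^sup>+t. ennreal (std_normal_density t) * h (t + b) \<partial>lborel)"
    by (subst nn_integral_density) auto
  also have "\<dots> = (\<integral>\<^sup>+t. ennreal (std_normal_density (t - b)) * h t \<partial>lborel)"
    by (subst (2) nn_integral_real_affine[where c = 1 and t = b]) (auto simp: add.commute)
  also have "\<dots> = (\<integral>\<^sup>+t. ennreal (std_normal_density t) * (h t * ennreal (exp (b * t - b\<^sup>2 / 2))) \<partial>lborel)"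
    by (intro nn_integral_cong) (simp add: dens ennreal_mult mult_ac)
  also have "\<dots> = (\<integral>\<^sup>+t. h t * ennreal (exp (b * t - b\<^sup>2 / 2)) \<partial>std_normal_distribution)"
    by (subst nn_integral_density) auto
  finally show ?thesis .
qed

lemma std_normal_exp_linear:
  "(\<integral>\<^sup>+t. ennreal (exp (b * t)) \<partial>std_normal_distribution) = ennreal (exp (b\<^sup>2 / 2))"
proof -
  interpret prob_space std_normal_distribution by (rule prob_space_std_normal)
  have "(\<integral>\<^sup>+t. ennreal (exp (b * t)) \<partial>std_normal_distribution)
      = (\<integral>\<^sup>+t. ennreal (exp (b\<^sup>2 / 2)) * (1 * ennreal (exp (b * t - b\<^sup>2 / 2))) \<partial>std_normal_distribution)"
    by (intro nn_integral_cong) (simp add: ennreal_mult'[symmetric] exp_add[symmetric])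
  also have "\<dots> = ennreal (exp (b\<^sup>2 / 2)) * (\<integral>\<^sup>+t. 1 \<partial>std_normal_distribution)"
    by (subst nn_integral_cmult, simp, subst std_normal_shift[of "\<lambda>_. 1", symmetric]) auto
  finally show ?thesis by (simp add: emeasure_space_1[simplified])
qed

lemma std_normal_exp_neg_square:
  assumes "0 \<le> q"
  shows "ennreal (1 - q) \<le> (\<integral>\<^sup>+t. ennreal (exp (- (q * t\<^sup>2))) \<partial>std_normal_distribution)"
proof -
  interpret prob_space std_normal_distribution by (rule prob_space_std_normal)
  have sq: "has_bochner_integral std_normal_distribution (\<lambda>t. t\<^sup>2) 1"
    using std_normal_moment_even[of 1] by (subst has_bochner_integral_density) (auto simp: fact_numeral)
  have int: "integrable std_normal_distribution (\<lambda>t. exp (- (q * t\<^sup>2)))"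
    using assms by (intro integrable_const_bound[of _ 1]) auto
  have "1 - q = (\<integral>t. 1 - q * t\<^sup>2 \<partial>std_normal_distribution)"
    using sq by (simp add: has_bochner_integral_iff prob_space[simplified])
  also have "\<dots> \<le> (\<integral>t. exp (- (q * t\<^sup>2)) \<partial>std_normal_distribution)"
    using sq int exp_ge_add_one_self[of "- (q * _\<^sup>2)"]
    by (intro integral_mono) (auto simp: has_bochner_integral_iff)
  finally show ?thesis by (subst nn_integral_eq_integral[OF int]) (auto intro: ennreal_leI)
qed

section \<open>Shearing a standard normal vector\<close>

definition shear :: "nat \<Rightarrow> nat \<Rightarrow> real \<Rightarrow> (nat \<Rightarrow> real) \<Rightarrow> nat \<Rightarrow> real" where
  "shear l k y z = z(k := z k + y * z l)"

text \<open>
  The density of the law of \<open>shear l k y z\<close> relative to the law of the standard normal vector \<open>z\<close>.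
\<close>

definition shear_density :: "nat \<Rightarrow> nat \<Rightarrow> real \<Rightarrow> (nat \<Rightarrow> real) \<Rightarrow> real" where
  "shear_density l k y z = exp (y * z l * z k - (y * z l)\<^sup>2 / 2)"

lemma measurable_shear_density [measurable]:
  "l < p \<Longrightarrow> k < p \<Longrightarrow> shear_density l k y \<in> borel_measurable (std_normal_vec p)"
  unfolding shear_density_def by measurable

lemma measurable_shear [measurable]:
  assumes "l < p" "k < p"
  shows "shear l k y \<in> measurable (std_normal_vec p) (std_normal_vec p)"
proof -
  have "(\<lambda>z. z(k := z k + y * z l)) \<in> measurable (std_normal_vec p) (std_normal_vec p)"
    using assms by (intro measurable_fun_upd[where J = "{..<p}"]) auto
  then show ?thesis by (simp add: shear_def[abs_def])
qed

text \<open>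
  With the other coordinates held fixed, the shear translates the \<open>k\<close>-th one by a constant.
\<close>

lemma nn_integral_shear:
  assumes lk: "l < p" "k < p" "l \<noteq> k" and h[measurable]: "h \<in> borel_measurable (std_normal_vec p)"
  shows "(\<integral>\<^sup>+z. h (shear l k y z) \<partial>std_normal_vec p)
    = (\<integral>\<^sup>+z. h z * ennreal (shear_density l k y z) \<partial>std_normal_vec p)"
proof -
  interpret product_sigma_finite "\<lambda>_::nat. std_normal_distribution"
    by (intro product_sigma_finite.intro prob_space_imp_sigma_finite prob_space_std_normal)
  let ?J = "{..<p} - {k}"
  let ?M = "\<Pi>\<^sub>M i\<in>?J. std_normal_distribution"
  have I: "{..<p} = insert k ?J" using lk by auto
  have ins: "integral\<^sup>N (std_normal_vec p) f = (\<integral>\<^sup>+x. \<integral>\<^sup>+t. f (x(k := t)) \<partial>std_normal_distribution \<partial>?M)"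
    if "f \<in> borel_measurable (std_normal_vec p)" for f
    using product_nn_integral_insert[of ?J k f] that unfolding I[symmetric] by auto
  have upd: "(\<lambda>t. f (x(k := t))) \<in> borel_measurable borel"
    if f: "f \<in> borel_measurable (std_normal_vec p)" and x: "x \<in> space ?M" for f :: "_ \<Rightarrow> ennreal" and x
  proof -
    have "(\<lambda>t. x(k := t)) \<in> measurable borel (std_normal_vec p)"
      using x I by (intro measurable_fun_upd[where J = ?J]) auto
    from measurable_compose[OF this f] show ?thesis .
  qed
  have "(\<integral>\<^sup>+z. h (shear l k y z) \<partial>std_normal_vec p)
      = (\<integral>\<^sup>+x. \<integral>\<^sup>+t. h (x(k := t + y * x l)) \<partial>std_normal_distribution \<partial>?M)"
    using lk measurable_compose[OF measurable_shear[OF lk(1,2)] h]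
    by (subst ins) (auto simp: shear_def intro!: nn_integral_cong)
  also have "\<dots> = (\<integral>\<^sup>+x. \<integral>\<^sup>+t. h (x(k := t)) * ennreal (exp (y * x l * t - (y * x l)\<^sup>2 / 2))
      \<partial>std_normal_distribution \<partial>?M)"
    by (intro nn_integral_cong std_normal_shift[of "\<lambda>t. h (_(k := t))"] upd h)
  also have "\<dots> = (\<integral>\<^sup>+z. h z * ennreal (shear_density l k y z) \<partial>std_normal_vec p)"
    using lk by (subst ins) (auto simp: shear_density_def intro!: nn_integral_cong)
  finally show ?thesis .
qed

lemma distr_shear:
  assumes lk: "l < p" "k < p" "l \<noteq> k"
  shows "distr (std_normal_vec p) (std_normal_vec p) (shear l k y)
    = density (std_normal_vec p) (\<lambda>z. ennreal (shear_density l k y z))"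
proof (rule measure_eqI)
  note [measurable] = lk(1,2)
  fix A assume "A \<in> sets (distr (std_normal_vec p) (std_normal_vec p) (shear l k y))"
  then have A[measurable]: "A \<in> sets (std_normal_vec p)" by simp
  have m: "shear l k y \<in> measurable (std_normal_vec p) (std_normal_vec p)"
    using lk by (intro measurable_shear)
  have "emeasure (distr (std_normal_vec p) (std_normal_vec p) (shear l k y)) A
      = (\<integral>\<^sup>+z. indicator A z \<partial>distr (std_normal_vec p) (std_normal_vec p) (shear l k y))" by simp
  also have "\<dots> = (\<integral>\<^sup>+z. indicator A (shear l k y z) \<partial>std_normal_vec p)"
    by (subst nn_integral_distr[OF m]) auto
  also have "\<dots> = (\<integral>\<^sup>+z. indicator A z * ennreal (shear_density l k y z) \<partial>std_normal_vec p)"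
    by (rule nn_integral_shear[OF lk]) simp
  also have "\<dots> = emeasure (density (std_normal_vec p) (\<lambda>z. ennreal (shear_density l k y z))) A"
    using measurable_shear_density[OF lk(1,2)] by (subst emeasure_density) (auto simp: mult.commute)
  finally show "emeasure (distr (std_normal_vec p) (std_normal_vec p) (shear l k y)) A = \<dots>" .
qed simp

lemma nn_integral_shear_density:
  assumes lk: "l < p" "k < p" "l \<noteq> k"
  shows "(\<integral>\<^sup>+z. ennreal (shear_density l k y z) \<partial>std_normal_vec p) = 1"
  using nn_integral_shear[OF lk, of "\<lambda>_. 1" y] prob_space.emeasure_space_1[OF prob_space_std_normal_vec]
  by simp

text \<open>
  Integrating out the \<open>k\<close>-th coordinate leaves the mean of \<open>exp (- y\<^sup>2 t\<^sup>2 / 8)\<close> over a standard normal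
  \<open>t\<close>, which \<open>exp x \<ge> 1 + x\<close> bounds from below.
\<close>

lemma hellinger_affinity_shear:
  assumes lk: "l < p" "k < p" "l \<noteq> k"
  shows "ennreal (1 - y\<^sup>2 / 8) \<le> (\<integral>\<^sup>+z. ennreal (sqrt (shear_density l k y z)) \<partial>std_normal_vec p)"
proof -
  interpret product_sigma_finite "\<lambda>_::nat. std_normal_distribution"
    by (intro product_sigma_finite.intro prob_space_imp_sigma_finite prob_space_std_normal)
  let ?J = "{..<p} - {k}"
  let ?M = "\<Pi>\<^sub>M i\<in>?J. std_normal_distribution"
  have I: "{..<p} = insert k ?J" using lk by auto
  let ?f = "\<lambda>z. ennreal (exp (y * z l / 2 * z k - (y * z l)\<^sup>2 / 4))"
  have "sqrt (exp x) = exp (x / 2)" for x :: real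
    by (rule real_sqrt_unique) (simp_all add: exp_double[symmetric])
  then have f: "ennreal (sqrt (shear_density l k y z)) = ?f z" for z
    unfolding shear_density_def by (simp add: field_simps)
  have fm: "?f \<in> borel_measurable (std_normal_vec p)" using lk(1,2) by measurable
  have "(\<integral>\<^sup>+z. ennreal (sqrt (shear_density l k y z)) \<partial>std_normal_vec p)
      = (\<integral>\<^sup>+x. \<integral>\<^sup>+t. ?f (x(k := t)) \<partial>std_normal_distribution \<partial>?M)"
    unfolding f using fm by (intro product_nn_integral_insert[of ?J k ?f, unfolded I[symmetric]]) auto
  also have "\<dots> = (\<integral>\<^sup>+x. ennreal (exp (- (y\<^sup>2 / 8 * (x l)\<^sup>2))) \<partial>?M)"
  proof (rule nn_integral_cong)
    fix x
    have "(\<integral>\<^sup>+t. ?f (x(k := t)) \<partial>std_normal_distribution)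
        = (\<integral>\<^sup>+t. ennreal (exp (- (y * x l)\<^sup>2 / 4)) * ennreal (exp (y * x l / 2 * t)) \<partial>std_normal_distribution)"
      using lk by (intro nn_integral_cong) (simp add: ennreal_mult'[symmetric] exp_add[symmetric])
    also have "\<dots> = ennreal (exp (- (y * x l)\<^sup>2 / 4)) * ennreal (exp ((y * x l / 2)\<^sup>2 / 2))"
      by (subst nn_integral_cmult) (simp_all only: std_normal_exp_linear, simp)
    also have "\<dots> = ennreal (exp (- (y\<^sup>2 / 8 * (x l)\<^sup>2)))"
      by (simp add: ennreal_mult'[symmetric] exp_add[symmetric] power_mult_distrib power_divide field_simps)
    finally show "(\<integral>\<^sup>+t. ?f (x(k := t)) \<partial>std_normal_distribution) = ennreal (exp (- (y\<^sup>2 / 8 * (x l)\<^sup>2)))" .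
  qed
  also have "\<dots> = (\<integral>\<^sup>+t. ennreal (exp (- (y\<^sup>2 / 8 * t\<^sup>2))) \<partial>distr ?M std_normal_distribution (\<lambda>x. x l))"
    using lk by (subst nn_integral_distr) (auto intro!: measurable_std_normal_coord)
  also have "distr ?M std_normal_distribution (\<lambda>x. x l) = std_normal_distribution"
    using lk by (intro distr_PiM_component prob_space_std_normal) auto
  finally show ?thesis using std_normal_exp_neg_square[of "y\<^sup>2 / 8"] by simp
qed

lemma PiM_density:
  assumes I: "finite I" and N: "prob_space N" and g[measurable]: "g \<in> borel_measurable N"
    and g1: "(\<integral>\<^sup>+z. g z \<partial>N) = 1"
  shows "(\<Pi>\<^sub>M i\<in>I. density N g) = density (\<Pi>\<^sub>M i\<in>I. N) (\<lambda>s. \<Prod>i\<in>I. g (s i))"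
proof -
  interpret N: prob_space N by fact
  have D: "prob_space (density N g)" by (rule prob_spaceI) (simp add: emeasure_density g1)
  interpret D: product_sigma_finite "\<lambda>_. density N g"
    by (intro product_sigma_finite.intro prob_space_imp_sigma_finite D)
  interpret P: product_sigma_finite "\<lambda>_. N"
    by (intro product_sigma_finite.intro prob_space_imp_sigma_finite N)
  have sets: "sets (\<Pi>\<^sub>M i\<in>I. density N g) = sets (\<Pi>\<^sub>M i\<in>I. N)" by (intro sets_PiM_cong) auto
  show ?thesis
  proof (rule D.PiM_eqI[OF I, symmetric])
    show "sets (density (\<Pi>\<^sub>M i\<in>I. N) (\<lambda>s. \<Prod>i\<in>I. g (s i))) = sets (\<Pi>\<^sub>M i\<in>I. density N g)"
      by (simp add: sets)
    fix A assume "\<And>i. i \<in> I \<Longrightarrow> A i \<in> sets (density N g)"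
    then have A[measurable]: "\<And>i. i \<in> I \<Longrightarrow> A i \<in> sets N" by simp
    have box: "Pi\<^sub>E I A \<in> sets (\<Pi>\<^sub>M i\<in>I. N)" using A I by (intro sets_PiM_I_finite) auto
    have "emeasure (density (\<Pi>\<^sub>M i\<in>I. N) (\<lambda>s. \<Prod>i\<in>I. g (s i))) (Pi\<^sub>E I A)
        = (\<integral>\<^sup>+s. (\<Prod>i\<in>I. g (s i)) * indicator (Pi\<^sub>E I A) s \<partial>(\<Pi>\<^sub>M i\<in>I. N))"
      using box I by (intro emeasure_density) auto
    also have "\<dots> = (\<integral>\<^sup>+s. (\<Prod>i\<in>I. g (s i) * indicator (A i) (s i)) \<partial>(\<Pi>\<^sub>M i\<in>I. N))"
    proof (rule nn_integral_cong)
      fix s assume "s \<in> space (\<Pi>\<^sub>M i\<in>I. N)"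
      then have "(\<Prod>i\<in>I. indicator (A i) (s i)) = (indicator (Pi\<^sub>E I A) s :: ennreal)"
        using I by (auto simp: indicator_def prod_zero_iff PiE_iff space_PiM split: if_splits intro!: prod.neutral)
      then show "(\<Prod>i\<in>I. g (s i)) * indicator (Pi\<^sub>E I A) s = (\<Prod>i\<in>I. g (s i) * indicator (A i) (s i))"
        by (simp add: prod.distrib)
    qed
    also have "\<dots> = (\<Prod>i\<in>I. \<integral>\<^sup>+z. g z * indicator (A i) z \<partial>N)"
      using I by (intro P.product_nn_integral_prod) auto
    also have "\<dots> = (\<Prod>i\<in>I. emeasure (density N g) (A i))"
      by (intro prod.cong refl) (simp add: emeasure_density)
    finally show "emeasure (density (\<Pi>\<^sub>M i\<in>I. N) (\<lambda>s. \<Prod>i\<in>I. g (s i))) (Pi\<^sub>E I A)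
      = (\<Prod>i\<in>I. emeasure (density N g) (A i))" .
  qed
qed

section \<open>Two-point lower bounds\<close>

text \<open>
  With \<open>dQ = g dP\<close>, the two risks add up to at least \<open>\<Delta> \<integral> min 1 g\<close>, and \<open>min 1 g\<close> dominates
  \<open>sqrt g - (1 + g) / 4\<close>, whose integral is the Hellinger affinity minus \<open>1/2\<close>.
\<close>

lemma two_point_bound:
  fixes g :: "'a \<Rightarrow> real" and h0 h1 :: "'a \<Rightarrow> ennreal"
  assumes M: "prob_space M"
    and [measurable]: "g \<in> borel_measurable M" "h0 \<in> borel_measurable M" "h1 \<in> borel_measurable M"
    and g0: "\<And>x. 0 \<le> g x" and g1: "(\<integral>\<^sup>+x. ennreal (g x) \<partial>M) = 1"
    and \<Delta>: "0 \<le> \<Delta>" "\<And>x. ennreal \<Delta> \<le> h0 x + h1 x"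
    and aff: "ennreal \<rho> \<le> (\<integral>\<^sup>+x. ennreal (sqrt (g x)) \<partial>M)" and \<rho>: "1/2 \<le> \<rho>"
  shows "ennreal (\<Delta> * (\<rho> - 1/2)) \<le> (\<integral>\<^sup>+x. h0 x \<partial>M) + (\<integral>\<^sup>+x. h1 x * ennreal (g x) \<partial>M)"
proof -
  interpret prob_space M by fact
  have pt: "sqrt t \<le> min 1 t + (1 + t) / 4" if "0 \<le> t" for t :: real
  proof -
    define q where "q = sqrt t"
    have t: "t = q\<^sup>2" using that by (simp add: q_def)
    \<comment> \<open>the claim for \<open>t \<ge> 1\<close> and for \<open>t < 1\<close>, with the square completed in \<open>q\<close>\<close>
    have "0 \<le> (q - 2)\<^sup>2" "0 \<le> (5 * q - 2)\<^sup>2" by auto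
    then have "0 \<le> q\<^sup>2 - 4 * q + 4" "0 \<le> 25 * q\<^sup>2 - 20 * q + 4"
      by (simp_all add: power2_eq_square algebra_simps)
    then have "q \<le> 1 + (1 + q\<^sup>2) / 4" "q \<le> q\<^sup>2 + (1 + q\<^sup>2) / 4" by (simp_all add: field_simps)
    then show ?thesis unfolding q_def[symmetric] unfolding t by (simp add: min_def)
  qed
  have "ennreal (\<Delta> * \<rho>) \<le> ennreal \<Delta> * (\<integral>\<^sup>+x. ennreal (sqrt (g x)) \<partial>M)"
    using aff \<Delta>(1) by (simp add: ennreal_mult' mult_left_mono)
  also have "\<dots> = (\<integral>\<^sup>+x. ennreal (\<Delta> * sqrt (g x)) \<partial>M)"
    using \<Delta>(1) by (simp add: nn_integral_cmult ennreal_mult')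
  also have "\<dots> \<le> (\<integral>\<^sup>+x. (h0 x + h1 x * ennreal (g x)) + ennreal (\<Delta> / 4) * (1 + ennreal (g x)) \<partial>M)"
  proof (rule nn_integral_mono)
    fix x
    have "\<Delta> * sqrt (g x) \<le> \<Delta> * (min 1 (g x) + (1 + g x) / 4)"
      using pt[OF g0] \<Delta>(1) by (intro mult_left_mono)
    then have "ennreal (\<Delta> * sqrt (g x)) \<le> ennreal (\<Delta> * min 1 (g x) + \<Delta> / 4 * (1 + g x))"
      by (intro ennreal_leI) (simp add: algebra_simps)
    also have "\<dots> = ennreal \<Delta> * ennreal (min 1 (g x)) + ennreal (\<Delta> / 4) * (1 + ennreal (g x))"
    proof -
      have "ennreal (\<Delta> * min 1 (g x) + \<Delta> / 4 * (1 + g x))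
          = ennreal (\<Delta> * min 1 (g x)) + ennreal (\<Delta> / 4 * (1 + g x))"
        using \<Delta>(1) g0[of x] by (intro ennreal_plus) auto
      moreover have "ennreal (\<Delta> / 4 * (1 + g x)) = ennreal (\<Delta> / 4) * ennreal (1 + g x)"
        using \<Delta>(1) by (intro ennreal_mult') auto
      moreover have "ennreal (1 + g x) = 1 + ennreal (g x)" using g0[of x] by simp
      ultimately show ?thesis using \<Delta>(1) by (simp add: ennreal_mult')
    qed
    also have "ennreal \<Delta> * ennreal (min 1 (g x)) \<le> (h0 x + h1 x) * ennreal (min 1 (g x))"
      using \<Delta>(2) by (intro mult_right_mono) auto
    also have "\<dots> \<le> h0 x + h1 x * ennreal (g x)"
    proof -
      have "h0 x * ennreal (min 1 (g x)) \<le> h0 x * 1"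
        using ennreal_leI[of "min 1 (g x)" 1] by (intro mult_left_mono) auto
      moreover have "h1 x * ennreal (min 1 (g x)) \<le> h1 x * ennreal (g x)"
        by (intro mult_left_mono ennreal_leI) auto
      ultimately show ?thesis by (simp add: distrib_right add_mono)
    qed
    finally show "ennreal (\<Delta> * sqrt (g x)) \<le> (h0 x + h1 x * ennreal (g x)) + ennreal (\<Delta> / 4) * (1 + ennreal (g x))"
      by (simp add: add_mono)
  qed
  also have "\<dots> = ((\<integral>\<^sup>+x. h0 x \<partial>M) + (\<integral>\<^sup>+x. h1 x * ennreal (g x) \<partial>M)) + ennreal (\<Delta> / 4) * 2"
    by (simp add: nn_integral_add nn_integral_cmult g1 emeasure_space_1)
  also have "ennreal (\<Delta> / 4) * 2 = ennreal (\<Delta> / 2)"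
    using \<Delta>(1) ennreal_mult'[of "\<Delta> / 4" 2] by simp
  finally have le: "ennreal (\<Delta> * \<rho>) \<le> ((\<integral>\<^sup>+x. h0 x \<partial>M) + (\<integral>\<^sup>+x. h1 x * ennreal (g x) \<partial>M)) + ennreal (\<Delta> / 2)" .
  have "ennreal (\<Delta> * (\<rho> - 1/2)) = ennreal (\<Delta> * \<rho>) - ennreal (\<Delta> / 2)"
    using \<Delta>(1) by (simp add: ennreal_minus algebra_simps)
  also have "\<dots> \<le> (\<integral>\<^sup>+x. h0 x \<partial>M) + (\<integral>\<^sup>+x. h1 x * ennreal (g x) \<partial>M)"
    using le by (simp add: ennreal_minus_le_iff add.commute)
  finally show ?thesis .
qed

lemma nn_integral_PiM_distr:
  assumes I: "finite I" and N: "prob_space N" and G: "G \<in> measurable N S"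
    and f: "f \<in> borel_measurable (\<Pi>\<^sub>M i\<in>I. S)"
  shows "(\<integral>\<^sup>+s. f s \<partial>(\<Pi>\<^sub>M i\<in>I. distr N S G)) = (\<integral>\<^sup>+s. f (compose I G s) \<partial>(\<Pi>\<^sub>M i\<in>I. N))"
proof -
  let ?D = "distr N S G"
  have D: "prob_space ?D" by (rule prob_space.prob_space_distr[OF N G])
  have G': "G \<in> measurable N ?D" using G by simp
  have "distr (\<Pi>\<^sub>M i\<in>I. N) (\<Pi>\<^sub>M i\<in>I. ?D) (compose I G) = (\<Pi>\<^sub>M i\<in>I. distr N ?D G)"
    by (rule distr_PiM_finite_prob_space'[OF I N D G'])
  also have "distr N ?D G = ?D" by (rule distr_cong) auto
  finally have eq: "(\<Pi>\<^sub>M i\<in>I. ?D) = distr (\<Pi>\<^sub>M i\<in>I. N) (\<Pi>\<^sub>M i\<in>I. ?D) (compose I G)" ..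
  have "sets (\<Pi>\<^sub>M i\<in>I. ?D) = sets (\<Pi>\<^sub>M i\<in>I. S)" by (intro sets_PiM_cong) auto
  then have f': "f \<in> borel_measurable (\<Pi>\<^sub>M i\<in>I. ?D)" using f by (simp cong: measurable_cong_sets)
  have cG: "compose I G \<in> measurable (\<Pi>\<^sub>M i\<in>I. N) (\<Pi>\<^sub>M i\<in>I. ?D)"
    unfolding compose_def using G by measurable
  show ?thesis by (subst eq) (rule nn_integral_distr[OF cG], simp add: f')
qed

text \<open>
  Affinities multiply over the \<open>n\<close> independent samples, and Bernoulli's inequality keeps the product
  above \<open>1 - n y\<^sup>2 / 8 \<ge> 31/32\<close>, which is \<open>15/32\<close> more than the threshold \<open>1/2\<close> of the two-point bound.
\<close>

lemma shear_two_point_bound: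
  fixes h0 h1 :: "(nat \<Rightarrow> nat \<Rightarrow> real) \<Rightarrow> ennreal"
  assumes lk: "l < p" "k < p" "l \<noteq> k" and y: "real n * y\<^sup>2 \<le> 1/4"
    and P0: "P0 = distr (std_normal_vec p) (sample_space p) G"
    and P1: "P1 = distr (std_normal_vec p) (sample_space p) (G \<circ> shear l k y)"
    and G: "G \<in> measurable (std_normal_vec p) (sample_space p)"
    and h0: "h0 \<in> borel_measurable (\<Pi>\<^sub>M i\<in>{1..n}. sample_space p)"
    and h1: "h1 \<in> borel_measurable (\<Pi>\<^sub>M i\<in>{1..n}. sample_space p)"
    and \<Delta>: "0 \<le> \<Delta>" "\<And>s. ennreal \<Delta> \<le> h0 s + h1 s"
  shows "ennreal (15/32 * \<Delta>) \<le> (\<integral>\<^sup>+s. h0 s \<partial>(\<Pi>\<^sub>M i\<in>{1..n}. P0)) + (\<integral>\<^sup>+s. h1 s \<partial>(\<Pi>\<^sub>M i\<in>{1..n}. P1))"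
proof -
  let ?N = "std_normal_vec p" and ?I = "{1..n}"
  let ?g = "shear_density l k y"
  let ?M = "\<Pi>\<^sub>M i\<in>?I. ?N"
  define H where "H s = (\<Prod>i\<in>?I. ?g (s i))" for s :: "nat \<Rightarrow> nat \<Rightarrow> real"
  have N: "prob_space ?N" by (rule prob_space_std_normal_vec)
  interpret P: product_sigma_finite "\<lambda>_::nat. ?N"
    by (intro product_sigma_finite.intro prob_space_imp_sigma_finite N)
  have gm[measurable]: "?g \<in> borel_measurable ?N" using lk by measurable
  have g0: "0 \<le> ?g z" for z by (simp add: shear_density_def)
  have Hm: "H \<in> borel_measurable ?M" unfolding H_def by measurable
  have H: "ennreal (H s) = (\<Prod>i\<in>?I. ennreal (?g (s i)))" for s
    unfolding H_def by (simp add: prod_ennreal g0)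
  have D: "density ?N (\<lambda>z. ennreal (?g z)) = distr ?N ?N (shear l k y)"
    by (rule distr_shear[OF lk, symmetric])
  have Dp: "prob_space (density ?N (\<lambda>z. ennreal (?g z)))"
    unfolding D using lk by (intro prob_space.prob_space_distr[OF N]) measurable
  have P1': "P1 = distr (density ?N (\<lambda>z. ennreal (?g z))) (sample_space p) G"
    unfolding D P1 using lk by (subst distr_distr[OF G]) (auto simp: comp_def)
  have dens: "(\<Pi>\<^sub>M i\<in>?I. density ?N (\<lambda>z. ennreal (?g z))) = density ?M (\<lambda>s. ennreal (H s))"
    unfolding H using nn_integral_shear_density[OF lk] by (intro PiM_density N) auto
  have cG: "compose ?I G \<in> measurable ?M (\<Pi>\<^sub>M i\<in>?I. sample_space p)"
    unfolding compose_def using G by measurable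
  note c0 = measurable_compose[OF cG h0] and c1 = measurable_compose[OF cG h1]
  have i0: "(\<integral>\<^sup>+s. h0 s \<partial>(\<Pi>\<^sub>M i\<in>?I. P0)) = (\<integral>\<^sup>+s. h0 (compose ?I G s) \<partial>?M)"
    unfolding P0 by (rule nn_integral_PiM_distr[OF _ N G h0]) simp
  have i1: "(\<integral>\<^sup>+s. h1 s \<partial>(\<Pi>\<^sub>M i\<in>?I. P1)) = (\<integral>\<^sup>+s. h1 (compose ?I G s) * ennreal (H s) \<partial>?M)"
  proof -
    have "(\<integral>\<^sup>+s. h1 s \<partial>(\<Pi>\<^sub>M i\<in>?I. P1)) = (\<integral>\<^sup>+s. h1 (compose ?I G s) \<partial>density ?M (\<lambda>s. ennreal (H s)))"
      unfolding P1' dens[symmetric] using G by (intro nn_integral_PiM_distr[OF _ Dp _ h1]) auto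
    also have "\<dots> = (\<integral>\<^sup>+s. ennreal (H s) * h1 (compose ?I G s) \<partial>?M)"
      using Hm c1 by (intro nn_integral_density) auto
    finally show ?thesis by (simp add: mult.commute)
  qed
  have "ennreal (31/32) \<le> (\<Prod>i\<in>?I. \<integral>\<^sup>+z. ennreal (sqrt (?g z)) \<partial>?N)"
  proof -
    have y8: "y\<^sup>2 / 8 \<le> 1" if "n \<noteq> 0"
    proof -
      have "1 * y\<^sup>2 \<le> real n * y\<^sup>2" using that by (intro mult_right_mono) auto
      then show ?thesis using y by simp
    qed
    have "31/32 \<le> 1 + real n * (- (y\<^sup>2 / 8))" using y by (simp add: field_simps)
    also have "\<dots> \<le> (1 + - (y\<^sup>2 / 8)) ^ n"
      using y8 Bernoulli_inequality[of "- (y\<^sup>2 / 8)" n] by (cases "n = 0") auto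
    finally have "ennreal (31/32) \<le> ennreal ((1 - y\<^sup>2 / 8) ^ n)" by (intro ennreal_leI) simp
    also have "\<dots> = (\<Prod>i\<in>?I. ennreal (1 - y\<^sup>2 / 8))"
      using y8 by (cases "n = 0") (auto simp: ennreal_power)
    also have "\<dots> \<le> (\<Prod>i\<in>?I. \<integral>\<^sup>+z. ennreal (sqrt (?g z)) \<partial>?N)"
      by (intro prod_mono_ennreal hellinger_affinity_shear[OF lk])
    finally show ?thesis .
  qed
  also have "\<dots> = (\<integral>\<^sup>+s. (\<Prod>i\<in>?I. ennreal (sqrt (?g (s i)))) \<partial>?M)"
    by (intro P.product_nn_integral_prod[symmetric]) auto
  also have "\<dots> = (\<integral>\<^sup>+s. ennreal (sqrt (H s)) \<partial>?M)"
  proof (intro nn_integral_cong)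
    fix s :: "nat \<Rightarrow> nat \<Rightarrow> real"
    have "sqrt (\<Prod>i\<in>J. ?g (s i)) = (\<Prod>i\<in>J. sqrt (?g (s i)))" for J
      by (induction J rule: infinite_finite_induct) (auto simp: real_sqrt_mult)
    then show "(\<Prod>i\<in>?I. ennreal (sqrt (?g (s i)))) = ennreal (sqrt (H s))"
      unfolding H_def by (simp add: prod_ennreal g0)
  qed
  finally have aff: "ennreal (31/32) \<le> (\<integral>\<^sup>+s. ennreal (sqrt (H s)) \<partial>?M)" .
  have PH: "prob_space (density ?M (\<lambda>s. ennreal (H s)))"
    unfolding dens[symmetric] by (intro prob_space_PiM Dp)
  then have H1: "(\<integral>\<^sup>+s. ennreal (H s) \<partial>?M) = 1"
    using Hm prob_space.emeasure_space_1[OF PH] by (simp add: emeasure_density del: One_nat_def cong: nn_integral_cong)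
  have "ennreal (\<Delta> * (31/32 - 1/2))
      \<le> (\<integral>\<^sup>+s. h0 (compose ?I G s) \<partial>?M) + (\<integral>\<^sup>+s. h1 (compose ?I G s) * ennreal (H s) \<partial>?M)"
  proof (rule two_point_bound)
    show "prob_space ?M" by (intro prob_space_PiM N)
    show "0 \<le> H s" for s unfolding H_def by (intro prod_nonneg g0)
  qed (use Hm c0 c1 H1 \<Delta> aff in auto)
  then show ?thesis unfolding i0 i1 by (simp add: mult.commute)
qed

section \<open>Orthonormal families\<close>

text \<open>
  Vectors are numbered from 1 and coordinates from 0, so index sets \<open>{1..m}\<close> have to keep their form.
\<close>

declare One_nat_def [simp del]

definition orthonormal_vecs :: "nat \<Rightarrow> nat \<Rightarrow> (nat \<Rightarrow> real Matrix.vec) \<Rightarrow> bool" where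
  "orthonormal_vecs p m w \<longleftrightarrow> (\<forall>i\<in>{1..m}. w i \<in> carrier_vec p) \<and>
     (\<forall>i\<in>{1..m}. \<forall>j\<in>{1..m}. scalar_prod (w i) (w j) = (if i = j then 1 else 0))"

lemma orthonormal_vecs_carrier:
  "orthonormal_vecs p m w \<Longrightarrow> i \<in> {1..m} \<Longrightarrow> w i \<in> carrier_vec p"
  unfolding orthonormal_vecs_def by blast

lemma orthonormal_vecs_scalar_prod:
  "orthonormal_vecs p m w \<Longrightarrow> i \<in> {1..m} \<Longrightarrow> j \<in> {1..m} \<Longrightarrow>
    scalar_prod (w i) (w j) = (if i = j then 1 else 0)"
  unfolding orthonormal_vecs_def by blast

lemma scalar_prod_sum:
  "w \<in> carrier_vec p \<Longrightarrow> scalar_prod v w = (\<Sum>a<p. v $ a * w $ a)"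
  by (simp add: scalar_prod_def atLeast0LessThan)

lemma scalar_prod_commute:
  fixes v w :: "real Matrix.vec"
  shows "v \<in> carrier_vec p \<Longrightarrow> w \<in> carrier_vec p \<Longrightarrow> scalar_prod v w = scalar_prod w v"
  by (simp add: scalar_prod_sum mult.commute)

text \<open>
  A left inverse of a square matrix is also a right inverse, so the rows of the matrix with columns
  \<open>w i\<close> are orthonormal along with its columns.
\<close>

lemma orthonormal_basis_complete:
  assumes w: "orthonormal_vecs p p w" and a: "a < p" and b: "b < p"
  shows "(\<Sum>i=1..p. w i $ a * w i $ b) = (if a = b then 1 else 0)"
proof -
  define W where "W = Matrix.mat p p (\<lambda>(a, i). w (Suc i) $ a)"
  have W: "W \<in> carrier_mat p p" by (simp add: W_def)
  have "transpose_mat W * W = 1\<^sub>m p"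
  proof (rule eq_matI)
    fix i j assume ij: "i < dim_row (1\<^sub>m p)" "j < dim_col (1\<^sub>m p)"
    then have ij: "i < p" "j < p" by auto
    then have "(transpose_mat W * W) $$ (i, j) = (\<Sum>a<p. w (Suc i) $ a * w (Suc j) $ a)"
      by (simp add: W_def scalar_prod_def atLeast0LessThan)
    also have "\<dots> = scalar_prod (w (Suc i)) (w (Suc j))"
      using orthonormal_vecs_carrier[OF w, of "Suc j"] ij by (subst scalar_prod_sum[of _ p]) auto
    also have "\<dots> = 1\<^sub>m p $$ (i, j)"
      using orthonormal_vecs_scalar_prod[OF w, of "Suc i" "Suc j"] ij by auto
    finally show "(transpose_mat W * W) $$ (i, j) = 1\<^sub>m p $$ (i, j)" .
  qed (use W in auto)
  then have "W * transpose_mat W = 1\<^sub>m p"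
    using mat_mult_left_right_inverse[of "transpose_mat W" p W] W by simp
  then have "(W * transpose_mat W) $$ (a, b) = 1\<^sub>m p $$ (a, b)" by simp
  moreover have "(W * transpose_mat W) $$ (a, b) = (\<Sum>i<p. w (Suc i) $ a * w (Suc i) $ b)"
    using a b by (simp add: W_def scalar_prod_def atLeast0LessThan)
  ultimately show ?thesis using a b by (simp add: sum.atLeast1_atMost_eq[folded One_nat_def])
qed

lemma orthonormal_basis_expand:
  assumes w: "orthonormal_vecs p p w" and x: "x \<in> carrier_vec p" and a: "a < p"
  shows "x $ a = (\<Sum>i=1..p. scalar_prod (w i) x * w i $ a)"
proof -
  have "(\<Sum>i=1..p. scalar_prod (w i) x * w i $ a) = (\<Sum>i=1..p. \<Sum>b<p. w i $ a * w i $ b * x $ b)"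
    using x by (simp add: scalar_prod_sum sum_distrib_left sum_distrib_right mult_ac)
  also have "\<dots> = (\<Sum>b<p. (\<Sum>i=1..p. w i $ a * w i $ b) * x $ b)"
    by (subst sum.swap) (simp add: sum_distrib_right)
  also have "\<dots> = (\<Sum>b<p. (if a = b then 1 else 0) * x $ b)"
    by (intro sum.cong refl) (subst orthonormal_basis_complete[OF w a], auto)
  also have "\<dots> = x $ a" using a by (simp add: if_distrib[of "\<lambda>y. y * _"] cong: if_cong)
  finally show ?thesis by simp
qed

lemma orthonormal_basis_parseval:
  assumes w: "orthonormal_vecs p p w" and x: "x \<in> carrier_vec p" and y: "y \<in> carrier_vec p"
  shows "scalar_prod x y = (\<Sum>i=1..p. scalar_prod (w i) x * scalar_prod (w i) y)"
proof -
  have "scalar_prod x y = (\<Sum>a<p. (\<Sum>i=1..p. scalar_prod (w i) x * w i $ a) * y $ a)"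
    using y unfolding scalar_prod_sum[OF y]
    by (intro sum.cong refl) (subst orthonormal_basis_expand[OF w x], auto)
  also have "\<dots> = (\<Sum>i=1..p. scalar_prod (w i) x * (\<Sum>a<p. w i $ a * y $ a))"
    by (subst sum_distrib_right, subst sum.swap) (simp add: sum_distrib_left mult_ac)
  finally show ?thesis using y by (simp add: scalar_prod_sum[of y])
qed

text \<open>
  The first \<open>p\<close> vectors would already form a basis, and a further one orthogonal to them would vanish.
\<close>

lemma orthonormal_vecs_card_le:
  assumes u: "orthonormal_vecs p m u"
  shows "m \<le> p"
proof (rule ccontr)
  assume "\<not> m \<le> p"
  then have mp: "p < m" by simp
  have w: "orthonormal_vecs p p u" using u mp unfolding orthonormal_vecs_def by auto
  let ?x = "u (Suc p)"
  have x: "?x \<in> carrier_vec p" using orthonormal_vecs_carrier[OF u, of "Suc p"] mp by auto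
  have "scalar_prod (u i) ?x = 0" if "i \<in> {1..p}" for i
    using orthonormal_vecs_scalar_prod[OF u, of i "Suc p"] that mp by auto
  then have "scalar_prod ?x ?x = 0"
    by (simp add: orthonormal_basis_parseval[OF w x x])
  then show False using orthonormal_vecs_scalar_prod[OF u, of "Suc p" "Suc p"] mp by auto
qed

text \<open>
  Fewer than \<open>p\<close> vectors, written as the rows of a square matrix padded with zero rows, give a
  singular matrix, and a vector in its kernel is orthogonal to all of them.
\<close>

lemma orthonormal_vecs_extend1:
  assumes u: "orthonormal_vecs p m u" and m: "m < p"
  shows "\<exists>v\<in>carrier_vec p. scalar_prod v v = 1 \<and> (\<forall>i\<in>{1..m}. scalar_prod (u i) v = 0)"
proof -
  define A where "A = Matrix.mat p p (\<lambda>(i, a). if i < m then u (Suc i) $ a else 0)"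
  have A: "A \<in> carrier_mat p p" by (simp add: A_def)
  have "transpose_mat A *\<^sub>v unit_vec p m = 0\<^sub>v p"
    using m by (intro eq_vecI) (auto simp: A_def)
  moreover have "unit_vec p m \<noteq> (0\<^sub>v p :: real Matrix.vec)"
    using m by (metis index_unit_vec(2) index_zero_vec(1) zero_neq_one)
  ultimately have "Determinant.det (transpose_mat A) = 0"
    using A det_0_iff_vec_prod_zero[of "transpose_mat A" p]
    by (auto intro!: exI[of _ "unit_vec p m"])
  then have "Determinant.det A = 0" using det_transpose[OF A] by simp
  then obtain x where x: "x \<in> carrier_vec p" "x \<noteq> 0\<^sub>v p" "A *\<^sub>v x = 0\<^sub>v p"
    using det_0_iff_vec_prod_zero[OF A] by auto
  have ux: "scalar_prod (u i) x = 0" if i: "i \<in> {1..m}" for i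
  proof -
    have "scalar_prod (u i) x = (A *\<^sub>v x) $ (i - 1)"
    proof -
      obtain k where k: "i = Suc k" "k < m" using i by (cases i) auto
      then have "(A *\<^sub>v x) $ k = (\<Sum>a<p. Matrix.row A k $ a * x $ a)"
        using m x(1) A by (simp add: scalar_prod_sum[OF x(1)])
      also have "\<dots> = scalar_prod (u i) x"
        using k m x(1) by (simp add: A_def scalar_prod_sum[OF x(1)])
      finally show ?thesis using k by simp
    qed
    moreover have "i - 1 < p" using i m by auto
    ultimately show ?thesis using x(3) by simp
  qed
  have "scalar_prod x x \<noteq> 0"
  proof
    assume "scalar_prod x x = 0"
    then have "(\<Sum>a<p. x $ a * x $ a) = 0" using x by (simp add: scalar_prod_sum)
    then have "\<forall>a<p. x $ a = 0" by (subst (asm) sum_nonneg_eq_0_iff) auto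
    then show False using x by (metis eq_vecI carrier_vecD index_zero_vec)
  qed
  moreover have "scalar_prod x x \<ge> 0" using x by (simp add: scalar_prod_sum sum_nonneg)
  ultimately have pos: "scalar_prod x x > 0" by simp
  define v where "v = (1 / sqrt (scalar_prod x x)) \<cdot>\<^sub>v x"
  have "v \<in> carrier_vec p" using x by (simp add: v_def)
  moreover have "scalar_prod v v = 1"
    using x pos by (simp add: v_def scalar_prod_smult_left scalar_prod_smult_right)
  moreover have "scalar_prod (u i) v = 0" if i: "i \<in> {1..m}" for i
    using ux[OF i] x orthonormal_vecs_carrier[OF u i] by (simp add: v_def)
  ultimately show ?thesis by blast
qed

lemma orthonormal_vecs_Suc:
  assumes u: "orthonormal_vecs p m u" and v: "v \<in> carrier_vec p" "scalar_prod v v = 1"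
    and uv: "\<And>i. i \<in> {1..m} \<Longrightarrow> scalar_prod (u i) v = 0"
  shows "orthonormal_vecs p (Suc m) (u(Suc m := v))"
  using assms scalar_prod_commute[OF v(1) orthonormal_vecs_carrier[OF u]]
  by (auto simp: orthonormal_vecs_def le_Suc_eq)

lemma orthonormal_vecs_extend:
  assumes "orthonormal_vecs p m u"
  shows "\<exists>w. orthonormal_vecs p p w \<and> (\<forall>i\<in>{1..m}. w i = u i)"
  using assms
proof (induction "p - m" arbitrary: m u)
  case 0
  then show ?case using orthonormal_vecs_card_le[of p m u] by auto
next
  case (Suc k)
  from Suc(2) have "m < p" by simp
  from orthonormal_vecs_extend1[OF Suc(3) this] obtain v where v: "v \<in> carrier_vec p" "scalar_prod v v = 1"
    "\<And>i. i \<in> {1..m} \<Longrightarrow> scalar_prod (u i) v = 0" by blast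
  have "k = p - Suc m" using Suc(2) by simp
  from Suc(1)[OF this orthonormal_vecs_Suc[OF Suc(3) v]] obtain w where
    "orthonormal_vecs p p w" "\<forall>i\<in>{1..Suc m}. w i = (u(Suc m := v)) i" by auto
  then show ?case by (intro exI[of _ w]) auto
qed

section \<open>Spectrum of a matrix given by an orthonormal eigenbasis\<close>

text \<open>
  A symmetric matrix is written as \<open>spiked_mat p p \<mu> w\<close> with a full orthonormal basis \<open>w\<close>, where some of
  the eigenvalues \<open>\<mu> i\<close> may be zero.
\<close>

lemma spiked_mat_carrier: "spiked_mat p r \<mu> w \<in> carrier_mat p p"
  by (simp add: spiked_mat_def)

lemma spiked_mat_mult_vec:
  assumes "\<And>i. i \<in> {1..r} \<Longrightarrow> w i \<in> carrier_vec p" and x: "x \<in> carrier_vec p" and a: "a < p"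
  shows "(spiked_mat p r \<mu> w *\<^sub>v x) $ a = (\<Sum>i=1..r. \<mu> i * scalar_prod (w i) x * w i $ a)"
proof -
  have "(spiked_mat p r \<mu> w *\<^sub>v x) $ a = (\<Sum>b<p. (\<Sum>i=1..r. \<mu> i * w i $ a * w i $ b) * x $ b)"
    using a x by (simp add: spiked_mat_def scalar_prod_sum[of x p])
  also have "\<dots> = (\<Sum>i=1..r. \<Sum>b<p. \<mu> i * w i $ a * w i $ b * x $ b)"
    by (subst sum.swap) (simp add: sum_distrib_right)
  also have "\<dots> = (\<Sum>i=1..r. \<mu> i * scalar_prod (w i) x * w i $ a)"
    using x by (simp add: scalar_prod_sum[of x p] sum_distrib_left sum_distrib_right mult_ac)
  finally show ?thesis .
qed

lemma spiked_mat_bilinear: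
  assumes w: "\<And>i. i \<in> {1..r} \<Longrightarrow> w i \<in> carrier_vec p"
    and x: "x \<in> carrier_vec p" and y: "y \<in> carrier_vec p"
  shows "scalar_prod y (spiked_mat p r \<mu> w *\<^sub>v x)
    = (\<Sum>i=1..r. \<mu> i * scalar_prod (w i) x * scalar_prod (w i) y)"
proof -
  have "spiked_mat p r \<mu> w *\<^sub>v x \<in> carrier_vec p"
    using mult_mat_vec_carrier[OF spiked_mat_carrier x] .
  then have "scalar_prod y (spiked_mat p r \<mu> w *\<^sub>v x)
      = (\<Sum>a<p. y $ a * (\<Sum>i=1..r. \<mu> i * scalar_prod (w i) x * w i $ a))"
    unfolding scalar_prod_sum[OF \<open>spiked_mat p r \<mu> w *\<^sub>v x \<in> carrier_vec p\<close>]
    by (intro sum.cong refl, subst spiked_mat_mult_vec[OF w x]) auto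
  also have "\<dots> = (\<Sum>i=1..r. \<mu> i * scalar_prod (w i) x * (\<Sum>a<p. w i $ a * y $ a))"
    by (simp add: sum_distrib_left, subst sum.swap, simp add: mult_ac)
  finally show ?thesis using y by (simp add: scalar_prod_sum[of y p])
qed

lemma spiked_mat_mult_basis:
  assumes w: "orthonormal_vecs p p w" and j: "j \<in> {1..p}"
  shows "spiked_mat p p \<mu> w *\<^sub>v w j = \<mu> j \<cdot>\<^sub>v w j"
proof (rule eq_vecI)
  have c: "w j \<in> carrier_vec p" using w j by (rule orthonormal_vecs_carrier)
  fix a assume "a < dim_vec (\<mu> j \<cdot>\<^sub>v w j)"
  then have a: "a < p" using c by simp
  have "(spiked_mat p p \<mu> w *\<^sub>v w j) $ a = (\<Sum>i=1..p. \<mu> i * (if i = j then 1 else 0) * w i $ a)"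
    using orthonormal_vecs_scalar_prod[OF w _ j] orthonormal_vecs_carrier[OF w]
    by (subst spiked_mat_mult_vec[OF _ c a]) auto
  also have "\<dots> = \<mu> j * w j $ a"
    using j by (simp add: if_distrib[of "\<lambda>y. y * _"] if_distrib[of "\<lambda>y. _ * y"] cong: if_cong)
  finally show "(spiked_mat p p \<mu> w *\<^sub>v w j) $ a = (\<mu> j \<cdot>\<^sub>v w j) $ a" using a c by simp
next
  have c: "w j \<in> carrier_vec p" using w j by (rule orthonormal_vecs_carrier)
  show "dim_vec (spiked_mat p p \<mu> w *\<^sub>v w j) = dim_vec (\<mu> j \<cdot>\<^sub>v w j)"
    using c by (simp add: spiked_mat_def)
qed

lemma char_poly_spiked_mat:
  assumes w: "orthonormal_vecs p p w"
  shows "char_poly (spiked_mat p p \<mu> w) = (\<Prod>i\<leftarrow>[1..<Suc p]. [:- \<mu> i, 1:])"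
proof -
  define W where "W = Matrix.mat p p (\<lambda>(a, i). w (Suc i) $ a)"
  define D where "D = Matrix.mat p p (\<lambda>(i, j). if i = j then \<mu> (Suc i) else 0)"
  have W: "W \<in> carrier_mat p p" and D: "D \<in> carrier_mat p p" by (auto simp: W_def D_def)
  have WW: "W * transpose_mat W = 1\<^sub>m p"
  proof (rule eq_matI)
    fix a b assume "a < dim_row (1\<^sub>m p)" "b < dim_col (1\<^sub>m p)"
    then have ab: "a < p" "b < p" by auto
    then have "(W * transpose_mat W) $$ (a, b) = (\<Sum>i<p. w (Suc i) $ a * w (Suc i) $ b)"
      by (simp add: W_def scalar_prod_def atLeast0LessThan)
    also have "\<dots> = (\<Sum>i=1..p. w i $ a * w i $ b)"
      by (simp add: sum.atLeast1_atMost_eq[folded One_nat_def])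
    finally show "(W * transpose_mat W) $$ (a, b) = 1\<^sub>m p $$ (a, b)"
      using ab by (simp add: orthonormal_basis_complete[OF w])
  qed (use W in auto)
  have WW': "transpose_mat W * W = 1\<^sub>m p"
    using mat_mult_left_right_inverse[OF W _ WW] W by simp
  have "spiked_mat p p \<mu> w = W * D * transpose_mat W"
  proof (rule eq_matI)
    fix a b assume "a < dim_row (W * D * transpose_mat W)" "b < dim_col (W * D * transpose_mat W)"
    then have ab: "a < p" "b < p" using W D by auto
    have WD: "(W * D) $$ (a, i) = w (Suc i) $ a * \<mu> (Suc i)" if "i < p" for i
      using that ab
      by (simp add: W_def D_def scalar_prod_def atLeast0LessThan if_distrib[of "\<lambda>y. _ * y"] cong: if_cong)
    have "(W * D * transpose_mat W) $$ (a, b) = (\<Sum>i<p. (W * D) $$ (a, i) * W $$ (b, i))"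
    proof -
      have "W * D \<in> carrier_mat p p" using W D by simp
      then show ?thesis using ab W by (subst index_mult_mat(1)) (auto simp: scalar_prod_def atLeast0LessThan)
    qed
    also have "\<dots> = (\<Sum>i<p. w (Suc i) $ a * \<mu> (Suc i) * w (Suc i) $ b)"
      by (intro sum.cong refl) (simp add: WD, use ab in \<open>simp add: W_def\<close>)
    also have "\<dots> = (\<Sum>i=1..p. \<mu> i * w i $ a * w i $ b)"
      by (simp add: sum.atLeast1_atMost_eq[folded One_nat_def] mult_ac)
    finally show "spiked_mat p p \<mu> w $$ (a, b) = (W * D * transpose_mat W) $$ (a, b)"
      using ab by (simp add: spiked_mat_def)
  qed (use W D in \<open>auto simp: spiked_mat_def\<close>)
  then have "similar_mat (spiked_mat p p \<mu> w) D"
    by (intro similar_matI[of _ _ W "transpose_mat W" p])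
      (use W D WW WW' in \<open>auto simp: spiked_mat_carrier\<close>)
  then have "char_poly (spiked_mat p p \<mu> w) = char_poly D" by (rule char_poly_similar)
  also have "\<dots> = (\<Prod>a\<leftarrow>diag_mat D. [:- a, 1:])"
    by (intro char_poly_upper_triangular[OF D]) (auto simp: D_def)
  also have "diag_mat D = map \<mu> [1..<Suc p]"
    by (rule nth_equalityI) (auto simp: diag_mat_def D_def simp del: upt_Suc simp flip: plus_1_eq_Suc)
  finally show ?thesis by (simp add: o_def)
qed

text \<open>
  Sorting the roots of the characteristic polynomial, as \<^const>\<open>eigval\<close> does, changes nothing when the
  spectrum is already listed in decreasing order.
\<close>

lemma eigval_spiked_mat:
  assumes w: "orthonormal_vecs p p w" and i: "i \<in> {1..p}"
    and mono: "\<And>i j. i \<in> {1..p} \<Longrightarrow> j \<in> {1..p} \<Longrightarrow> i \<le> j \<Longrightarrow> \<mu> j \<le> \<mu> i"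
  shows "eigval (spiked_mat p p \<mu> w) i = \<mu> i"
proof -
  let ?xs = "map \<mu> [1..<Suc p]"
  have "proots (\<Prod>i\<leftarrow>js. [:- \<mu> i, 1:]) = mset (map \<mu> js)" for js :: "nat list"
  proof (induction js)
    case (Cons j js)
    have nz: "(\<Prod>i\<leftarrow>js. [:- \<mu> i, 1:]) \<noteq> 0" by (auto simp: prod_list_zero_iff)
    have "proots [:- \<mu> j, 1:] = {#\<mu> j#}"
    proof (rule multiset_eqI)
      fix x show "count (proots [:- \<mu> j, 1:]) x = count {#\<mu> j#} x"
        using order_power_n_n[of "\<mu> j" 1] by (auto intro: order_0I)
    qed
    have "proots ([:- \<mu> j, 1:] * (\<Prod>i\<leftarrow>js. [:- \<mu> i, 1:])) = {#\<mu> j#} + mset (map \<mu> js)"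
      using nz by (subst proots_mult) (auto simp: \<open>proots [:- \<mu> j, 1:] = {#\<mu> j#}\<close> Cons)
    then show ?case by (simp del: mult_pCons_left)
  qed simp
  then have pr: "proots (char_poly (spiked_mat p p \<mu> w)) = mset ?xs"
    by (simp add: char_poly_spiked_mat[OF w])
  have "sorted (rev ?xs)"
    unfolding sorted_rev_iff_nth_mono by (auto intro!: mono simp del: upt_Suc)
  then have "sorted_list_of_multiset (mset ?xs) = rev ?xs"
    by (metis mset_rev sorted_list_of_multiset_mset sort_key_id_if_sorted sorted_sort_id)
  then have "eigval (spiked_mat p p \<mu> w) i = ?xs ! (i - 1)" unfolding eigval_def pr by simp
  moreover have "?xs ! (i - 1) = \<mu> i"
    using i by (subst nth_map) (auto simp del: upt_Suc)
  ultimately show ?thesis by simp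
qed

lemma psd_spiked_mat:
  assumes w: "orthonormal_vecs p p w" and nonneg: "\<And>i. i \<in> {1..p} \<Longrightarrow> 0 \<le> \<mu> i"
  shows "psd_mat p (spiked_mat p p \<mu> w)"
  unfolding psd_mat_def
proof (intro conjI ballI)
  show "spiked_mat p p \<mu> w \<in> carrier_mat p p" by (rule spiked_mat_carrier)
  show "transpose_mat (spiked_mat p p \<mu> w) = spiked_mat p p \<mu> w"
    by (rule eq_matI) (auto simp: spiked_mat_def mult_ac)
  fix x :: "real Matrix.vec" assume x: "x \<in> carrier_vec p"
  have "scalar_prod x (spiked_mat p p \<mu> w *\<^sub>v x) = (\<Sum>i=1..p. \<mu> i * (scalar_prod (w i) x)\<^sup>2)"
    using x orthonormal_vecs_carrier[OF w]
    by (subst spiked_mat_bilinear) (auto simp: power2_eq_square mult_ac)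
  then show "0 \<le> scalar_prod x (spiked_mat p p \<mu> w *\<^sub>v x)"
    using nonneg by (auto intro!: sum_nonneg)
qed

lemma det_spiked_mat_nonzero:
  assumes w: "orthonormal_vecs p p w" and nz: "\<And>i. i \<in> {1..p} \<Longrightarrow> \<mu> i \<noteq> 0"
  shows "Determinant.det (spiked_mat p p \<mu> w) \<noteq> 0"
proof
  let ?S = "spiked_mat p p \<mu> w"
  assume "Determinant.det ?S = 0"
  then obtain x where "x \<in> carrier_vec p" "x \<noteq> 0\<^sub>v p" "?S *\<^sub>v x = 0\<^sub>v p"
    using det_0_iff_vec_prod_zero[OF spiked_mat_carrier] by blast
  then have "eigenvalue ?S 0"
    unfolding eigenvalue_def eigenvector_def
    by (intro exI[of _ x]) (auto simp: spiked_mat_def)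
  then have "poly (\<Prod>i\<leftarrow>[1..<Suc p]. [:- \<mu> i, 1:]) 0 = 0"
    by (simp add: eigenvalue_root_char_poly[OF spiked_mat_carrier] char_poly_spiked_mat[OF w])
  then show False using nz by (auto simp: poly_prod_list prod_list_zero_iff)
qed

lemma rank_sum_rank_one_le:
  assumes "finite I"
  shows "vec_space.rank p (Matrix.mat p p (\<lambda>(a, b). \<Sum>i\<in>I. f i a * g i b :: real)) \<le> card I"
  using assms
proof (induction I rule: finite_induct)
  case empty
  interpret vec_space "TYPE(real)" p .
  have "Matrix.mat p p (\<lambda>(a, b). \<Sum>i\<in>{}. f i a * g i b :: real) = 0\<^sub>m p p"
    by (rule eq_matI) auto
  moreover have "rank (0\<^sub>m p p) = 0" by (rule rank_0I)
  ultimately show ?case by (simp only: card.empty)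
next
  case (insert j I)
  interpret vec_space "TYPE(real)" p .
  let ?A = "\<lambda>I. Matrix.mat p p (\<lambda>(a, b). \<Sum>i\<in>I. f i a * g i b)"
  let ?B = "Matrix.mat p p (\<lambda>(a, b). f j a * g j b)"
  have "?A (insert j I) = ?B + ?A I" using insert by (intro eq_matI) auto
  then have "rank (?A (insert j I)) \<le> rank ?B + rank (?A I)"
    using rank_subadditive[of ?B p "?A I"] by simp
  moreover have "rank ?B \<le> 1" by (rule rank_le_1_product_entries[of _ p "f j" "g j"]) auto
  ultimately show ?case using insert by simp
qed

text \<open>
  Both bounds come from subadditivity of the rank: the matrix is a sum of \<open>r\<close> matrices of rank one,
  and adding \<open>p - r\<close> further ones makes it invertible.
\<close>

lemma rank_spiked_mat:
  assumes w: "orthonormal_vecs p p w" and rp: "r \<le> p"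
    and pos: "\<And>i. i \<in> {1..r} \<Longrightarrow> 0 < \<mu> i" and zero: "\<And>i. i \<in> {r<..p} \<Longrightarrow> \<mu> i = 0"
  shows "vec_space.rank p (spiked_mat p p \<mu> w) = r"
proof -
  interpret vec_space "TYPE(real)" p .
  let ?A = "\<lambda>I. Matrix.mat p p (\<lambda>(a, b). \<Sum>i\<in>I. (if i \<le> r then \<mu> i else 1) * w i $ a * w i $ b)"
  have A: "rank (?A I) \<le> card I" if "finite I" for I
    by (rule rank_sum_rank_one_le[OF that])
  have U: "{1..p} = {1..r} \<union> {r<..p}" using rp by auto
  have S: "spiked_mat p p \<mu> w = ?A {1..r}"
  proof (rule eq_matI)
    fix a b assume "a < dim_row (?A {1..r})" "b < dim_col (?A {1..r})"
    then show "spiked_mat p p \<mu> w $$ (a, b) = ?A {1..r} $$ (a, b)"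
      using rp zero by (simp add: spiked_mat_def, intro sum.mono_neutral_cong_right) auto
  qed (auto simp: spiked_mat_def)
  have T: "spiked_mat p p (\<lambda>i. if i \<le> r then \<mu> i else 1) w = ?A {1..r} + ?A {r<..p}"
    unfolding spiked_mat_def U
    by (intro eq_matI) (auto simp: sum.union_disjoint[of "{1..r}" "{r<..p}"] ivl_disj_int)
  have "p = rank (spiked_mat p p (\<lambda>i. if i \<le> r then \<mu> i else 1) w)"
    using det_rank_iff[OF spiked_mat_carrier] det_spiked_mat_nonzero[OF w, of "\<lambda>i. if i \<le> r then \<mu> i else 1"]
      pos by (metis (no_types, lifting) atLeastAtMost_iff less_irrefl zero_neq_one)
  also have "\<dots> \<le> rank (?A {1..r}) + rank (?A {r<..p})"
    unfolding T by (rule rank_subadditive[of _ p]) auto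
  also have "\<dots> \<le> rank (?A {1..r}) + (p - r)" using A[of "{r<..p}"] by simp
  finally show ?thesis using A[of "{1..r}"] S rp by simp
qed

text \<open>
  A simple eigenvalue determines its unit eigenvector up to sign, so linear forms of the arbitrary
  choice made by \<^const>\<open>unit_eigvec\<close> are known up to sign.
\<close>

lemma abs_scalar_prod_unit_eigvec:
  assumes w: "orthonormal_vecs p p w" and l: "l \<in> {1..p}"
    and ev: "eigval (spiked_mat p p \<mu> w) l = \<mu> l"
    and simple: "\<And>i. i \<in> {1..p} \<Longrightarrow> i \<noteq> l \<Longrightarrow> \<mu> i \<noteq> \<mu> l" and x: "x \<in> carrier_vec p"
  shows "\<bar>scalar_prod x (unit_eigvec p (spiked_mat p p \<mu> w) l)\<bar> = \<bar>scalar_prod x (w l)\<bar>"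
proof -
  let ?S = "spiked_mat p p \<mu> w"
  have wl: "w l \<in> carrier_vec p" using w l by (rule orthonormal_vecs_carrier)
  have "is_unit_eigvec p ?S l (w l)"
    using wl orthonormal_vecs_scalar_prod[OF w l l]
    by (simp add: is_unit_eigvec_def ev spiked_mat_mult_basis[OF w l] vec_norm2_def)
  then have "is_unit_eigvec p ?S l (unit_eigvec p ?S l)"
    unfolding unit_eigvec_def by (rule someI)
  then obtain v where v_def: "v = unit_eigvec p ?S l" and v: "v \<in> carrier_vec p"
    and Sv: "?S *\<^sub>v v = \<mu> l \<cdot>\<^sub>v v" and vv: "scalar_prod v v = 1"
    unfolding is_unit_eigvec_def ev by (auto simp: vec_norm2_def)
  have orth: "scalar_prod (w j) v = 0" if j: "j \<in> {1..p}" "j \<noteq> l" for j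
  proof -
    have wj: "w j \<in> carrier_vec p" using w j(1) by (rule orthonormal_vecs_carrier)
    have "\<mu> l * scalar_prod (w j) v = scalar_prod (w j) (?S *\<^sub>v v)"
      using Sv v wj by simp
    also have "\<dots> = (\<Sum>i=1..p. \<mu> i * scalar_prod (w i) v * (if i = j then 1 else 0))"
      using orthonormal_vecs_scalar_prod[OF w _ j(1)] orthonormal_vecs_carrier[OF w]
      by (subst spiked_mat_bilinear[OF _ v wj]) auto
    also have "\<dots> = \<mu> j * scalar_prod (w j) v"
      using j(1) by (simp add: if_distrib[of "\<lambda>y. _ * y"] cong: if_cong)
    finally show ?thesis using simple[OF j] by simp
  qed
  have expand: "scalar_prod y v = scalar_prod (w l) y * scalar_prod (w l) v" if y: "y \<in> carrier_vec p" for y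
  proof -
    have "scalar_prod y v = (\<Sum>i=1..p. if i = l then scalar_prod (w l) y * scalar_prod (w l) v else 0)"
      unfolding orthonormal_basis_parseval[OF w y v] using orth by (intro sum.cong) auto
    then show ?thesis using l by simp
  qed
  have "(scalar_prod (w l) v)\<^sup>2 = 1" using expand[OF v] vv by (simp add: power2_eq_square)
  then have "\<bar>scalar_prod (w l) v\<bar> = 1" by (simp add: abs_square_eq_1)
  then show ?thesis
    using expand[OF x] scalar_prod_commute[OF wl x] by (simp add: v_def abs_mult)
qed

section \<open>Rotation in a plane spanned by two eigenvectors\<close>

definition rotate_pair :: "nat \<Rightarrow> nat \<Rightarrow> real \<Rightarrow> real \<Rightarrow> (nat \<Rightarrow> real Matrix.vec) \<Rightarrow> nat \<Rightarrow> real Matrix.vec" where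
  "rotate_pair l k c s w = w(l := c \<cdot>\<^sub>v w l + s \<cdot>\<^sub>v w k, k := (- s) \<cdot>\<^sub>v w l + c \<cdot>\<^sub>v w k)"

lemma orthonormal_rotate_pair:
  assumes w: "orthonormal_vecs p p w" and lk: "l \<in> {1..p}" "k \<in> {1..p}" "l \<noteq> k" and cs: "c\<^sup>2 + s\<^sup>2 = 1"
  shows "orthonormal_vecs p p (rotate_pair l k c s w)"
proof -
  let ?v = "rotate_pair l k c s w"
  have wc: "w i \<in> carrier_vec p" if "i \<in> {1..p}" for i using w that by (rule orthonormal_vecs_carrier)
  have ww: "scalar_prod (w i) (w j) = (if i = j then 1 else 0)" if "i \<in> {1..p}" "j \<in> {1..p}" for i j
    using w that by (rule orthonormal_vecs_scalar_prod)
  have vc: "?v i \<in> carrier_vec p" if "i \<in> {1..p}" for i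
    using wc[OF that] wc[OF lk(1)] wc[OF lk(2)] by (auto simp: rotate_pair_def)
  note sp = add_scalar_prod_distrib[of _ p] scalar_prod_add_distrib[of _ p]
  have "scalar_prod (?v i) (?v j) = (if i = j then 1 else 0)" if ij: "i \<in> {1..p}" "j \<in> {1..p}" for i j
    using lk ij wc[OF ij(1)] wc[OF ij(2)] wc[OF lk(1)] wc[OF lk(2)] cs
    by (auto simp: rotate_pair_def sp ww power2_eq_square algebra_simps)
  then show ?thesis using vc unfolding orthonormal_vecs_def by blast
qed

lemma sum_pair_split:
  fixes f :: "nat \<Rightarrow> real"
  assumes "l \<in> {1..p}" "k \<in> {1..p}" "l \<noteq> k"
  shows "(\<Sum>i=1..p. f i) = f l + f k + (\<Sum>i\<in>{1..p} - {l, k}. f i)"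
proof -
  have "{1..p} = insert l (insert k ({1..p} - {l, k}))" using assms by auto
  then have "(\<Sum>i=1..p. f i) = sum f (insert l (insert k ({1..p} - {l, k})))" by simp
  also have "\<dots> = f l + f k + (\<Sum>i\<in>{1..p} - {l, k}. f i)"
    using assms(3) by (subst sum.insert, simp, simp, subst sum.insert) auto
  finally show ?thesis .
qed

text \<open>
  Since the projection onto the plane does not change, the difference of the two matrices is
  \<open>\<mu> l - \<mu> k\<close> times the difference of the projections onto the old and the new \<open>l\<close>-th eigenvector.
\<close>

lemma frobenius_norm_rotate_pair:
  assumes w: "orthonormal_vecs p p w" and lk: "l \<in> {1..p}" "k \<in> {1..p}" "l \<noteq> k" and cs: "c\<^sup>2 + s\<^sup>2 = 1"
  shows "frobenius_norm (spiked_mat p p \<mu> (rotate_pair l k c s w) - spiked_mat p p \<mu> w)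
    = sqrt 2 * \<bar>\<mu> l - \<mu> k\<bar> * \<bar>s\<bar>"
proof -
  let ?v = "rotate_pair l k c s w"
  let ?d = "\<mu> l - \<mu> k"
  have wc: "w l \<in> carrier_vec p" "w k \<in> carrier_vec p" using w lk by (auto intro: orthonormal_vecs_carrier)
  have pair: "(\<Sum>a<p. (w l $ a * x + w k $ a * y)\<^sup>2) = x\<^sup>2 + y\<^sup>2" for x y
  proof -
    have "(w l $ a * x + w k $ a * y)\<^sup>2
        = x\<^sup>2 * (w l $ a * w l $ a) + 2 * x * y * (w l $ a * w k $ a) + y\<^sup>2 * (w k $ a * w k $ a)" for a
      by (simp add: power2_eq_square algebra_simps)
    then have "(\<Sum>a<p. (w l $ a * x + w k $ a * y)\<^sup>2)
      = x\<^sup>2 * scalar_prod (w l) (w l) + 2 * x * y * scalar_prod (w l) (w k) + y\<^sup>2 * scalar_prod (w k) (w k)"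
      by (simp only: sum.distrib sum_distrib_left[symmetric] scalar_prod_sum[OF wc(1)] scalar_prod_sum[OF wc(2)])
    then show ?thesis using orthonormal_vecs_scalar_prod[OF w] lk by simp
  qed
  \<comment> \<open>each row of the difference is a combination of \<open>w l\<close> and \<open>w k\<close>, so that \<open>pair\<close> sums over both indices\<close>
  have entry: "(spiked_mat p p \<mu> ?v - spiked_mat p p \<mu> w) $$ (a, b)
      = w l $ a * (w l $ b * (- ?d * s\<^sup>2) + w k $ b * (?d * c * s))
      + w k $ a * (w l $ b * (?d * c * s) + w k $ b * (?d * s\<^sup>2))"
    if ab: "a < p" "b < p" for a b
  proof -
    have rest: "(\<Sum>i\<in>{1..p} - {l, k}. \<mu> i * ?v i $ a * ?v i $ b) = (\<Sum>i\<in>{1..p} - {l, k}. \<mu> i * w i $ a * w i $ b)"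
      by (intro sum.cong) (auto simp: rotate_pair_def)
    have c2: "c\<^sup>2 = 1 - s\<^sup>2" using cs by simp
    have "(spiked_mat p p \<mu> ?v - spiked_mat p p \<mu> w) $$ (a, b)
      = \<mu> l * (c * w l $ a + s * w k $ a) * (c * w l $ b + s * w k $ b)
      + \<mu> k * (- s * w l $ a + c * w k $ a) * (- s * w l $ b + c * w k $ b)
      - \<mu> l * w l $ a * w l $ b - \<mu> k * w k $ a * w k $ b"
      using ab wc lk(3)
      by (simp add: spiked_mat_def sum_pair_split[OF lk] rest) (simp add: rotate_pair_def)
    also have "\<dots> = w l $ a * (w l $ b * ((c\<^sup>2 - 1) * \<mu> l + s\<^sup>2 * \<mu> k) + w k $ b * (?d * c * s))
      + w k $ a * (w l $ b * (?d * c * s) + w k $ b * (s\<^sup>2 * \<mu> l + (c\<^sup>2 - 1) * \<mu> k))"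
      by (simp add: power2_eq_square algebra_simps)
    finally show ?thesis by (simp add: c2 algebra_simps)
  qed
  have "(\<Sum>a<p. \<Sum>b<p. ((spiked_mat p p \<mu> ?v - spiked_mat p p \<mu> w) $$ (a, b))\<^sup>2)
      = (\<Sum>b<p. (w l $ b * (- ?d * s\<^sup>2) + w k $ b * (?d * c * s))\<^sup>2
        + (w l $ b * (?d * c * s) + w k $ b * (?d * s\<^sup>2))\<^sup>2)"
    by (subst sum.swap) (simp add: entry pair cong: sum.cong_simp)
  also have "\<dots> = 2 * (?d * s)\<^sup>2 * (c\<^sup>2 + s\<^sup>2)"
    by (simp only: sum.distrib pair) (simp add: power2_eq_square algebra_simps)
  also have "\<dots> = 2 * (?d * s)\<^sup>2" by (simp add: cs)
  finally show ?thesis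
    unfolding frobenius_norm_def by (simp add: spiked_mat_def real_sqrt_mult abs_mult)
qed

lemma spiked_mat_add_scalar:
  assumes w: "orthonormal_vecs p p w"
  shows "spiked_mat p p \<mu> w + t \<cdot>\<^sub>m 1\<^sub>m p = spiked_mat p p (\<lambda>i. \<mu> i + t) w"
proof (rule eq_matI)
  fix a b assume "a < dim_row (spiked_mat p p (\<lambda>i. \<mu> i + t) w)" "b < dim_col (spiked_mat p p (\<lambda>i. \<mu> i + t) w)"
  then have ab: "a < p" "b < p" by (auto simp: spiked_mat_def)
  have "(\<Sum>i=1..p. (\<mu> i + t) * w i $ a * w i $ b)
      = (\<Sum>i=1..p. \<mu> i * w i $ a * w i $ b) + t * (\<Sum>i=1..p. w i $ a * w i $ b)"
    by (simp only: distrib_right sum.distrib sum_distrib_left mult.assoc)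
  then show "(spiked_mat p p \<mu> w + t \<cdot>\<^sub>m 1\<^sub>m p) $$ (a, b) = spiked_mat p p (\<lambda>i. \<mu> i + t) w $$ (a, b)"
    using ab by (simp add: spiked_mat_def orthonormal_basis_complete[OF w])
qed (auto simp: spiked_mat_def)

text \<open>
  A square root of the covariance with eigenvalues \<open>\<nu>\<close>, adapted to the rotation whose half angle has
  cosine \<open>c\<close> and sine \<open>s\<close>. Its \<open>k\<close>-th column points along the axis \<open>c w\<^sub>l + s w\<^sub>k\<close> at the half angle and
  has the length of the conditional standard deviation of the coordinate along the axis, given the one
  across it; \<open>m\<close> is the standard deviation of the latter. The \<open>l\<close>-th column is then determined up to
  sign. Samples use coordinates from 0, hence \<open>Suc j\<close>.
\<close>

definition sheared_root :: "nat \<Rightarrow> nat \<Rightarrow> real \<Rightarrow> real \<Rightarrow> (nat \<Rightarrow> real) \<Rightarrow> (nat \<Rightarrow> real Matrix.vec)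
    \<Rightarrow> nat \<Rightarrow> nat \<Rightarrow> real" where
  "sheared_root l k c s \<nu> w a j =
    (let m = sqrt (\<nu> l * s\<^sup>2 + \<nu> k * c\<^sup>2) in
     if Suc j = l then (\<nu> k * c * w k $ a - \<nu> l * s * w l $ a) / m
     else if Suc j = k then sqrt (\<nu> l * \<nu> k) * (c * w l $ a + s * w k $ a) / m
     else sqrt (\<nu> (Suc j)) * w (Suc j) $ a)"

text \<open>
  Twice the regression coefficient of the axis coordinate on the other one, after both the latter and
  the residual have been scaled to variance 1.
\<close>

definition shear_slope :: "real \<Rightarrow> real \<Rightarrow> real \<Rightarrow> real \<Rightarrow> real" where
  "shear_slope \<alpha> \<beta> c s = (\<alpha> - \<beta>) * (2 * s * c) / sqrt (\<alpha> * \<beta>)"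

text \<open>
  The coefficients of \<open>x x'\<close>, of \<open>x z' + z x'\<close> and of \<open>z z'\<close> in the second identity of
  \<open>sheared_root_coeffs\<close> below, cleared of denominators.
\<close>

lemma sheared_root_algebra:
  fixes \<alpha> \<beta> c s :: real
  assumes cs: "c\<^sup>2 + s\<^sup>2 = 1"
  shows "(2 * (\<alpha> - \<beta>) * s * c\<^sup>2 - \<alpha> * s)\<^sup>2 + \<alpha> * \<beta> * c\<^sup>2
      = (\<alpha> * s\<^sup>2 + \<beta> * c\<^sup>2) * (\<alpha> * (c\<^sup>2 - s\<^sup>2)\<^sup>2 + \<beta> * (2 * s * c)\<^sup>2)"
    and "(2 * (\<alpha> - \<beta>) * s * c\<^sup>2 - \<alpha> * s) * (\<beta> * c + 2 * (\<alpha> - \<beta>) * s\<^sup>2 * c) + \<alpha> * \<beta> * (c * s)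
      = (\<alpha> * s\<^sup>2 + \<beta> * c\<^sup>2) * ((\<alpha> - \<beta>) * (c\<^sup>2 - s\<^sup>2) * (2 * s * c))"
    and "(\<beta> * c + 2 * (\<alpha> - \<beta>) * s\<^sup>2 * c)\<^sup>2 + \<alpha> * \<beta> * s\<^sup>2
      = (\<alpha> * s\<^sup>2 + \<beta> * c\<^sup>2) * (\<alpha> * (2 * s * c)\<^sup>2 + \<beta> * (c\<^sup>2 - s\<^sup>2)\<^sup>2)"
proof -
  define q where "q = s\<^sup>2"
  have q: "s\<^sup>2 = q" and p: "c\<^sup>2 = 1 - q" using cs by (auto simp: q_def)
  have n0: "2 * (\<alpha> - \<beta>) * s * c\<^sup>2 - \<alpha> * s = s * (2 * (\<alpha> - \<beta>) * (1 - q) - \<alpha>)"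
    and n1: "\<beta> * c + 2 * (\<alpha> - \<beta>) * s\<^sup>2 * c = c * (\<beta> + 2 * (\<alpha> - \<beta>) * q)"
    by (simp_all add: q p algebra_simps)
  have "q * (2 * (\<alpha> - \<beta>) * (1 - q) - \<alpha>)\<^sup>2 + \<alpha> * \<beta> * (1 - q)
      = (\<alpha> * q + \<beta> * (1 - q)) * (\<alpha> * (1 - q - q)\<^sup>2 + \<beta> * (4 * q * (1 - q)))"
    by (simp add: power2_eq_square algebra_simps)
  then show "(2 * (\<alpha> - \<beta>) * s * c\<^sup>2 - \<alpha> * s)\<^sup>2 + \<alpha> * \<beta> * c\<^sup>2
      = (\<alpha> * s\<^sup>2 + \<beta> * c\<^sup>2) * (\<alpha> * (c\<^sup>2 - s\<^sup>2)\<^sup>2 + \<beta> * (2 * s * c)\<^sup>2)"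
    unfolding n0 by (simp add: power_mult_distrib q p mult.assoc)
  have "(2 * (\<alpha> - \<beta>) * (1 - q) - \<alpha>) * (\<beta> + 2 * (\<alpha> - \<beta>) * q) + \<alpha> * \<beta>
      = (\<alpha> * q + \<beta> * (1 - q)) * ((\<alpha> - \<beta>) * (1 - q - q) * 2)"
    by (simp add: algebra_simps)
  then have "s * c * ((2 * (\<alpha> - \<beta>) * (1 - q) - \<alpha>) * (\<beta> + 2 * (\<alpha> - \<beta>) * q) + \<alpha> * \<beta>)
      = s * c * ((\<alpha> * q + \<beta> * (1 - q)) * ((\<alpha> - \<beta>) * (1 - q - q) * 2))" by (rule arg_cong)
  then show "(2 * (\<alpha> - \<beta>) * s * c\<^sup>2 - \<alpha> * s) * (\<beta> * c + 2 * (\<alpha> - \<beta>) * s\<^sup>2 * c) + \<alpha> * \<beta> * (c * s)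
      = (\<alpha> * s\<^sup>2 + \<beta> * c\<^sup>2) * ((\<alpha> - \<beta>) * (c\<^sup>2 - s\<^sup>2) * (2 * s * c))"
    unfolding n0 n1 unfolding q p by (simp add: algebra_simps)
  have "(1 - q) * (\<beta> + 2 * (\<alpha> - \<beta>) * q)\<^sup>2 + \<alpha> * \<beta> * q
      = (\<alpha> * q + \<beta> * (1 - q)) * (\<alpha> * (4 * q * (1 - q)) + \<beta> * (1 - q - q)\<^sup>2)"
    by (simp add: power2_eq_square algebra_simps)
  then show "(\<beta> * c + 2 * (\<alpha> - \<beta>) * s\<^sup>2 * c)\<^sup>2 + \<alpha> * \<beta> * s\<^sup>2
      = (\<alpha> * s\<^sup>2 + \<beta> * c\<^sup>2) * (\<alpha> * (2 * s * c)\<^sup>2 + \<beta> * (c\<^sup>2 - s\<^sup>2)\<^sup>2)"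
    unfolding n1 by (simp add: power_mult_distrib q p mult.assoc)
qed

text \<open>
  The contribution of the columns \<open>l\<close> and \<open>k\<close> to an entry of root times transposed root, where \<open>x, x'\<close>
  are entries of \<open>w\<^sub>l\<close> and \<open>z, z'\<close> entries of \<open>w\<^sub>k\<close>: before the shear it belongs to the original
  eigenvectors, after adding \<open>y\<close> times column \<open>k\<close> to column \<open>l\<close> to the rotated ones.
\<close>

lemma sheared_root_coeffs:
  fixes \<alpha> \<beta> c s :: real
  assumes \<alpha>: "0 < \<alpha>" and \<beta>: "0 < \<beta>" and cs: "c\<^sup>2 + s\<^sup>2 = 1"
  defines "m \<equiv> sqrt (\<alpha> * s\<^sup>2 + \<beta> * c\<^sup>2)" and "g \<equiv> sqrt (\<alpha> * \<beta>)"
    and "y \<equiv> shear_slope \<alpha> \<beta> c s"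
  shows "(\<beta> * c * z - \<alpha> * s * x) / m * ((\<beta> * c * z' - \<alpha> * s * x') / m)
        + g * (c * x + s * z) / m * (g * (c * x' + s * z') / m) = \<alpha> * x * x' + \<beta> * z * z'" (is ?A)
    and "((\<beta> * c * z - \<alpha> * s * x) / m + y * (g * (c * x + s * z) / m))
          * ((\<beta> * c * z' - \<alpha> * s * x') / m + y * (g * (c * x' + s * z') / m))
        + g * (c * x + s * z) / m * (g * (c * x' + s * z') / m)
      = \<alpha> * ((c\<^sup>2 - s\<^sup>2) * x + 2 * s * c * z) * ((c\<^sup>2 - s\<^sup>2) * x' + 2 * s * c * z')
        + \<beta> * ((c\<^sup>2 - s\<^sup>2) * z - 2 * s * c * x) * ((c\<^sup>2 - s\<^sup>2) * z' - 2 * s * c * x')" (is ?B)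
proof -
  have "0 < \<alpha> * s\<^sup>2 + \<beta> * c\<^sup>2"
  proof (cases "s = 0")
    case True
    then show ?thesis using cs \<beta> by simp
  next
    case False
    then show ?thesis using \<alpha> \<beta> by (intro add_pos_nonneg) auto
  qed
  then have m2: "m * m = \<alpha> * s\<^sup>2 + \<beta> * c\<^sup>2" and m0: "m \<noteq> 0" by (auto simp: m_def)
  have g2: "g * g = \<alpha> * \<beta>" and g0: "g \<noteq> 0" using \<alpha> \<beta> by (auto simp: g_def)
  have yg: "y * (g * r) = (\<alpha> - \<beta>) * (2 * s * c) * r" for r
    using g0 by (simp add: y_def shear_slope_def g_def[symmetric])
  have over: "X / m * (X' / m) + G / m * (G' / m) = (X * X' + G * G') / (m * m)" for X X' G G'
    by (simp add: add_divide_distrib)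
  have gg: "g * r * (g * r') = \<alpha> * \<beta> * (r * r')" for r r' by (metis g2 mult.assoc mult.left_commute)
  show ?A
  proof -
    have "(\<beta> * c * z - \<alpha> * s * x) * (\<beta> * c * z' - \<alpha> * s * x') + \<alpha> * \<beta> * ((c * x + s * z) * (c * x' + s * z'))
        = (\<alpha> * x * x' + \<beta> * z * z') * (m * m)"
      unfolding m2 by (simp add: power2_eq_square algebra_simps)
    then show ?thesis unfolding over gg using m0 by simp
  qed
  let ?n0 = "2 * (\<alpha> - \<beta>) * s * c\<^sup>2 - \<alpha> * s" and ?n1 = "\<beta> * c + 2 * (\<alpha> - \<beta>) * s\<^sup>2 * c"
  have N: "((\<beta> * c * z - \<alpha> * s * x) / m + y * (g * (c * x + s * z) / m)) = (?n0 * x + ?n1 * z) / m" for x z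
    using yg[of "c * x + s * z"] by (simp add: add_divide_distrib[symmetric] power2_eq_square algebra_simps)
  show ?B
  proof -
    let ?C = "c\<^sup>2 - s\<^sup>2" and ?S = "2 * s * c"
    have expand: "(n0 * x + n1 * z) * (n0 * x' + n1 * z') + \<alpha> * \<beta> * ((c * x + s * z) * (c * x' + s * z'))
        = (n0\<^sup>2 + \<alpha> * \<beta> * c\<^sup>2) * (x * x') + (n0 * n1 + \<alpha> * \<beta> * (c * s)) * (x * z' + z * x')
          + (n1\<^sup>2 + \<alpha> * \<beta> * s\<^sup>2) * (z * z')" for n0 n1
      by (simp add: power2_eq_square algebra_simps)
    have pull: "M * X * t + M * Y * u + M * Z * v = M * (X * t + Y * u + Z * v)" for M X Y Z t u v :: real
      by (simp add: algebra_simps)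
    have collect: "(\<alpha> * C\<^sup>2 + \<beta> * S\<^sup>2) * (x * x')
        + ((\<alpha> - \<beta>) * C * S) * (x * z' + z * x') + (\<alpha> * S\<^sup>2 + \<beta> * C\<^sup>2) * (z * z')
      = \<alpha> * (C * x + S * z) * (C * x' + S * z') + \<beta> * (C * z - S * x) * (C * z' - S * x')" for C S
      by (simp add: power2_eq_square algebra_simps)
    have "(?n0 * x + ?n1 * z) * (?n0 * x' + ?n1 * z') + \<alpha> * \<beta> * ((c * x + s * z) * (c * x' + s * z'))
        = (?n0\<^sup>2 + \<alpha> * \<beta> * c\<^sup>2) * (x * x') + (?n0 * ?n1 + \<alpha> * \<beta> * (c * s)) * (x * z' + z * x')
          + (?n1\<^sup>2 + \<alpha> * \<beta> * s\<^sup>2) * (z * z')"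
      by (rule expand)
    also have "\<dots> = (m * m) * ((\<alpha> * ?C\<^sup>2 + \<beta> * ?S\<^sup>2) * (x * x')
        + ((\<alpha> - \<beta>) * ?C * ?S) * (x * z' + z * x') + (\<alpha> * ?S\<^sup>2 + \<beta> * ?C\<^sup>2) * (z * z'))"
      unfolding sheared_root_algebra[OF cs] m2 by (rule pull)
    also have "(\<alpha> * ?C\<^sup>2 + \<beta> * ?S\<^sup>2) * (x * x')
        + ((\<alpha> - \<beta>) * ?C * ?S) * (x * z' + z * x') + (\<alpha> * ?S\<^sup>2 + \<beta> * ?C\<^sup>2) * (z * z')
      = \<alpha> * (?C * x + ?S * z) * (?C * x' + ?S * z') + \<beta> * (?C * z - ?S * x) * (?C * z' - ?S * x')"
      by (rule collect)
    finally show ?thesis unfolding N over gg using m0 by simp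
  qed
qed

text \<open>
  Adding \<open>y\<close> times column \<open>k\<close> to column \<open>l\<close> of the root amounts to shearing the standard normal vector
  first. By \<open>sheared_root_coeffs\<close> it turns the root of the original covariance into one of the rotated
  covariance.
\<close>

lemma normal_law_rotate_pair:
  assumes w: "orthonormal_vecs p p w" and lk: "l \<in> {1..p}" "k \<in> {1..p}" "l \<noteq> k"
    and pos: "\<And>i. i \<in> {1..p} \<Longrightarrow> 0 \<le> \<nu> i" "0 < \<nu> l" "0 < \<nu> k" and cs: "c\<^sup>2 + s\<^sup>2 = 1"
  defines "y \<equiv> shear_slope (\<nu> l) (\<nu> k) c s" and "R \<equiv> sheared_root l k c s \<nu> w"
  shows "normal_law p (spiked_mat p p \<nu> w) = distr (std_normal_vec p) (sample_space p) (linear_image p R)"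
    and "normal_law p (spiked_mat p p \<nu> (rotate_pair l k (c\<^sup>2 - s\<^sup>2) (2 * s * c) w))
      = distr (std_normal_vec p) (sample_space p) (linear_image p R \<circ> shear (l - 1) (k - 1) y)"
proof -
  let ?v = "rotate_pair l k (c\<^sup>2 - s\<^sup>2) (2 * s * c) w"
  define R' where "R' a j = (if Suc j = l then R a j + y * R a (k - 1) else R a j)" for a j
  have wc: "w l \<in> carrier_vec p" "w k \<in> carrier_vec p" using w lk by (auto intro: orthonormal_vecs_carrier)
  obtain l' k' where l': "l = Suc l'" "l' < p" and k': "k = Suc k'" "k' < p"
    using lk by (cases l; cases k) auto
  have split: "(\<Sum>j<p. f (Suc j)) = f l + f k + (\<Sum>i\<in>{1..p} - {l, k}. f i)" for f :: "nat \<Rightarrow> real"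
    using sum_pair_split[OF lk, of f] by (simp add: sum.atLeast1_atMost_eq[folded One_nat_def])
  have rest: "R a (i - 1) * R b (i - 1) = \<nu> i * w i $ a * w i $ b"
    if i: "i \<in> {1..p} - {l, k}" for a b i
  proof -
    have "Suc (i - 1) = i" using i by auto
    then have "R x (i - 1) = sqrt (\<nu> i) * w i $ x" for x
      using i by (simp add: R_def sheared_root_def)
    then have "R a (i - 1) * R b (i - 1) = (sqrt (\<nu> i) * sqrt (\<nu> i)) * (w i $ a * w i $ b)" by simp
    then show ?thesis using pos(1)[of i] i by simp
  qed
  have Rl: "R a (l - 1) = (\<nu> k * c * w k $ a - \<nu> l * s * w l $ a) / sqrt (\<nu> l * s\<^sup>2 + \<nu> k * c\<^sup>2)"
    and Rk: "R a (k - 1) = sqrt (\<nu> l * \<nu> k) * (c * w l $ a + s * w k $ a) / sqrt (\<nu> l * s\<^sup>2 + \<nu> k * c\<^sup>2)" for a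
    using l' k' lk(3) by (auto simp: R_def sheared_root_def)
  show "normal_law p (spiked_mat p p \<nu> w) = distr (std_normal_vec p) (sample_space p) (linear_image p R)"
  proof (rule normal_law_eq_linear_image[OF spiked_mat_carrier])
    fix a b assume ab: "a < p" "b < p"
    have "(\<Sum>j<p. R a j * R b j) = R a (l - 1) * R b (l - 1) + R a (k - 1) * R b (k - 1)
        + (\<Sum>i\<in>{1..p} - {l, k}. R a (i - 1) * R b (i - 1))"
      using split[of "\<lambda>i. R a (i - 1) * R b (i - 1)"] by simp
    also have "\<dots> = (\<nu> l * w l $ a * w l $ b + \<nu> k * w k $ a * w k $ b)
        + (\<Sum>i\<in>{1..p} - {l, k}. \<nu> i * w i $ a * w i $ b)"
      unfolding Rl Rk sheared_root_coeffs(1)[OF pos(2,3) cs] by (simp add: rest)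
    also have "\<dots> = spiked_mat p p \<nu> w $$ (a, b)"
      using ab by (simp add: spiked_mat_def sum_pair_split[OF lk])
    finally show "(\<Sum>j<p. R a j * R b j) = spiked_mat p p \<nu> w $$ (a, b)" .
  qed
  have R'l: "R' a (l - 1) = R a (l - 1) + y * R a (k - 1)" and R'k: "R' a (k - 1) = R a (k - 1)" for a
    using l' k' lk(3) by (auto simp: R'_def)
  have "normal_law p (spiked_mat p p \<nu> ?v) = distr (std_normal_vec p) (sample_space p) (linear_image p R')"
  proof (rule normal_law_eq_linear_image[OF spiked_mat_carrier])
    fix a b assume ab: "a < p" "b < p"
    have R'rest: "R' x (i - 1) = R x (i - 1)" if "i \<in> {1..p} - {l, k}" for x i
      using that by (auto simp: R'_def)
    have "(\<Sum>j<p. R' a j * R' b j) = R' a (l - 1) * R' b (l - 1) + R' a (k - 1) * R' b (k - 1)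
        + (\<Sum>i\<in>{1..p} - {l, k}. R' a (i - 1) * R' b (i - 1))"
      using split[of "\<lambda>i. R' a (i - 1) * R' b (i - 1)"] by simp
    also have "\<dots> = (\<nu> l * ?v l $ a * ?v l $ b + \<nu> k * ?v k $ a * ?v k $ b)
        + (\<Sum>i\<in>{1..p} - {l, k}. R a (i - 1) * R b (i - 1))"
      unfolding R'l R'k unfolding Rl Rk y_def sheared_root_coeffs(2)[OF pos(2,3) cs]
      using wc ab lk(3) by (simp add: R'rest rotate_pair_def)
    also have "(\<Sum>i\<in>{1..p} - {l, k}. R a (i - 1) * R b (i - 1))
        = (\<Sum>i\<in>{1..p} - {l, k}. \<nu> i * ?v i $ a * ?v i $ b)"
      by (intro sum.cong refl) (simp add: rest, simp add: rotate_pair_def)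
    also have "\<nu> l * ?v l $ a * ?v l $ b + \<nu> k * ?v k $ a * ?v k $ b + \<dots> = spiked_mat p p \<nu> ?v $$ (a, b)"
      using ab by (simp add: spiked_mat_def sum_pair_split[OF lk])
    finally show "(\<Sum>j<p. R' a j * R' b j) = spiked_mat p p \<nu> ?v $$ (a, b)" .
  qed
  also have "linear_image p R' = linear_image p R \<circ> shear (l - 1) (k - 1) y"
  proof
    fix z
    have "(\<Sum>j<p. R' a j * z j) = (\<Sum>j<p. R a j * shear (l - 1) (k - 1) y z j)" for a
    proof -
      have "(\<Sum>i\<in>{1..p} - {l, k}. R' a (i - 1) * z (i - 1))
          = (\<Sum>i\<in>{1..p} - {l, k}. R a (i - 1) * shear (l - 1) (k - 1) y z (i - 1))"
        using k' by (intro sum.cong) (auto simp: R'_def shear_def)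
      then show ?thesis
        using split[of "\<lambda>i. R' a (i - 1) * z (i - 1)"]
          split[of "\<lambda>i. R a (i - 1) * shear (l - 1) (k - 1) y z (i - 1)"] l' k' lk(3)
        by (simp add: R'l R'k) (simp add: R'_def shear_def algebra_simps)
    qed
    then show "linear_image p R' z = (linear_image p R \<circ> shear (l - 1) (k - 1) y) z"
      unfolding linear_image_def by simp
  qed
  finally show "normal_law p (spiked_mat p p \<nu> ?v)
      = distr (std_normal_vec p) (sample_space p) (linear_image p R \<circ> shear (l - 1) (k - 1) y)" .
qed

section \<open>Minimax bounds along one direction\<close>

lemma double_angle_unit:
  fixes c s :: real
  assumes "c\<^sup>2 + s\<^sup>2 = 1"
  shows "(c\<^sup>2 - s\<^sup>2)\<^sup>2 + (2 * s * c)\<^sup>2 = 1"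
proof -
  have "(c\<^sup>2 - s\<^sup>2)\<^sup>2 + (2 * s * c)\<^sup>2 = (c\<^sup>2 + s\<^sup>2)\<^sup>2"
    by (simp add: power2_eq_square algebra_simps)
  then show ?thesis using assms by simp
qed

text \<open>
  The loss is the distance of \<open>\<bar>t\<bar>\<close> to \<open>\<bar>x\<bar>\<close>, so for every estimate the two losses add up to at least the
  difference of the absolute values of the two targets, whichever signs the eigenvectors have.
\<close>

lemma minimax_two_point:
  assumes w: "orthonormal_vecs p p w" and lk: "l \<in> {1..p}" "k \<in> {1..p}" "l \<noteq> k"
    and \<mu>: "\<And>i. i \<in> {1..p} \<Longrightarrow> 0 \<le> \<mu> i" "0 < \<mu> l + \<sigma>\<^sup>2" "0 < \<mu> k + \<sigma>\<^sup>2" and cs: "c\<^sup>2 + s\<^sup>2 = 1"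
    and y: "real n * (shear_slope (\<mu> l + \<sigma>\<^sup>2) (\<mu> k + \<sigma>\<^sup>2) c s)\<^sup>2 \<le> 1/4"
  defines "S0 \<equiv> spiked_mat p p \<mu> w"
    and "S1 \<equiv> spiked_mat p p \<mu> (rotate_pair l k (c\<^sup>2 - s\<^sup>2) (2 * s * c) w)"
  assumes M: "S0 \<in> M" "S1 \<in> M"
  shows "ennreal (15/64 * \<bar>\<bar>scalar_prod a (unit_eigvec p S1 l)\<bar> - \<bar>scalar_prod a (unit_eigvec p S0 l)\<bar>\<bar>)
    \<le> minimax_risk p n l \<sigma> a M"
  unfolding minimax_risk_def
proof (rule INF_greatest)
  fix est assume est: "est \<in> estimators p n"
  define x0 where "x0 = scalar_prod a (unit_eigvec p S0 l)"
  define x1 where "x1 = scalar_prod a (unit_eigvec p S1 l)"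
  let ?\<nu> = "\<lambda>i. \<mu> i + \<sigma>\<^sup>2"
  let ?v = "rotate_pair l k (c\<^sup>2 - s\<^sup>2) (2 * s * c) w"
  let ?y = "shear_slope (\<mu> l + \<sigma>\<^sup>2) (\<mu> k + \<sigma>\<^sup>2) c s"
  let ?h = "\<lambda>x t. ennreal (min \<bar>est t - x\<bar> \<bar>est t + x\<bar>)"
  have "(c\<^sup>2 - s\<^sup>2)\<^sup>2 + (2 * s * c)\<^sup>2 = 1" using cs by (rule double_angle_unit)
  then have v: "orthonormal_vecs p p ?v" by (rule orthonormal_rotate_pair[OF w lk])
  have \<nu>: "0 \<le> ?\<nu> i" if "i \<in> {1..p}" for i using \<mu>(1)[OF that] by simp
  note laws = normal_law_rotate_pair[OF w lk, of ?\<nu>, OF \<nu> \<mu>(2,3) cs]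
  have S: "S0 + \<sigma>\<^sup>2 \<cdot>\<^sub>m 1\<^sub>m p = spiked_mat p p ?\<nu> w" "S1 + \<sigma>\<^sup>2 \<cdot>\<^sub>m 1\<^sub>m p = spiked_mat p p ?\<nu> ?v"
    unfolding S0_def S1_def by (simp_all add: spiked_mat_add_scalar w v)
  have em[measurable]: "est \<in> borel_measurable (\<Pi>\<^sub>M i\<in>{1..n}. sample_space p)"
    using est by (simp add: estimators_def)
  have tri: "ennreal \<bar>\<bar>x1\<bar> - \<bar>x0\<bar>\<bar> \<le> ?h x0 t + ?h x1 t" for t
  proof -
    have "\<bar>\<bar>x1\<bar> - \<bar>x0\<bar>\<bar> \<le> min \<bar>est t - x0\<bar> \<bar>est t + x0\<bar> + min \<bar>est t - x1\<bar> \<bar>est t + x1\<bar>"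
      by (simp add: min_def abs_if)
    then show ?thesis by (simp add: ennreal_leI flip: ennreal_plus)
  qed
  have "ennreal (15/32 * \<bar>\<bar>x1\<bar> - \<bar>x0\<bar>\<bar>)
    \<le> (\<integral>\<^sup>+t. ?h x0 t \<partial>(\<Pi>\<^sub>M i\<in>{1..n}. normal_law p (spiked_mat p p ?\<nu> w)))
      + (\<integral>\<^sup>+t. ?h x1 t \<partial>(\<Pi>\<^sub>M i\<in>{1..n}. normal_law p (spiked_mat p p ?\<nu> ?v)))"
  proof (rule shear_two_point_bound[where l = "l - 1" and k = "k - 1" and y = ?y, OF _ _ _ y laws])
    show "l - 1 < p" "k - 1 < p" "l - 1 \<noteq> k - 1" using lk by auto
  qed (use tri in auto)
  also have "\<dots> = risk p n l \<sigma> a S0 est + risk p n l \<sigma> a S1 est"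
    unfolding risk_def S x0_def x1_def ..
  also have "\<dots> \<le> (SUP S\<in>M. risk p n l \<sigma> a S est) + (SUP S\<in>M. risk p n l \<sigma> a S est)"
    using M by (intro add_mono SUP_upper)
  finally have le: "ennreal (15/32 * \<bar>\<bar>x1\<bar> - \<bar>x0\<bar>\<bar>) \<le> 2 * (SUP S\<in>M. risk p n l \<sigma> a S est)"
    by (simp add: mult_2)
  have "ennreal (15/64 * \<bar>\<bar>x1\<bar> - \<bar>x0\<bar>\<bar>) = ennreal (1/2) * ennreal (15/32 * \<bar>\<bar>x1\<bar> - \<bar>x0\<bar>\<bar>)"
  proof -
    have "ennreal (15/64 * \<bar>\<bar>x1\<bar> - \<bar>x0\<bar>\<bar>) = ennreal (1/2 * (15/32 * \<bar>\<bar>x1\<bar> - \<bar>x0\<bar>\<bar>))" by simp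
    also have "\<dots> = ennreal (1/2) * ennreal (15/32 * \<bar>\<bar>x1\<bar> - \<bar>x0\<bar>\<bar>)" by (rule ennreal_mult) auto
    finally show ?thesis .
  qed
  also have "\<dots> \<le> ennreal (1/2) * (2 * (SUP S\<in>M. risk p n l \<sigma> a S est))"
    using le by (rule mult_left_mono) simp
  also have "\<dots> = (SUP S\<in>M. risk p n l \<sigma> a S est)"
  proof -
    have "ennreal (1/2) * 2 = 1" using ennreal_mult[of "1/2" 2] by simp
    then show ?thesis by (metis mult.assoc mult_1)
  qed
  finally show "ennreal (15/64 * \<bar>\<bar>scalar_prod a (unit_eigvec p S1 l)\<bar> - \<bar>scalar_prod a (unit_eigvec p S0 l)\<bar>\<bar>)
    \<le> (SUP S\<in>M. risk p n l \<sigma> a S est)" unfolding x0_def x1_def .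
qed

text \<open>
  The absolute value \<open>\<bar>A\<bar>\<close> is compared with that of its rotated version, where \<open>c\<close> and \<open>s\<close> belong to half
  of the angle. If the rotated multiple of \<open>A\<close> dominates that of \<open>B\<close>, rotating against the sign of \<open>A B\<close>
  makes the losses from the cosine and from the sine add up. Otherwise rotating with that sign gains
  more from \<open>B\<close> than the cosine takes from \<open>A\<close>, as \<open>\<bar>A\<bar>\<close> is then small.
\<close>

lemma rotation_gap:
  fixes A B \<delta> :: real
  assumes \<delta>: "0 \<le> \<delta>" "\<delta> \<le> 1"
  defines "c \<equiv> sqrt (1 - (\<delta> / 4)\<^sup>2)"
  shows "\<exists>s\<in>{\<delta> / 4, - (\<delta> / 4)}. (\<delta>\<^sup>2 * \<bar>A\<bar> + \<delta> * \<bar>B\<bar>) / 16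
    \<le> \<bar>\<bar>(c\<^sup>2 - s\<^sup>2) * A + 2 * s * c * B\<bar> - \<bar>A\<bar>\<bar>"
proof -
  define r where "r = \<delta> / 4"
  have r: "0 \<le> r" "r \<le> 1/4" using \<delta> by (auto simp: r_def)
  have r2: "r\<^sup>2 \<le> 1/16" using power_mono[of r "1/4" 2] r by (simp add: power2_eq_square)
  have c2: "c\<^sup>2 = 1 - r\<^sup>2" using r2 unfolding c_def r_def[symmetric] by simp
  have c0: "0 \<le> c" using r2 unfolding c_def r_def[symmetric] by simp
  have c34: "3/4 \<le> c" unfolding c_def r_def[symmetric] using r2 by (intro real_le_rsqrt) (simp add: power2_eq_square)
  define T where "T = 2 * r * c * \<bar>B\<bar>"
  define C where "C = c\<^sup>2 - r\<^sup>2"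
  have C: "C = 1 - 2 * r\<^sup>2" "7/8 \<le> C" "C \<le> 1" using c2 r2 by (auto simp: C_def)
  have T0: "0 \<le> T" using r c0 by (simp add: T_def)
  have r3c: "r * 3 / 4 * \<bar>B\<bar> \<le> r * c * \<bar>B\<bar>"
    using mult_left_mono[OF c34, of "r * \<bar>B\<bar>"] r by (simp add: mult_ac)
  have lower: "(\<delta>\<^sup>2 * \<bar>A\<bar> + \<delta> * \<bar>B\<bar>) / 16 \<le> ((1 - C) * \<bar>A\<bar> + T) / 2"
  proof -
    have d: "\<delta> = 4 * r" by (simp add: r_def)
    have "\<delta>\<^sup>2 * \<bar>A\<bar> = 16 * (r\<^sup>2 * \<bar>A\<bar>)" by (simp add: d power_mult_distrib)
    moreover have "(1 - C) * \<bar>A\<bar> = 2 * (r\<^sup>2 * \<bar>A\<bar>)" by (simp add: C)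
    moreover have "\<delta> * \<bar>B\<bar> = 4 * (r * \<bar>B\<bar>)" by (simp add: d)
    moreover have "T = 2 * (r * c * \<bar>B\<bar>)" by (simp add: T_def)
    moreover have "0 \<le> r * \<bar>B\<bar>" using r by simp
    moreover have "r * \<bar>B\<bar> * 3 / 4 \<le> r * c * \<bar>B\<bar>" using r3c by (simp add: mult_ac)
    moreover have "(X + Z) / 16 \<le> (Y + t) / 2"
      if "X = 16 * P" "Y = 2 * P" "Z = 4 * Q" "t = 2 * W" "0 \<le> Q" "Q * 3 / 4 \<le> W" for X Y Z t P Q W :: real
      using that by simp
    ultimately show ?thesis by blast
  qed
  define e where "e = (if 0 \<le> A * B then r else - r)"
  have e2: "e\<^sup>2 = r\<^sup>2" by (simp add: e_def)
  have same: "\<bar>C * A + 2 * e * c * B\<bar> = C * \<bar>A\<bar> + T" and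
    opp: "\<bar>C * A - 2 * e * c * B\<bar> = \<bar>C * \<bar>A\<bar> - T\<bar>"
  proof -
    have "2 * e * c * B = T \<and> 0 \<le> A \<or> 2 * e * c * B = - T \<and> A \<le> 0"
      unfolding e_def T_def
      by (cases "0 \<le> A * B"; cases "0 \<le> B") (auto simp: zero_le_mult_iff mult_less_0_iff not_le abs_if)
    moreover have "C * \<bar>A\<bar> = \<bar>C * A\<bar>" using C by (simp add: abs_mult)
    moreover have "0 \<le> C * A \<longleftrightarrow> 0 \<le> A" "C * A \<le> 0 \<longleftrightarrow> A \<le> 0"
      using C by (auto simp: zero_le_mult_iff mult_le_0_iff)
    ultimately show "\<bar>C * A + 2 * e * c * B\<bar> = C * \<bar>A\<bar> + T" "\<bar>C * A - 2 * e * c * B\<bar> = \<bar>C * \<bar>A\<bar> - T\<bar>"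
      using T0 by auto
  qed
  show ?thesis
  proof (cases "T \<le> C * \<bar>A\<bar>")
    case True
    have "\<bar>\<bar>C * A - 2 * e * c * B\<bar> - \<bar>A\<bar>\<bar> = (1 - C) * \<bar>A\<bar> + T"
      unfolding opp using True T0 C(3) mult_right_mono[OF C(3), of "\<bar>A\<bar>"] by (simp add: algebra_simps)
    moreover have "0 \<le> (1 - C) * \<bar>A\<bar>" using C by simp
    ultimately have *: "(\<delta>\<^sup>2 * \<bar>A\<bar> + \<delta> * \<bar>B\<bar>) / 16 \<le> \<bar>\<bar>C * A - 2 * e * c * B\<bar> - \<bar>A\<bar>\<bar>"
    proof -
      have half_le: "x / 2 \<le> x" if "0 \<le> x" for x :: real using that by simp
      have "((1 - C) * \<bar>A\<bar> + T) / 2 \<le> (1 - C) * \<bar>A\<bar> + T"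
        using add_nonneg_nonneg[OF \<open>0 \<le> (1 - C) * \<bar>A\<bar>\<close> T0] by (rule half_le)
      from order_trans[OF lower this] show ?thesis
        by (simp only: \<open>\<bar>\<bar>C * A - 2 * e * c * B\<bar> - \<bar>A\<bar>\<bar> = (1 - C) * \<bar>A\<bar> + T\<close>)
    qed
    have "- e \<in> {r, - r}" by (simp add: e_def)
    then show ?thesis using * e2 unfolding C_def r_def[symmetric] by (intro bexI[of _ "- e"]) auto
  next
    case False
    have "7/8 * \<bar>A\<bar> \<le> C * \<bar>A\<bar>" using C(2) by (intro mult_right_mono) auto
    moreover have "(1 - C) * \<bar>A\<bar> \<le> 1/8 * \<bar>A\<bar>" using C(2) by (intro mult_right_mono) auto
    moreover have "(X + t) / 2 \<le> t - X" if "7/8 * q \<le> Y" "X \<le> 1/8 * q" "\<not> t \<le> Y" "0 \<le> q" for X Y q t :: real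
      using that by simp
    ultimately have "((1 - C) * \<bar>A\<bar> + T) / 2 \<le> T - (1 - C) * \<bar>A\<bar>" using False abs_ge_zero by blast
    also have "\<dots> = (C * \<bar>A\<bar> + T) - \<bar>A\<bar>" by (simp add: algebra_simps)
    also have "\<dots> \<le> \<bar>\<bar>C * A + 2 * e * c * B\<bar> - \<bar>A\<bar>\<bar>" unfolding same by simp
    finally have *: "(\<delta>\<^sup>2 * \<bar>A\<bar> + \<delta> * \<bar>B\<bar>) / 16 \<le> \<bar>\<bar>C * A + 2 * e * c * B\<bar> - \<bar>A\<bar>\<bar>"
      using lower by (rule order_trans[rotated])
    have "e \<in> {r, - r}" by (simp add: e_def)
    then show ?thesis using * e2 unfolding C_def r_def[symmetric] by (intro bexI[of _ e]) auto
  qed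
qed

text \<open>
  The half angle of sine \<open>\<delta> / 4\<close> is small enough for \<open>n y\<^sup>2 \<le> 1/4\<close>. Membership is required for both signs
  of the angle, because the better side depends on \<open>a\<close>.
\<close>

lemma minimax_rotation:
  assumes w: "orthonormal_vecs p p w" and lk: "l \<in> {1..p}" "k \<in> {1..p}" "l \<noteq> k"
    and \<mu>: "\<And>i. i \<in> {1..p} \<Longrightarrow> 0 \<le> \<mu> i" "0 < \<mu> l + \<sigma>\<^sup>2" "0 < \<mu> k + \<sigma>\<^sup>2"
    and mono: "\<And>i j. i \<in> {1..p} \<Longrightarrow> j \<in> {1..p} \<Longrightarrow> i \<le> j \<Longrightarrow> \<mu> j \<le> \<mu> i"
    and simple: "\<And>i. i \<in> {1..p} \<Longrightarrow> i \<noteq> l \<Longrightarrow> \<mu> i \<noteq> \<mu> l"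
    and \<delta>: "0 \<le> \<delta>" "\<delta> \<le> 1" "\<delta>\<^sup>2 * ((\<mu> l - \<mu> k)\<^sup>2 * real n) = (\<mu> l + \<sigma>\<^sup>2) * (\<mu> k + \<sigma>\<^sup>2)"
    and M0: "spiked_mat p p \<mu> w \<in> M"
    and M1: "\<And>c s. c\<^sup>2 + s\<^sup>2 = 1 \<Longrightarrow> \<bar>s\<bar> = \<delta> / 4 \<Longrightarrow> 0 \<le> c \<Longrightarrow>
      spiked_mat p p \<mu> (rotate_pair l k (c\<^sup>2 - s\<^sup>2) (2 * s * c) w) \<in> M"
    and a: "a \<in> carrier_vec p"
  shows "ennreal (15/1024 * (\<delta>\<^sup>2 * \<bar>scalar_prod a (w l)\<bar> + \<delta> * \<bar>scalar_prod a (w k)\<bar>)) \<le> minimax_risk p n l \<sigma> a M"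
proof -
  define c where "c = sqrt (1 - (\<delta> / 4)\<^sup>2)"
  have d2: "(\<delta> / 4)\<^sup>2 \<le> 1" using \<delta>(1,2) by (intro power_le_one) auto
  obtain s where s: "s \<in> {\<delta> / 4, - (\<delta> / 4)}"
    and gap: "(\<delta>\<^sup>2 * \<bar>scalar_prod a (w l)\<bar> + \<delta> * \<bar>scalar_prod a (w k)\<bar>) / 16
      \<le> \<bar>\<bar>(c\<^sup>2 - s\<^sup>2) * scalar_prod a (w l) + 2 * s * c * scalar_prod a (w k)\<bar> - \<bar>scalar_prod a (w l)\<bar>\<bar>"
    using rotation_gap[OF \<delta>(1,2), of "scalar_prod a (w l)" "scalar_prod a (w k)"] unfolding c_def by blast
  have s2: "s\<^sup>2 = (\<delta> / 4)\<^sup>2" using s by auto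
  have c2: "c\<^sup>2 = 1 - s\<^sup>2" unfolding s2 c_def using d2 by simp
  then have cs: "c\<^sup>2 + s\<^sup>2 = 1" by simp
  have c0: "0 \<le> c" unfolding c_def using d2 by simp
  let ?d = "\<mu> l - \<mu> k" and ?ab = "(\<mu> l + \<sigma>\<^sup>2) * (\<mu> k + \<sigma>\<^sup>2)"
  let ?y = "shear_slope (\<mu> l + \<sigma>\<^sup>2) (\<mu> k + \<sigma>\<^sup>2) c s"
  have ab: "0 < ?ab" using \<mu>(2,3) by simp
  have \<delta>2: "0 < \<delta>\<^sup>2" using \<delta>(3) ab by (cases "\<delta> = 0") auto
  have y: "real n * ?y\<^sup>2 \<le> 1/4"
  proof -
    have "?y\<^sup>2 = ?d\<^sup>2 * (4 * s\<^sup>2 * c\<^sup>2) / ?ab"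
      using ab by (simp add: shear_slope_def power_divide power_mult_distrib)
    then have "\<delta>\<^sup>2 * (real n * ?y\<^sup>2) = (\<delta>\<^sup>2 * (?d\<^sup>2 * real n)) * (4 * s\<^sup>2 * c\<^sup>2) / ?ab" by simp
    also have "\<dots> = 4 * s\<^sup>2 * c\<^sup>2"
      unfolding \<delta>(3) using ab by (metis nonzero_mult_div_cancel_left less_irrefl)
    also have "\<dots> \<le> 4 * s\<^sup>2 * 1" using c2 by (intro mult_left_mono) auto
    also have "\<dots> = \<delta>\<^sup>2 * (1/4)" unfolding s2 by (simp add: power_divide)
    finally show ?thesis using \<delta>2 by (rule mult_left_le_imp_le)
  qed
  let ?v = "rotate_pair l k (c\<^sup>2 - s\<^sup>2) (2 * s * c) w"
  have "(c\<^sup>2 - s\<^sup>2)\<^sup>2 + (2 * s * c)\<^sup>2 = 1" using cs by (rule double_angle_unit)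
  then have v: "orthonormal_vecs p p ?v" by (rule orthonormal_rotate_pair[OF w lk])
  have ev: "\<bar>scalar_prod a (unit_eigvec p (spiked_mat p p \<mu> v) l)\<bar> = \<bar>scalar_prod a (v l)\<bar>"
    if "orthonormal_vecs p p v" for v
    using that mono simple by (intro abs_scalar_prod_unit_eigvec a lk eigval_spiked_mat) auto
  have wc: "w l \<in> carrier_vec p" "w k \<in> carrier_vec p" using w lk by (auto intro: orthonormal_vecs_carrier)
  have avl: "scalar_prod a (?v l) = (c\<^sup>2 - s\<^sup>2) * scalar_prod a (w l) + 2 * s * c * scalar_prod a (w k)"
    using lk(3) wc a by (simp add: rotate_pair_def scalar_prod_add_distrib[of _ p])
  have "15/1024 * (\<delta>\<^sup>2 * \<bar>scalar_prod a (w l)\<bar> + \<delta> * \<bar>scalar_prod a (w k)\<bar>)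
      \<le> 15/64 * \<bar>\<bar>scalar_prod a (?v l)\<bar> - \<bar>scalar_prod a (w l)\<bar>\<bar>"
  proof -
    have "15/1024 * X \<le> 15/64 * Y" if "X / 16 \<le> Y" for X Y :: real using that by simp
    from this[OF gap[folded avl]] show ?thesis .
  qed
  then have "ennreal (15/1024 * (\<delta>\<^sup>2 * \<bar>scalar_prod a (w l)\<bar> + \<delta> * \<bar>scalar_prod a (w k)\<bar>))
      \<le> ennreal (15/64 * \<bar>\<bar>scalar_prod a (?v l)\<bar> - \<bar>scalar_prod a (w l)\<bar>\<bar>)" by (rule ennreal_leI)
  also have "\<dots> \<le> minimax_risk p n l \<sigma> a M"
    using minimax_two_point[OF w lk \<mu> cs y M0 M1[OF cs _ c0], of a] s \<delta>(1) unfolding ev[OF w] ev[OF v]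
    by (metis abs_minus_cancel abs_of_nonneg divide_nonneg_pos insertE singletonD zero_less_numeral)
  finally show ?thesis .
qed

lemma spiked_mat_extend:
  assumes "r \<le> p" "\<And>i. i \<in> {1..r} \<Longrightarrow> w i = u i"
  shows "spiked_mat p p (\<lambda>i. if i \<le> r then lam i else 0) w = spiked_mat p r lam u"
proof (rule eq_matI)
  fix a b assume "a < dim_row (spiked_mat p r lam u)" "b < dim_col (spiked_mat p r lam u)"
  then have ab: "a < p" "b < p" by (auto simp: spiked_mat_def)
  have "(\<Sum>i=1..p. (if i \<le> r then lam i else 0) * w i $ a * w i $ b) = (\<Sum>i=1..r. lam i * u i $ a * u i $ b)"
    using assms by (intro sum.mono_neutral_cong_right) auto
  then show "spiked_mat p p (\<lambda>i. if i \<le> r then lam i else 0) w $$ (a, b) = spiked_mat p r lam u $$ (a, b)"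
    using ab by (simp add: spiked_mat_def)
qed (auto simp: spiked_mat_def)

locale spiked_spectrum =
  fixes p r l :: nat and lam :: "nat \<Rightarrow> real" and u :: "nat \<Rightarrow> real Matrix.vec"
  assumes u: "orthonormal_vecs p r u"
    and pos: "\<And>i. i \<in> {1..r} \<Longrightarrow> 0 < lam i"
    and mono: "\<And>i j. i \<in> {1..r} \<Longrightarrow> j \<in> {1..r} \<Longrightarrow> i \<le> j \<Longrightarrow> lam j \<le> lam i"
    and l: "l \<in> {1..r}"
    and simple: "\<And>k. k \<in> {1..r} \<Longrightarrow> k \<noteq> l \<Longrightarrow> lam k \<noteq> lam l"
begin

text \<open>
  The spectrum of the spiked matrix, with the zero eigenvalues of the orthogonal complement included.
\<close>

definition \<mu> :: "nat \<Rightarrow> real" where "\<mu> i = (if i \<le> r then lam i else 0)"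

lemma r_le_p: "r \<le> p" using u by (rule orthonormal_vecs_card_le)

lemma \<mu>_nonneg: "i \<in> {1..p} \<Longrightarrow> 0 \<le> \<mu> i"
  using pos[of i] by (auto simp: \<mu>_def)

lemma \<mu>_antimono: "i \<in> {1..p} \<Longrightarrow> j \<in> {1..p} \<Longrightarrow> i \<le> j \<Longrightarrow> \<mu> j \<le> \<mu> i"
  using mono[of i j] pos[of i] by (auto simp: \<mu>_def)

lemma \<mu>_simple: "i \<in> {1..p} \<Longrightarrow> i \<noteq> l \<Longrightarrow> \<mu> i \<noteq> \<mu> l"
  using simple[of i] pos[of l] l by (auto simp: \<mu>_def)

lemma spectrum_spiked:
  assumes v: "orthonormal_vecs p p v"
  shows "psd_mat p (spiked_mat p p \<mu> v)" "vec_space.rank p (spiked_mat p p \<mu> v) = r"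
    "\<And>i. i \<in> {1..r} \<Longrightarrow> eigval (spiked_mat p p \<mu> v) i = lam i"
proof -
  show "psd_mat p (spiked_mat p p \<mu> v)" using v \<mu>_nonneg by (rule psd_spiked_mat)
  show "vec_space.rank p (spiked_mat p p \<mu> v) = r"
    using v r_le_p by (rule rank_spiked_mat) (use pos in \<open>auto simp: \<mu>_def\<close>)
  fix i assume i: "i \<in> {1..r}"
  then have "eigval (spiked_mat p p \<mu> v) i = \<mu> i"
    using r_le_p by (intro eigval_spiked_mat[OF v] \<mu>_antimono) auto
  then show "eigval (spiked_mat p p \<mu> v) i = lam i" using i by (simp add: \<mu>_def)
qed

text \<open>
  The rotation by twice the half angle moves the matrix by at most \<open>\<bar>\<lambda>\<^sub>l - \<lambda>\<^sub>k\<bar> \<delta>\<close> in Frobenius norm,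
  which is the \<open>k\<close>-th term of the maximum that defines the radius of the class.
\<close>

lemma minimax_M1_direction:
  assumes k: "k \<in> {1..r}" "k \<noteq> l" and a: "a \<in> carrier_vec p"
    and n: "(lam k + \<sigma>\<^sup>2) * (lam l + \<sigma>\<^sup>2) / \<bar>lam l - lam k\<bar>\<^sup>2 \<le> real n"
  defines "\<delta> \<equiv> sqrt ((lam k + \<sigma>\<^sup>2) * (lam l + \<sigma>\<^sup>2)) / (\<bar>lam l - lam k\<bar> * sqrt (real n))"
  shows "ennreal (15/1024 * (\<delta>\<^sup>2 * \<bar>scalar_prod a (u l)\<bar> + \<delta> * \<bar>scalar_prod a (u k)\<bar>))
    \<le> minimax_risk p n l \<sigma> a (M1 p r n l \<sigma> lam u)"
proof -
  obtain w where w: "orthonormal_vecs p p w" and wu: "\<And>i. i \<in> {1..r} \<Longrightarrow> w i = u i"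
    using orthonormal_vecs_extend[OF u] by blast
  have S0: "spiked_mat p r lam u = spiked_mat p p \<mu> w"
    using spiked_mat_extend[OF r_le_p wu] unfolding \<mu>_def by simp
  have \<mu>l: "\<mu> l = lam l" and \<mu>k: "\<mu> k = lam k" using l k by (auto simp: \<mu>_def)
  have \<alpha>: "0 < lam l + \<sigma>\<^sup>2" and \<beta>: "0 < lam k + \<sigma>\<^sup>2"
    using pos[OF l] pos[OF k(1)] by (auto intro: add_pos_nonneg)
  have d: "lam l - lam k \<noteq> 0" using simple[OF k] by simp
  have n0: "0 < real n" using \<alpha> \<beta> d by (intro less_le_trans[OF _ n]) auto
  have \<delta>2: "\<delta>\<^sup>2 * ((lam l - lam k)\<^sup>2 * real n) = (lam l + \<sigma>\<^sup>2) * (lam k + \<sigma>\<^sup>2)"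
    using \<alpha> \<beta> d n0 by (simp add: \<delta>_def power_divide power_mult_distrib)
  have \<delta>0: "0 \<le> \<delta>" using \<alpha> \<beta> by (simp add: \<delta>_def)
  have "\<delta>\<^sup>2 = (lam k + \<sigma>\<^sup>2) * (lam l + \<sigma>\<^sup>2) / \<bar>lam l - lam k\<bar>\<^sup>2 / real n"
    using \<alpha> \<beta> d n0 by (simp add: \<delta>_def power_divide power_mult_distrib)
  also have "\<dots> \<le> real n / real n" using n n0 by (intro divide_right_mono) auto
  also have "\<dots> = 1" using n0 by simp
  finally have \<delta>1: "\<delta> \<le> 1" using \<delta>0 by (simp add: power_le_one_iff abs_square_le_1)
  have radius: "0 \<le> max_over ({1..r} - {l}) (\<lambda>k. sqrt ((lam l + \<sigma>\<^sup>2) * (lam k + \<sigma>\<^sup>2) / real n))"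
    and radius_k: "\<bar>lam l - lam k\<bar> * \<delta> \<le> max_over ({1..r} - {l}) (\<lambda>k. sqrt ((lam l + \<sigma>\<^sup>2) * (lam k + \<sigma>\<^sup>2) / real n))"
  proof -
    let ?f = "\<lambda>k. sqrt ((lam l + \<sigma>\<^sup>2) * (lam k + \<sigma>\<^sup>2) / real n)"
    have "\<bar>lam l - lam k\<bar> * \<delta> = ?f k"
      using d n0 by (simp add: \<delta>_def real_sqrt_divide mult.commute)
    also have "\<dots> \<le> max_over ({1..r} - {l}) ?f"
      using k by (auto simp: max_over_def intro!: Max_ge)
    finally show "\<bar>lam l - lam k\<bar> * \<delta> \<le> max_over ({1..r} - {l}) ?f" .
    then show "0 \<le> max_over ({1..r} - {l}) ?f" using \<delta>0 by (meson abs_ge_zero mult_nonneg_nonneg order_trans)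
  qed
  have "ennreal (15/1024 * (\<delta>\<^sup>2 * \<bar>scalar_prod a (w l)\<bar> + \<delta> * \<bar>scalar_prod a (w k)\<bar>))
    \<le> minimax_risk p n l \<sigma> a (M1 p r n l \<sigma> lam u)"
  proof (rule minimax_rotation[OF w])
    show "l \<in> {1..p}" "k \<in> {1..p}" "l \<noteq> k" using l k r_le_p by auto
    then have lk: "l \<in> {1..p}" "k \<in> {1..p}" "l \<noteq> k" .
    show "0 \<le> \<mu> i" if "i \<in> {1..p}" for i using that by (rule \<mu>_nonneg)
    show "0 < \<mu> l + \<sigma>\<^sup>2" "0 < \<mu> k + \<sigma>\<^sup>2" using \<alpha> \<beta> \<mu>l \<mu>k by auto
    show "\<mu> j \<le> \<mu> i" if "i \<in> {1..p}" "j \<in> {1..p}" "i \<le> j" for i j using that by (rule \<mu>_antimono)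
    show "\<mu> i \<noteq> \<mu> l" if "i \<in> {1..p}" "i \<noteq> l" for i using that by (rule \<mu>_simple)
    show "\<delta>\<^sup>2 * ((\<mu> l - \<mu> k)\<^sup>2 * real n) = (\<mu> l + \<sigma>\<^sup>2) * (\<mu> k + \<sigma>\<^sup>2)" unfolding \<mu>l \<mu>k by (rule \<delta>2)
    have "frobenius_norm (spiked_mat p p \<mu> w - spiked_mat p p \<mu> w) = 0"
      by (simp add: frobenius_norm_def spiked_mat_def)
    then show "spiked_mat p p \<mu> w \<in> M1 p r n l \<sigma> lam u"
      unfolding M1_def S0 using spectrum_spiked[OF w] radius by simp
    fix c s :: real assume cs: "c\<^sup>2 + s\<^sup>2 = 1" and s: "\<bar>s\<bar> = \<delta> / 4" and c: "0 \<le> c"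
    have CS: "(c\<^sup>2 - s\<^sup>2)\<^sup>2 + (2 * s * c)\<^sup>2 = 1" using cs by (rule double_angle_unit)
    have "c\<^sup>2 \<le> 1" using cs zero_le_power2[of s] by linarith
    then have "\<bar>c\<bar> \<le> 1" by (simp add: abs_square_le_1)
    then have "\<delta> / 2 * \<bar>c\<bar> \<le> \<delta> / 2 * 1" using \<delta>0 by (intro mult_left_mono) auto
    moreover have "\<bar>2 * s * c\<bar> = \<delta> / 2 * \<bar>c\<bar>" using s by (simp add: abs_mult)
    ultimately have "\<bar>2 * s * c\<bar> \<le> \<delta> / 2" by simp
    moreover have "sqrt 2 \<le> 2" by (rule real_le_lsqrt) auto
    ultimately have "sqrt 2 * \<bar>2 * s * c\<bar> \<le> 2 * (\<delta> / 2)" by (intro mult_mono) auto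
    then have "\<bar>lam l - lam k\<bar> * (sqrt 2 * \<bar>2 * s * c\<bar>) \<le> \<bar>lam l - lam k\<bar> * \<delta>"
      by (intro mult_left_mono) auto
    then have "frobenius_norm (spiked_mat p p \<mu> (rotate_pair l k (c\<^sup>2 - s\<^sup>2) (2 * s * c) w) - spiked_mat p p \<mu> w)
        \<le> max_over ({1..r} - {l}) (\<lambda>k. sqrt ((lam l + \<sigma>\<^sup>2) * (lam k + \<sigma>\<^sup>2) / real n))"
      unfolding frobenius_norm_rotate_pair[OF w lk CS] \<mu>l \<mu>k using radius_k by (simp add: mult_ac)
    then show "spiked_mat p p \<mu> (rotate_pair l k (c\<^sup>2 - s\<^sup>2) (2 * s * c) w) \<in> M1 p r n l \<sigma> lam u"
      unfolding M1_def S0 using spectrum_spiked[OF orthonormal_rotate_pair[OF w lk CS]] by simp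
  qed (use \<delta>0 \<delta>1 a in auto)
  then show ?thesis using wu l k by simp
qed
end

lemma proj_perp_carrier: "proj_perp p r u \<in> carrier_mat p p"
  unfolding proj_perp_def Let_def
  by (intro minus_carrier_mat mult_carrier_mat[of _ p r]) (auto simp: mat_of_cols_def simp del: upt_Suc)

lemma proj_perp_mult_vec:
  assumes u: "\<And>i. i \<in> {1..r} \<Longrightarrow> u i \<in> carrier_vec p" and a: "a \<in> carrier_vec p" and x: "x < p"
  shows "(proj_perp p r u *\<^sub>v a) $ x = a $ x - (\<Sum>i=1..r. scalar_prod (u i) a * u i $ x)"
proof -
  let ?us = "map u [1..<Suc r]"
  let ?U = "mat_of_cols p ?us"
  have U: "?U \<in> carrier_mat p r" by (simp add: mat_of_cols_def del: upt_Suc)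
  have Uent: "?U $$ (y, i) = u (Suc i) $ y" if "y < p" "i < r" for y i
    using that by (simp add: mat_of_cols_index flip: plus_1_eq_Suc del: upt_Suc)
  have P: "proj_perp p r u = 1\<^sub>m p - ?U * transpose_mat ?U" by (simp add: proj_perp_def Let_def)
  have Pent: "proj_perp p r u $$ (x, y) = (if x = y then 1 else 0) - (\<Sum>i=1..r. u i $ x * u i $ y)"
    if y: "y < p" for y
  proof -
    have "(?U * transpose_mat ?U) $$ (x, y) = (\<Sum>i<r. ?U $$ (x, i) * ?U $$ (y, i))"
      using U x y by (auto simp: scalar_prod_def atLeast0LessThan simp del: upt_Suc)
    also have "\<dots> = (\<Sum>i=1..r. u i $ x * u i $ y)"
      using x y by (simp add: Uent sum.atLeast1_atMost_eq[folded One_nat_def] cong: sum.cong_simp del: upt_Suc)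
    finally show ?thesis using U x y by (simp add: P)
  qed
  have Pc: "proj_perp p r u \<in> carrier_mat p p" by (rule proj_perp_carrier)
  have "(proj_perp p r u *\<^sub>v a) $ x = (\<Sum>y<p. proj_perp p r u $$ (x, y) * a $ y)"
    using Pc x a by (simp add: scalar_prod_sum[OF a])
  also have "\<dots> = (\<Sum>y<p. (if x = y then a $ y else 0) - (\<Sum>i=1..r. u i $ x * u i $ y) * a $ y)"
    by (intro sum.cong refl) (simp add: Pent left_diff_distrib)
  also have "\<dots> = a $ x - (\<Sum>y<p. \<Sum>i=1..r. u i $ x * (u i $ y * a $ y))"
    using x by (simp add: sum_subtractf sum_distrib_right mult.assoc)
  also have "(\<Sum>y<p. \<Sum>i=1..r. u i $ x * (u i $ y * a $ y)) = (\<Sum>i=1..r. scalar_prod (u i) a * u i $ x)"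
    by (subst sum.swap) (simp add: scalar_prod_sum[OF a] sum_distrib_left[symmetric] mult.commute)
  finally show ?thesis .
qed

lemma proj_perp_residual:
  assumes u: "orthonormal_vecs p r u" and a: "a \<in> carrier_vec p"
  defines "v \<equiv> proj_perp p r u *\<^sub>v a"
  shows "v \<in> carrier_vec p" and "\<And>j. j \<in> {1..r} \<Longrightarrow> scalar_prod (u j) v = 0"
    and "scalar_prod a v = scalar_prod v v"
proof -
  have uc: "u i \<in> carrier_vec p" if "i \<in> {1..r}" for i using u that by (rule orthonormal_vecs_carrier)
  have Pc: "proj_perp p r u \<in> carrier_mat p p" by (rule proj_perp_carrier)
  show v: "v \<in> carrier_vec p" unfolding v_def using Pc a by simp
  have vx: "v $ x = a $ x - (\<Sum>i=1..r. scalar_prod (u i) a * u i $ x)" if "x < p" for x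
    unfolding v_def using uc a that by (rule proj_perp_mult_vec)
  have yv: "scalar_prod y v = scalar_prod y a - (\<Sum>i=1..r. scalar_prod (u i) a * scalar_prod y (u i))"
    if y: "y \<in> carrier_vec p" for y
  proof -
    have "scalar_prod y v = (\<Sum>x<p. y $ x * a $ x - (\<Sum>i=1..r. scalar_prod (u i) a * (y $ x * u i $ x)))"
      unfolding scalar_prod_sum[OF v]
      by (intro sum.cong refl) (simp add: vx right_diff_distrib sum_distrib_left mult_ac)
    also have "\<dots> = scalar_prod y a - (\<Sum>x<p. \<Sum>i=1..r. scalar_prod (u i) a * (y $ x * u i $ x))"
      by (simp add: sum_subtractf scalar_prod_sum[OF a])
    also have "(\<Sum>x<p. \<Sum>i=1..r. scalar_prod (u i) a * (y $ x * u i $ x))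
        = (\<Sum>i=1..r. scalar_prod (u i) a * scalar_prod y (u i))"
      by (subst sum.swap, intro sum.cong refl) (simp add: scalar_prod_sum[OF uc] sum_distrib_left)
    finally show ?thesis .
  qed
  show orth: "scalar_prod (u j) v = 0" if j: "j \<in> {1..r}" for j
  proof -
    have "(\<Sum>i=1..r. scalar_prod (u i) a * scalar_prod (u j) (u i))
        = (\<Sum>i=1..r. if i = j then scalar_prod (u j) a else 0)"
      using orthonormal_vecs_scalar_prod[OF u j] by (intro sum.cong) auto
    then show ?thesis unfolding yv[OF uc[OF j]] using j by simp
  qed
  have "scalar_prod v v = scalar_prod v a - (\<Sum>i=1..r. scalar_prod (u i) a * scalar_prod v (u i))"
    by (rule yv[OF v])
  also have "(\<Sum>i=1..r. scalar_prod (u i) a * scalar_prod v (u i)) = 0"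
    using orth scalar_prod_commute[OF v uc] by (intro sum.neutral) auto
  finally show "scalar_prod a v = scalar_prod v v" using scalar_prod_commute[OF v a] by simp
qed

context spiked_spectrum
begin

text \<open>
  The second direction is the normalised residual of \<open>a\<close>, with eigenvalue zero; its scalar product with
  \<open>a\<close> is the norm of the residual. The rotated eigenvector is at distance \<open>2 \<bar>s\<bar> = \<delta> / 2\<close> from \<open>u\<^sub>l\<close>.
\<close>

lemma minimax_M2_direction:
  assumes a: "a \<in> carrier_vec p" and \<sigma>: "\<sigma> \<noteq> 0"
    and n: "(lam l + \<sigma>\<^sup>2) * \<sigma>\<^sup>2 / (lam l)\<^sup>2 \<le> real n"
    and nz: "scalar_prod (proj_perp p r u *\<^sub>v a) (proj_perp p r u *\<^sub>v a) \<noteq> 0"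
  defines "\<delta> \<equiv> sqrt ((lam l + \<sigma>\<^sup>2) * \<sigma>\<^sup>2 / ((lam l)\<^sup>2 * real n))"
  shows "ennreal (15/1024 * (\<delta> * vec_norm2 (proj_perp p r u *\<^sub>v a)))
    \<le> minimax_risk p n l \<sigma> a (M2 p r n l \<sigma> lam u)"
proof -
  define v where "v = proj_perp p r u *\<^sub>v a"
  note v = proj_perp_residual[OF u a, folded v_def]
  have vv: "0 < scalar_prod v v"
    using nz scalar_prod_sum[OF v(1), of v] by (auto simp: v_def[symmetric] less_le intro: sum_nonneg)
  define e where "e = (1 / vec_norm2 v) \<cdot>\<^sub>v v"
  have nv: "vec_norm2 v * vec_norm2 v = scalar_prod v v" "0 < vec_norm2 v" using vv by (auto simp: vec_norm2_def)
  have e: "e \<in> carrier_vec p" using v(1) by (simp add: e_def)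
  have ee: "scalar_prod e e = 1"
    using v(1) nv by (simp add: e_def nv(1)[symmetric])
  have ue: "scalar_prod (u i) e = 0" if "i \<in> {1..r}" for i
    using v(2)[OF that] v(1) orthonormal_vecs_carrier[OF u that] by (simp add: e_def)
  have ae: "scalar_prod a e = vec_norm2 v"
    using v(1) a nv v(3) by (simp add: e_def nv(1)[symmetric])
  have u': "orthonormal_vecs p (Suc r) (u(Suc r := e))" using u e ee ue by (rule orthonormal_vecs_Suc)
  have rp: "Suc r \<le> p" using u' by (rule orthonormal_vecs_card_le)
  obtain w where w: "orthonormal_vecs p p w" and wu': "\<And>i. i \<in> {1..Suc r} \<Longrightarrow> w i = (u(Suc r := e)) i"
    using orthonormal_vecs_extend[OF u'] by blast
  have wu: "w i = u i" if "i \<in> {1..r}" for i using wu'[of i] that by auto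
  have we: "w (Suc r) = e" using wu'[of "Suc r"] by auto
  have \<mu>l: "\<mu> l = lam l" and \<mu>k: "\<mu> (Suc r) = 0" using l by (auto simp: \<mu>_def)
  have laml: "0 < lam l" by (rule pos[OF l])
  have \<sigma>2: "0 < \<sigma>\<^sup>2" using \<sigma> by simp
  have \<alpha>: "0 < (lam l + \<sigma>\<^sup>2) * \<sigma>\<^sup>2" using laml \<sigma>2 by (intro mult_pos_pos add_pos_pos)
  have n0: "0 < real n" using \<alpha> laml by (intro less_le_trans[OF _ n]) auto
  have \<delta>2': "\<delta>\<^sup>2 = (lam l + \<sigma>\<^sup>2) * \<sigma>\<^sup>2 / (lam l)\<^sup>2 / real n"
    using \<alpha> by (simp add: \<delta>_def real_sqrt_pow2)
  have \<delta>2: "\<delta>\<^sup>2 * ((lam l)\<^sup>2 * real n) = (lam l + \<sigma>\<^sup>2) * \<sigma>\<^sup>2"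
    unfolding \<delta>2' using laml n0 by simp
  have \<delta>0: "0 \<le> \<delta>" using \<alpha> by (simp add: \<delta>_def)
  have "\<delta>\<^sup>2 \<le> real n / real n" unfolding \<delta>2' using n n0 by (intro divide_right_mono) auto
  also have "\<dots> = 1" using n0 by simp
  finally have \<delta>1: "\<delta> \<le> 1" using \<delta>0 by (simp add: power_le_one_iff abs_square_le_1)
  have member: "spiked_mat p p \<mu> v \<in> M2 p r n l \<sigma> lam u"
    if v: "orthonormal_vecs p p v" and dist: "vec_norm2 (v l - u l) \<le> \<delta>" for v
  proof -
    have lp: "l \<in> {1..p}" using l rp by auto
    have "is_unit_eigvec p (spiked_mat p p \<mu> v) l (v l)"
      using orthonormal_vecs_carrier[OF v lp] orthonormal_vecs_scalar_prod[OF v lp lp]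
        spiked_mat_mult_basis[OF v lp, of \<mu>] spectrum_spiked(3)[OF v l]
      by (simp add: is_unit_eigvec_def vec_norm2_def \<mu>l)
    then show ?thesis unfolding M2_def using spectrum_spiked[OF v] dist unfolding \<delta>_def by blast
  qed
  have "ennreal (15/1024 * (\<delta>\<^sup>2 * \<bar>scalar_prod a (w l)\<bar> + \<delta> * \<bar>scalar_prod a (w (Suc r))\<bar>))
    \<le> minimax_risk p n l \<sigma> a (M2 p r n l \<sigma> lam u)"
  proof (rule minimax_rotation[OF w])
    show lk: "l \<in> {1..p}" "Suc r \<in> {1..p}" "l \<noteq> Suc r" using l rp by auto
    show "0 \<le> \<mu> i" if "i \<in> {1..p}" for i using that by (rule \<mu>_nonneg)
    show "0 < \<mu> l + \<sigma>\<^sup>2" "0 < \<mu> (Suc r) + \<sigma>\<^sup>2"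
      unfolding \<mu>l \<mu>k using laml \<sigma>2 by (intro add_pos_pos, auto)
    show "\<mu> j \<le> \<mu> i" if "i \<in> {1..p}" "j \<in> {1..p}" "i \<le> j" for i j using that by (rule \<mu>_antimono)
    show "\<mu> i \<noteq> \<mu> l" if "i \<in> {1..p}" "i \<noteq> l" for i using that by (rule \<mu>_simple)
    show "\<delta>\<^sup>2 * ((\<mu> l - \<mu> (Suc r))\<^sup>2 * real n) = (\<mu> l + \<sigma>\<^sup>2) * (\<mu> (Suc r) + \<sigma>\<^sup>2)"
      unfolding \<mu>l \<mu>k using \<delta>2 by simp
    have "vec_norm2 (w l - u l) = 0"
      using wu[OF l] orthonormal_vecs_carrier[OF u l] by (simp add: vec_norm2_def)
    then show "spiked_mat p p \<mu> w \<in> M2 p r n l \<sigma> lam u" using member[OF w] \<delta>0 by simp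
    fix c s :: real assume cs: "c\<^sup>2 + s\<^sup>2 = 1" and s: "\<bar>s\<bar> = \<delta> / 4" and c: "0 \<le> c"
    have CS: "(c\<^sup>2 - s\<^sup>2)\<^sup>2 + (2 * s * c)\<^sup>2 = 1" using cs by (rule double_angle_unit)
    let ?v = "rotate_pair l (Suc r) (c\<^sup>2 - s\<^sup>2) (2 * s * c) w"
    have v: "orthonormal_vecs p p ?v" using w lk CS by (rule orthonormal_rotate_pair)
    have wl: "w l \<in> carrier_vec p" "w (Suc r) \<in> carrier_vec p" using w lk by (auto intro: orthonormal_vecs_carrier)
    let ?C = "c\<^sup>2 - s\<^sup>2" and ?S = "2 * s * c"
    have vl: "?v l - u l = (?C - 1) \<cdot>\<^sub>v w l + ?S \<cdot>\<^sub>v w (Suc r)"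
      using wl lk(3) wu[OF l] by (intro eq_vecI) (auto simp: rotate_pair_def algebra_simps)
    have "scalar_prod (?v l - u l) (?v l - u l) = (?C - 1)\<^sup>2 + ?S\<^sup>2"
      unfolding vl using wl orthonormal_vecs_scalar_prod[OF w] lk
      by (simp add: add_scalar_prod_distrib[of _ p] scalar_prod_add_distrib[of _ p] power2_eq_square)
    also have "\<dots> = ?C\<^sup>2 + ?S\<^sup>2 + 1 - 2 * ?C" by (simp add: power2_eq_square algebra_simps)
    also have "\<dots> = 2 - 2 * ?C" unfolding CS by simp
    also have "\<dots> = 4 * s\<^sup>2" using cs by simp
    finally have "vec_norm2 (?v l - u l) = 2 * \<bar>s\<bar>"
      unfolding vec_norm2_def by (simp add: real_sqrt_mult)
    also have "\<dots> \<le> \<delta>" using s \<delta>0 by simp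
    finally show "spiked_mat p p \<mu> ?v \<in> M2 p r n l \<sigma> lam u" by (rule member[OF v])
  qed (use \<delta>0 \<delta>1 a in auto)
  moreover have "15/1024 * (\<delta> * vec_norm2 v)
      \<le> 15/1024 * (\<delta>\<^sup>2 * \<bar>scalar_prod a (w l)\<bar> + \<delta> * \<bar>scalar_prod a (w (Suc r))\<bar>)"
    using \<delta>0 nv(2) by (simp add: we ae)
  ultimately show ?thesis unfolding v_def[symmetric] by (meson ennreal_leI order_trans)
qed

end

section \<open>The minimax lower bounds\<close>

lemma max_over_attained:
  assumes "finite K" "K \<noteq> {}"
  obtains k where "k \<in> K" "max_over K f = f k"
proof -
  have "Max (f ` K) \<in> f ` K" using assms by (intro Max_in) auto
  then obtain k where "k \<in> K" "Max (f ` K) = f k" by blast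
  then show ?thesis using that[of k] assms by (simp add: max_over_def)
qed

lemma max_over_ge: "finite K \<Longrightarrow> k \<in> K \<Longrightarrow> f k \<le> max_over K f"
  by (auto simp: max_over_def intro: Max_ge)

text \<open>
  The two maxima may be attained at different indices, but their sum is at most twice the sum of the
  two terms at one of these indices. This costs a factor of 2 against the constant along one direction.
\<close>

theorem theorem4:
  shows "\<exists>C>0::real. \<forall>(p::nat) (r::nat) (n::nat) (l::nat) (\<sigma>::real)
      (lam :: nat \<Rightarrow> real) (u :: nat \<Rightarrow> real Matrix.vec) (a :: real Matrix.vec).
    (\<forall>i\<in>{1..r}. u i \<in> carrier_vec p) \<longrightarrow>
    (\<forall>i\<in>{1..r}. \<forall>j\<in>{1..r}. scalar_prod (u i) (u j) = (if i = j then 1 else 0)) \<longrightarrow>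
    (\<forall>i\<in>{1..r}. 0 < lam i) \<longrightarrow>
    (\<forall>i\<in>{1..r}. \<forall>j\<in>{1..r}. i \<le> j \<longrightarrow> lam j \<le> lam i) \<longrightarrow>
    l \<in> {1..r} \<longrightarrow>
    (\<forall>k\<in>{1..r} - {l}. lam k \<noteq> lam l) \<longrightarrow>
    a \<in> carrier_vec p \<longrightarrow>
    real n \<ge> max
      (max_over ({1..r} - {l}) (\<lambda>k. (lam k + \<sigma>\<^sup>2) * (lam l + \<sigma>\<^sup>2) / \<bar>lam l - lam k\<bar>\<^sup>2))
      ((lam l + \<sigma>\<^sup>2) * \<sigma>\<^sup>2 / (lam l)\<^sup>2) \<longrightarrow>
    minimax_risk p n l \<sigma> a (M1 p r n l \<sigma> lam u)
      \<ge> ennreal (C *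
          (max_over ({1..r} - {l}) (\<lambda>k. (lam k + \<sigma>\<^sup>2) * (lam l + \<sigma>\<^sup>2)
               / (\<bar>lam l - lam k\<bar>\<^sup>2 * real n) * \<bar>scalar_prod a (u l)\<bar>)
           + max_over ({1..r} - {l}) (\<lambda>k. sqrt ((lam k + \<sigma>\<^sup>2) * (lam l + \<sigma>\<^sup>2))
               / (\<bar>lam l - lam k\<bar> * sqrt (real n)) * \<bar>scalar_prod a (u k)\<bar>))) \<and>
    minimax_risk p n l \<sigma> a (M2 p r n l \<sigma> lam u)
      \<ge> ennreal (C * (sqrt ((lam l + \<sigma>\<^sup>2) * \<sigma>\<^sup>2 / ((lam l)\<^sup>2 * real n))
                        * vec_norm2 (proj_perp p r u *\<^sub>v a)))"
proof (intro exI[of _ "15/2048"] conjI allI impI)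
  show "(0::real) < 15/2048" by simp
next
  fix p r n l :: nat and \<sigma> :: real and lam :: "nat \<Rightarrow> real"
    and u :: "nat \<Rightarrow> real Matrix.vec" and a :: "real Matrix.vec"
  assume 1: "\<forall>i\<in>{1..r}. u i \<in> carrier_vec p"
    "\<forall>i\<in>{1..r}. \<forall>j\<in>{1..r}. scalar_prod (u i) (u j) = (if i = j then 1 else 0)"
    "\<forall>i\<in>{1..r}. 0 < lam i" "\<forall>i\<in>{1..r}. \<forall>j\<in>{1..r}. i \<le> j \<longrightarrow> lam j \<le> lam i"
    "l \<in> {1..r}" "\<forall>k\<in>{1..r} - {l}. lam k \<noteq> lam l" and a: "a \<in> carrier_vec p"
    and n: "max (max_over ({1..r} - {l}) (\<lambda>k. (lam k + \<sigma>\<^sup>2) * (lam l + \<sigma>\<^sup>2) / \<bar>lam l - lam k\<bar>\<^sup>2))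
      ((lam l + \<sigma>\<^sup>2) * \<sigma>\<^sup>2 / (lam l)\<^sup>2) \<le> real n"
  interpret spiked_spectrum p r l lam u
    using 1 by unfold_locales (auto simp: orthonormal_vecs_def)
  let ?K = "{1..r} - {l}"
  let ?mm = "minimax_risk p n l \<sigma> a (M1 p r n l \<sigma> lam u)"
  let ?\<delta> = "\<lambda>k. sqrt ((lam k + \<sigma>\<^sup>2) * (lam l + \<sigma>\<^sup>2)) / (\<bar>lam l - lam k\<bar> * sqrt (real n))"
  let ?f = "\<lambda>k. (lam k + \<sigma>\<^sup>2) * (lam l + \<sigma>\<^sup>2) / (\<bar>lam l - lam k\<bar>\<^sup>2 * real n) * \<bar>scalar_prod a (u l)\<bar>"
  let ?g = "\<lambda>k. ?\<delta> k * \<bar>scalar_prod a (u k)\<bar>"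
  show "ennreal (15/2048 * (max_over ?K ?f + max_over ?K ?g)) \<le> ?mm"
  proof (cases "?K = {}")
    case True
    then show ?thesis by (simp add: max_over_def)
  next
    case False
    have dir: "ennreal (15/1024 * (?f k + ?g k)) \<le> ?mm" and nonneg: "0 \<le> ?f k" "0 \<le> ?g k"
      if k: "k \<in> ?K" for k
    proof -
      have kr: "k \<in> {1..r}" "k \<noteq> l" using k by auto
      have "(lam k + \<sigma>\<^sup>2) * (lam l + \<sigma>\<^sup>2) / \<bar>lam l - lam k\<bar>\<^sup>2 \<le> real n"
        using n max_over_ge[OF _ k, of "\<lambda>k. (lam k + \<sigma>\<^sup>2) * (lam l + \<sigma>\<^sup>2) / \<bar>lam l - lam k\<bar>\<^sup>2"] by simp
      note * = minimax_M1_direction[OF kr a this]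
      have ab: "0 \<le> (lam k + \<sigma>\<^sup>2) * (lam l + \<sigma>\<^sup>2)"
        using pos[OF kr(1)] pos[OF l] by (intro mult_nonneg_nonneg add_nonneg_nonneg) auto
      then have "(?\<delta> k)\<^sup>2 = (lam k + \<sigma>\<^sup>2) * (lam l + \<sigma>\<^sup>2) / (\<bar>lam l - lam k\<bar>\<^sup>2 * real n)"
        by (simp add: power_divide power_mult_distrib)
      with * show "ennreal (15/1024 * (?f k + ?g k)) \<le> ?mm" by (simp only:)
      show "0 \<le> ?f k" "0 \<le> ?g k" using ab by auto
    qed
    obtain k1 where k1: "k1 \<in> ?K" "max_over ?K ?f = ?f k1"
      using False by (rule max_over_attained[rotated, of _ ?f]) auto
    obtain k2 where k2: "k2 \<in> ?K" "max_over ?K ?g = ?g k2"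
      using False by (rule max_over_attained[rotated, of _ ?g]) auto
    \<comment> \<open>the sum of two numbers is at most twice the larger of them\<close>
    have half: "15/2048 * (x + y) \<le> 15/1024 * (x + y') \<or> 15/2048 * (x + y) \<le> 15/1024 * (x' + y)"
      if "0 \<le> x'" "0 \<le> y'" for x x' y y' :: real using that by argo
    have "15/2048 * (?f k1 + ?g k2) \<le> 15/1024 * (?f k1 + ?g k1)
        \<or> 15/2048 * (?f k1 + ?g k2) \<le> 15/1024 * (?f k2 + ?g k2)"
      by (rule half) (rule nonneg k1 k2)+
    then show ?thesis unfolding k1(2) k2(2)
      using dir[OF k1(1)] dir[OF k2(1)] by (meson ennreal_leI order_trans)
  qed
  let ?v = "proj_perp p r u *\<^sub>v a"
  show "ennreal (15/2048 * (sqrt ((lam l + \<sigma>\<^sup>2) * \<sigma>\<^sup>2 / ((lam l)\<^sup>2 * real n)) * vec_norm2 ?v))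
    \<le> minimax_risk p n l \<sigma> a (M2 p r n l \<sigma> lam u)"
  proof (cases "\<sigma> = 0 \<or> scalar_prod ?v ?v = 0")
    case True
    \<comment> \<open>the lower bound is zero\<close>
    then show ?thesis by (auto simp: vec_norm2_def)
  next
    case False
    have "0 \<le> lam l + \<sigma>\<^sup>2" using pos[OF l] by (intro add_nonneg_nonneg) auto
    then have "0 \<le> sqrt ((lam l + \<sigma>\<^sup>2) * \<sigma>\<^sup>2 / ((lam l)\<^sup>2 * real n))" by simp
    moreover have "0 \<le> vec_norm2 ?v"
    proof -
      have "0 \<le> scalar_prod ?v ?v" using scalar_prod_sum[OF proj_perp_residual(1)[OF u a], of ?v] by (simp add: sum_nonneg)
      then show ?thesis by (simp add: vec_norm2_def)
    qed
    ultimately have "15/2048 * (sqrt ((lam l + \<sigma>\<^sup>2) * \<sigma>\<^sup>2 / ((lam l)\<^sup>2 * real n)) * vec_norm2 ?v)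
        \<le> 15/1024 * (sqrt ((lam l + \<sigma>\<^sup>2) * \<sigma>\<^sup>2 / ((lam l)\<^sup>2 * real n)) * vec_norm2 ?v)"
      by (intro mult_right_mono mult_nonneg_nonneg) auto
    then show ?thesis using minimax_M2_direction[OF a, of \<sigma> n] False n by (meson ennreal_leI max.boundedE order_trans)
  qed
qed

end
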